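(* Let $G$ be a minimal graph, $\alpha\in X_G$, $\tau\in i\mathbb R_{>0}$, $t\in\mathbb R+\frac{\pi}{2}\tau$, and assume condition $( * )$: every finite, simply connected subgraph $G_0$ of $G$ can be embedded in a periodic minimal graph $G'$, with the restriction of $\alpha$ to the train-tracks of $G_0$ extending to an element of $X_{G'}$. Consider an edge $wb$ of $G$ with train-track half-angles $\alpha,\beta$, and set $t_b=t-\frac{\pi}{2}\tau+\eta(b)$. The probability that this edge occurs in a dimer configuration of $G$ chosen with respect to the Gibbs measure $\mathbb P^{u_0}$ is given by the following. 1. Gaseous phase: if $u_0$ belongs to the component $C_1$ of $D$, then $$\mathbb P^{u_0}(wb)=\frac{\beta-\alpha}{\pi}+\frac{K'}{\pi}\bigl[\tilde Z(\beta-t_b)-\tilde Z(\alpha-t_b)\bigr]=H^{u_0}(\beta-t_b)-H^{u_0}(\alpha-t_b),$$ where $H^{u_0}(u)=\frac{K'}{\pi}\tilde Z(u)+\frac{u}{\pi}$. 2. Liquid phase: if $u_0$ belongs to the interior of $D$, then $$\mathbb P^{u_0}(wb)=\frac{1}{2\pi i}\log\frac{\theta(\beta-u_0)\theta(\alpha-\bar u_0)}{\theta(\beta-\bar u_0)\theta(\alpha-u_0)}-\frac{iK}{\pi^2}(u_0-\bar u_0)\bigl[\tilde Z(\beta-t_b)-\tilde Z(\alpha-t_b)\bigr].$$ 3. Solid phases: if $u_0$ belongs to $C_0\setminus\{\alpha_T:T\in\mathcal T\}$, then $\mathbb P^{u_0}(wb)=\mathbf 1_{\{\alpha<u_0<\beta\text{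 on }C_0\}}$, i.e. it equals $1$ if $u_0$ lies on the arc of $C_0$ from $\alpha$ to $\beta$ in the positive direction and $0$ otherwise. Moreover, around every black vertex $b$ there is exactly one edge $wb$ incident to $b$ such that $\mathbb P^{u_0}(wb)=1$, so that the dimer model is deterministic.
   Context: Graphs. $G$ is an infinite, locally finite bipartite graph with vertex set $V=B\sqcup W$ (black, white), embedded in the plane so that its faces are bounded topological discs; $G^*$ is the dual graph, with vertex set $V^*$. The quad-graph $G^\diamond$ has vertex set $V\sqcup V^*$, with $v\in V$ joined to $f\in V^*$ each time $v$ lies on the boundary of the face $f$; its faces are quadrilaterals whose diagonals are an edge of $G$ and its dual edge. A train-track is a maximal chain of adjacent quadrilaterals of $G^\diamond$ such that when it enters a quadrilateral it exits through the opposite edge; it is viewed as a path crossing these opposite edges, oriented so that black vertices are on its right and white vertices on its left. $\mathcal T$ is the set of oriented train-tracks. $G$ is minimal if no train-track self-intersects and there are no parallel bigons, i.e. no two oriented train-tracks intersecting twice and joining these two intersection points in the same direction. Two oriented train-tracks are parallel (resp. anti-parallel) if they are disjoint and there is a topological disc that they cross in the same (resp. opposite) direction. Cyclic order on $\mathcal T$ ($G$ minimal): for three pairwise non-parallel oriented train-tracks, if two of them intersect infinitely often (necessarily in opposite directions) replace them by anti-parallel disjoint oriented curves; outside a large compact disc the three curves do not meet, and they are cyclically ordered by their outgoing points on the boundary of the disc. $X_G$ is the set of maps $\alpha:\mathcal T\to\mathbb R/\pi\mathbb Z$, $T\mapsto\alpha_T$, that are monotone for the cyclic orders and map pairs of intersecting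 or anti-parallel train-tracks to distinct values. Fock's operator. $\theta(z)=2\sum_{n\ge0}(-1)^nq^{(n+1/2)^2}\sin((2n+1)z)$ with $q=e^{i\pi\tau}$; $\mathbb T(q)=\mathbb C/(\pi\mathbb Z+\pi\tau\mathbb Z)$, $C_0=\mathbb R/\pi\mathbb Z$, $C_1=(\mathbb R+\frac{\pi}{2}\tau)/\pi\mathbb Z$. The discrete Abel map $\eta$ assigns to vertices of $G^\diamond$ elements of $\mathbb R/\pi\mathbb Z$: $\eta(v_0)=0$ at a fixed vertex $v_0$, and when traversing an edge of $G^\diamond$ crossed by $T$, $\eta$ increases by $\alpha_T$ if $T$ goes from right to left and decreases by $\alpha_T$ if $T$ goes from left to right. For an edge $wb$, let $w,f',b,f$ be the vertices in counterclockwise order of the face of $G^\diamond$ containing $wb$; $\alpha$ denotes the half-angle of the train-track crossing $wf'$ and $bf$, and $\beta$ that of the train-track crossing $wf$ and $bf'$ (when lifts to $\mathbb R$ are needed, $\alpha<\beta<\alpha+\pi$). Then $K^{(t)}_{w,b}=\dfrac{\theta(\beta-\alpha)}{\theta(t+\eta(b)-\beta)\theta(t+\eta(b)-\alpha)}$; all other coefficients are $0$. Gibbs measures. For an edge of $G^\diamond$ crossed by a train-track of half-angle $\alpha$, $g_{f,w}(u)=g_{w,f}(u)^{-1}=\frac{\theta(u+t+\eta(w))}{\theta(u-\alpha)}$ and $g_{b,f}(u)=g_{f,b}(u)^{-1}=\frac{\theta(u-t-\eta(b))}{\theta(u-\alpha)}$; $g_{x,y}$ is the product along any path of $G^\diamond$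 from $x$ to $y$. There is a partition of $C_0$ into two intervals, one containing no poles of $g_{b,w}$ and the other no zeros. If $g_{b,w}$ has a zero and a pole on $C_0$, the sector $s_{b,w}$ is the part containing the poles; if $g_{b,w}$ has no zeros on $C_0$ (which happens when $b,w$ are neighbours), $s_{b,w}$ is the arc of $C_0$ from $\alpha$ to $\beta$ in the positive direction, where, $w,f',b,f$ being the vertices in counterclockwise order of the face of $G^\diamond$ containing the edge $wb$, $\alpha$ is the half-angle of the train-track crossing $wf'$ and $bf$, and $\beta$ is that of the train-track crossing $wf$ and $bf'$. Let $D=(\mathbb R/\pi\mathbb Z+[0,\frac{\pi}{2}\tau])\setminus\{\alpha_T:T\in\mathcal T\}$. The path $\mathcal C^{u_0}_{b,w}$ in $\mathbb T(q)$ is: if $u_0\in C_1$, a simple closed contour winding once vertically from bottom to top (no net horizontal winding), whose intersection with $C_0$ avoids $s_{b,w}$; if $u_0$ is in the interior of $D$, a simple path from $\bar u_0$ to $u_0$ (no net horizontal winding) crossing $C_0$ once but not $C_1$, avoiding $s_{b,w}$; if $u_0\in C_0\setminus\{\alpha_T\}$, a simple homologically trivial counterclockwise closed contour crossing $C_0$ twice: once in the complement of $s_{b,w}$ from bottom to top, and once, from top to bottom, in the open interval of $C_0\setminus\{\alpha_T\}$ containing $u_0$. Then $A^{u_0}_{b,w}=\frac{i\theta'(0)}{2\pi}\int_{\mathcal C^{u_0}_{b,w}}g_{b,w}(u)\,du$, and $\mathbb P^{u_0}$ is the Gibbs measure on dimer configurations (perfect matchings) of $G$, for edge weights $|K^{(t)}_{w,b}|$,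 given by $\mathbb P^{u_0}(e_1,\dots,e_k)=\prod_jK^{(t)}_{w_j,b_j}\det(A^{u_0}_{b_i,w_j})$ for distinct edges $e_j=w_jb_j$. Notation. With $\theta_3,\theta_4$ the third and fourth Jacobi theta functions of nome $q$: $K=\frac{\pi}{2}\theta_3(0)^2$, $K'=-i\tau K$ (constants, not to be confused with the operator), $\tilde Z(u)=\frac{\pi}{2K}\frac{\theta_4'(u)}{\theta_4(u)}$. In item 2, $\log$ is the determination obtained by continuous variation of $\log\frac{\theta(u-u_0)}{\theta(u-\bar u_0)}$ as $u$ goes from $\alpha$ to $\beta$ along $C_0$ in the positive direction. *)

theory Defs
  imports
    "HOL-Complex_Analysis.Complex_Analysis"
    "HOL-Probability.Probability"
    "HOL-Library.Real_Mod"
    "Jordan_Normal_Form.Determinant"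
begin

section \<open>Embedded graphs and their quad-graphs\<close>

type_synonym curve = "real \<Rightarrow> complex"

text \<open>
  The bipartite graph \<open>G\<close> is given by its edges, each one an arc in the plane oriented from its
  white to its black endpoint. Its quad-graph is given by the edges of the latter (the spokes), each
  one an arc oriented from a vertex of \<open>G\<close> to a dual vertex. The vertices are the endpoints of arcs.
\<close>

record plane_graph =
  edges :: "curve set"
  spokes :: "curve set"

type_synonym track = "curve set"

definition open_arc :: "curve \<Rightarrow> complex set" where
  "open_arc p = p ` {0<..<1}"

definition support :: "curve set \<Rightarrow> complex set" where
  "support A = \<Union> (path_image ` A)"

definition embedded_arcs :: "curve set \<Rightarrow> bool" where
  "embedded_arcs A \<longleftrightarrow>
     (\<forall>p\<in>A. arc p) \<and>
     (\<forall>p\<in>A. \<forall>q\<in>A. p \<noteq> q \<longrightarrow>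
        path_image p \<inter> path_image q \<subseteq> {pathstart p, pathfinish p} \<inter> {pathstart q, pathfinish q}) \<and>
     (\<forall>X. compact X \<longrightarrow> finite {p \<in> A. path_image p \<inter> X \<noteq> {}})"

abbreviation white :: "curve \<Rightarrow> complex" where "white e \<equiv> pathstart e"
abbreviation black :: "curve \<Rightarrow> complex" where "black e \<equiv> pathfinish e"

definition whites :: "plane_graph \<Rightarrow> complex set" where
  "whites G = white ` edges G"

definition blacks :: "plane_graph \<Rightarrow> complex set" where
  "blacks G = black ` edges G"

definition faces :: "curve set \<Rightarrow> complex set set" where
  "faces A = components (- support A)"

definition bipartite_plane_graph :: "plane_graph \<Rightarrow> bool" where
  "bipartite_plane_graph G \<longleftrightarrow>
     embedded_arcs (edges G) \<and> infinite (edges G) \<and> whites G \<inter> blacks G = {} \<and>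
     (\<forall>f\<in>faces (edges G). bounded f \<and> f homeomorphic ball (0::complex) 1)"

text \<open>
  \<open>is_quad G e (s1, s2, s3, s4)\<close>: writing \<open>w, f', b, f\<close> for the vertices, in counterclockwise order,
  of the face of the quad-graph containing the edge \<open>e = wb\<close>, the four sides of this face are
  \<open>s1 = wf'\<close>, \<open>s2 = bf'\<close>, \<open>s3 = bf\<close> and \<open>s4 = wf\<close>.
\<close>

definition is_quad :: "plane_graph \<Rightarrow> curve \<Rightarrow> curve \<times> curve \<times> curve \<times> curve \<Rightarrow> bool" where
  "is_quad G e = (\<lambda>(s1, s2, s3, s4).
     let loop = s1 +++ reversepath s2 +++ s3 +++ reversepath s4 in
     {s1, s2, s3, s4} \<subseteq> spokes G \<and>
     pathstart s1 = white e \<and> pathstart s4 = white e \<and>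
     pathstart s2 = black e \<and> pathstart s3 = black e \<and>
     pathfinish s1 = pathfinish s2 \<and> pathfinish s3 = pathfinish s4 \<and>
     simple_path loop \<and>
     inside (path_image loop) \<in> faces (spokes G) \<and>
     open_arc e \<subseteq> inside (path_image loop) \<and>
     (\<forall>z \<in> inside (path_image loop). winding_number loop z = 1))"

definition is_quad_graph :: "plane_graph \<Rightarrow> bool" where
  "is_quad_graph G \<longleftrightarrow>
     embedded_arcs (spokes G) \<and>
     (\<forall>s\<in>spokes G. pathstart s \<in> whites G \<union> blacks G \<and>
        (\<exists>f\<in>faces (edges G). path_image s - {pathstart s} \<subseteq> f)) \<and>
     (\<forall>f\<in>faces (edges G). \<exists>!x. x \<in> f \<and> x \<in> pathfinish ` spokes G) \<and>
     (\<forall>Q\<in>faces (spokes G). \<exists>!e. e \<in> edges G \<and> open_arc e \<subseteq> Q) \<and>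
     (\<forall>e\<in>edges G. \<exists>q. is_quad G e q)"

definition quad :: "plane_graph \<Rightarrow> curve \<Rightarrow> curve \<times> curve \<times> curve \<times> curve" where
  "quad G e = (THE q. is_quad G e q)"

definition quad_face :: "plane_graph \<Rightarrow> curve \<Rightarrow> complex set" where
  "quad_face G e = connected_component_set (- support (spokes G)) (e (1/2))"


section \<open>Train-tracks\<close>

text \<open>
  A spoke is crossed by exactly one oriented train-track, which has the spoke's white end on its left
  or its black end on its right. In the quad \<open>w, f', b, f\<close> these orientations force one train-track
  to enter through \<open>wf'\<close> and leave through \<open>bf\<close>, and the other one to enter through \<open>bf'\<close> and leave
  through \<open>wf\<close>. An oriented train-track is represented by the set of spokes that it crosses.
\<close>

definition quad_steps :: "plane_graph \<Rightarrow> curve \<Rightarrow> (curve \<times> curve) set" where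
  "quad_steps G e = (case quad G e of (s1, s2, s3, s4) \<Rightarrow> {(s1, s3), (s2, s4)})"

definition steps :: "plane_graph \<Rightarrow> (curve \<times> curve) set" where
  "steps G = (\<Union>e\<in>edges G. quad_steps G e)"

definition track_of :: "plane_graph \<Rightarrow> curve \<Rightarrow> track" where
  "track_of G s = (steps G \<union> (steps G)\<inverse>)\<^sup>* `` {s}"

definition tracks :: "plane_graph \<Rightarrow> track set" where
  "tracks G = track_of G ` spokes G"

text \<open>The train-tracks of half-angles \<open>\<alpha>\<close> (first) and \<open>\<beta>\<close> (second) through an edge.\<close>

definition alpha_track :: "plane_graph \<Rightarrow> curve \<Rightarrow> track" where
  "alpha_track G e = (case quad G e of (s1, s2, s3, s4) \<Rightarrow> track_of G s1)"

definition beta_track :: "plane_graph \<Rightarrow> curve \<Rightarrow> track" where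
  "beta_track G e = (case quad G e of (s1, s2, s3, s4) \<Rightarrow> track_of G s2)"

definition tracks_intersect :: "plane_graph \<Rightarrow> track \<Rightarrow> track \<Rightarrow> bool" where
  "tracks_intersect G T T' \<longleftrightarrow> (\<exists>e\<in>edges G. {alpha_track G e, beta_track G e} = {T, T'})"

definition parallel_bigon :: "plane_graph \<Rightarrow> curve \<Rightarrow> curve \<Rightarrow> bool" where
  "parallel_bigon G e e' \<longleftrightarrow> e \<noteq> e' \<and>
     (case (quad G e, quad G e') of ((s1, s2, _, _), (s1', s2', _, _)) \<Rightarrow>
        (s1, s1') \<in> (steps G)\<^sup>+ \<and> (s2, s2') \<in> (steps G)\<^sup>+ \<or>
        (s1, s2') \<in> (steps G)\<^sup>+ \<and> (s2, s1') \<in> (steps G)\<^sup>+)"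

definition minimal :: "plane_graph \<Rightarrow> bool" where
  "minimal G \<longleftrightarrow>
     (\<forall>e\<in>edges G. alpha_track G e \<noteq> beta_track G e) \<and>
     (\<forall>e\<in>edges G. \<forall>e'\<in>edges G. \<not> parallel_bigon G e e')"

definition minimal_graph :: "plane_graph \<Rightarrow> bool" where
  "minimal_graph G \<longleftrightarrow> bipartite_plane_graph G \<and> is_quad_graph G \<and> minimal G"

definition track_curve :: "plane_graph \<Rightarrow> track \<Rightarrow> curve \<Rightarrow> bool" where
  "track_curve G T c \<longleftrightarrow> continuous_on UNIV c \<and> inj c \<and>
     (\<exists>\<sigma> :: int \<Rightarrow> curve. range \<sigma> = T \<and>
        (\<forall>n. c (of_int n) \<in> open_arc (\<sigma> n) \<and>
             (\<exists>e\<in>edges G. (\<sigma> n, \<sigma> (n + 1)) \<in> quad_steps G e \<and>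
                          c ` {of_int n<..<of_int n + 1} \<subseteq> quad_face G e)))"

text \<open>
  A topological disc crossed by two disjoint oriented curves, once each, is presented as the
  homeomorphic image of the unit square, in which the two curves become the horizontal chords at
  heights \<open>1/3\<close> and \<open>2/3\<close>. A chord is run through from abscissa \<open>x0\<close> to abscissa \<open>1 - x0\<close>.
\<close>

definition unit_square :: "complex set" where
  "unit_square = {z. 0 \<le> Re z \<and> Re z \<le> 1 \<and> 0 \<le> Im z \<and> Im z \<le> 1}"

definition crosses_square :: "curve \<Rightarrow> (complex \<Rightarrow> complex) \<Rightarrow> real \<Rightarrow> real \<Rightarrow> bool" where
  "crosses_square c \<phi> y x0 \<longleftrightarrow> (\<exists>r r'. r < r' \<and>
     {x. c x \<in> \<phi> ` unit_square} = {r..r'} \<and>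
     c ` {r..r'} = \<phi> ` {z \<in> unit_square. Im z = y} \<and>
     c r = \<phi> (Complex x0 y) \<and> c r' = \<phi> (Complex (1 - x0) y))"

definition cross_disc :: "plane_graph \<Rightarrow> track \<Rightarrow> track \<Rightarrow> real \<Rightarrow> bool" where
  "cross_disc G T T' x0 \<longleftrightarrow> (\<exists>c c' \<phi>. track_curve G T c \<and> track_curve G T' c' \<and>
     continuous_on unit_square \<phi> \<and> inj_on \<phi> unit_square \<and>
     crosses_square c \<phi> (1/3) 0 \<and> crosses_square c' \<phi> (2/3) x0)"

definition parallel :: "plane_graph \<Rightarrow> track \<Rightarrow> track \<Rightarrow> bool" where
  "parallel G T T' \<longleftrightarrow> T \<noteq> T' \<and> \<not> tracks_intersect G T T' \<and> cross_disc G T T' 0"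

definition antiparallel :: "plane_graph \<Rightarrow> track \<Rightarrow> track \<Rightarrow> bool" where
  "antiparallel G T T' \<longleftrightarrow> T \<noteq> T' \<and> \<not> tracks_intersect G T T' \<and> cross_disc G T T' 1"

text \<open>
  Cyclic order: counterclockwise order of the outgoing points on the boundary of a disc. Only the
  parts of the three curves after their last visit to the disc are required to be disjoint. When
  no two of the train-tracks meet infinitely often, a large disc outside of which the curves are
  disjoint has this property. When two of them do, then in a minimal graph the outgoing end of each
  still meets that of the other finitely often, and they can be replaced by disjoint anti-parallel
  curves by modifying their incoming ends only.
\<close>

definition cyclic_tracks :: "plane_graph \<Rightarrow> track \<Rightarrow> track \<Rightarrow> track \<Rightarrow> bool" where
  "cyclic_tracks G T1 T2 T3 \<longleftrightarrow>
     distinct [T1, T2, T3] \<and> {T1, T2, T3} \<subseteq> tracks G \<and>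
     (\<forall>T\<in>{T1, T2, T3}. \<forall>T'\<in>{T1, T2, T3}. \<not> parallel G T T') \<and>
     (\<exists>c1 c2 c3 R r1 r2 r3 a1 a2 a3.
        track_curve G T1 c1 \<and> track_curve G T2 c2 \<and> track_curve G T3 c3 \<and> R > 0 \<and>
        (\<forall>x>r1. norm (c1 x) > R) \<and> (\<forall>x>r2. norm (c2 x) > R) \<and> (\<forall>x>r3. norm (c3 x) > R) \<and>
        c1 ` {r1..} \<inter> c2 ` {r2..} = {} \<and>
        c2 ` {r2..} \<inter> c3 ` {r3..} = {} \<and>
        c1 ` {r1..} \<inter> c3 ` {r3..} = {} \<and>
        c1 r1 = of_real R * cis a1 \<and> c2 r2 = of_real R * cis a2 \<and> c3 r3 = of_real R * cis a3 \<and>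
        a1 < a2 \<and> a2 < a3 \<and> a3 < a1 + 2 * pi)"

definition cyclic_angles :: "real \<Rightarrow> real \<Rightarrow> real \<Rightarrow> bool" where
  "cyclic_angles x1 x2 x3 \<longleftrightarrow> (\<exists>a1 a2 a3.
     [a1 = x1] (rmod pi) \<and> [a2 = x2] (rmod pi) \<and> [a3 = x3] (rmod pi) \<and>
     a1 < a2 \<and> a2 < a3 \<and> a3 < a1 + pi)"

text \<open>
  Maps to \<open>\<real>/\<pi>\<int>\<close> are represented by real-valued lifts. The cyclic order on angles is strict:
  pairwise non-parallel train-tracks intersect or are anti-parallel, so their angles are distinct.
\<close>

definition angle_maps :: "plane_graph \<Rightarrow> (track \<Rightarrow> real) set" where
  "angle_maps G = {\<alpha>.
     (\<forall>T1 T2 T3. cyclic_tracks G T1 T2 T3 \<longrightarrow> cyclic_angles (\<alpha> T1) (\<alpha> T2) (\<alpha> T3)) \<and>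
     (\<forall>T\<in>tracks G. \<forall>T'\<in>tracks G. T \<noteq> T' \<and> (tracks_intersect G T T' \<or> antiparallel G T T') \<longrightarrow>
        \<not> [\<alpha> T = \<alpha> T'] (rmod pi))}"

definition edge_angles :: "plane_graph \<Rightarrow> (track \<Rightarrow> real) \<Rightarrow> curve \<Rightarrow> real \<Rightarrow> real \<Rightarrow> bool" where
  "edge_angles G \<alpha> e a b \<longleftrightarrow>
     [a = \<alpha> (alpha_track G e)] (rmod pi) \<and> [b = \<alpha> (beta_track G e)] (rmod pi) \<and>
     a < b \<and> b < a + pi"


section \<open>Approximation by periodic graphs\<close>

definition periodic :: "plane_graph \<Rightarrow> bool" where
  "periodic G \<longleftrightarrow> (\<exists>p q. Im (cnj p * q) \<noteq> 0 \<and>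
     (\<lambda>e x. e x + p) ` edges G = edges G \<and> (\<lambda>e x. e x + q) ` edges G = edges G)"

definition orientation_preserving_homeo :: "(complex \<Rightarrow> complex) \<Rightarrow> bool" where
  "orientation_preserving_homeo h \<longleftrightarrow>
     (\<exists>k. homeomorphism UNIV UNIV h k) \<and> winding_number (h \<circ> circlepath 0 1) (h 0) = 1"

definition simply_connected_subgraph :: "plane_graph \<Rightarrow> curve set \<Rightarrow> bool" where
  "simply_connected_subgraph G E0 \<longleftrightarrow> E0 \<subseteq> edges G \<and> connected (support E0) \<and>
     (\<forall>f\<in>faces E0. bounded f \<longrightarrow> f \<in> faces (edges G))"

definition periodic_extension_property :: "plane_graph \<Rightarrow> (track \<Rightarrow> real) \<Rightarrow> bool" where
  "periodic_extension_property G \<alpha> \<longleftrightarrow>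
     (\<forall>E0. finite E0 \<and> simply_connected_subgraph G E0 \<longrightarrow>
        (\<exists>G' \<alpha>' h. minimal_graph G' \<and> periodic G' \<and> \<alpha>' \<in> angle_maps G' \<and>
           orientation_preserving_homeo h \<and>
           (\<forall>f\<in>faces E0. bounded f \<longrightarrow> h ` f \<in> faces (edges G')) \<and>
           (\<forall>e\<in>E0. \<exists>e'\<in>edges G'.
              path_image e' = h ` path_image e \<and> white e' = h (white e) \<and> black e' = h (black e) \<and>
              [\<alpha>' (alpha_track G' e') = \<alpha> (alpha_track G e)] (rmod pi) \<and>
              [\<alpha>' (beta_track G' e') = \<alpha> (beta_track G e)] (rmod pi))))"


section \<open>Theta functions\<close>

text \<open>The nome is \<open>q = exp (i \<pi> \<tau>)\<close>.\<close>

definition theta :: "complex \<Rightarrow> complex \<Rightarrow> complex" where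
  "theta \<tau> z = 2 * (\<Sum>n. (-1) ^ n * exp (\<i> * of_real pi * \<tau> * (of_nat n + 1/2)\<^sup>2)
                       * sin (of_nat (2 * n + 1) * z))"

definition theta3 :: "complex \<Rightarrow> complex \<Rightarrow> complex" where
  "theta3 \<tau> z = 1 + 2 * (\<Sum>n. exp (\<i> * of_real pi * \<tau> * (of_nat (Suc n))\<^sup>2)
                           * cos (2 * of_nat (Suc n) * z))"

definition theta4 :: "complex \<Rightarrow> complex \<Rightarrow> complex" where
  "theta4 \<tau> z = 1 + 2 * (\<Sum>n. (-1) ^ Suc n * exp (\<i> * of_real pi * \<tau> * (of_nat (Suc n))\<^sup>2)
                           * cos (2 * of_nat (Suc n) * z))"

definition ell_K :: "complex \<Rightarrow> complex" where
  "ell_K \<tau> = of_real pi / 2 * (theta3 \<tau> 0)\<^sup>2"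

definition ell_K' :: "complex \<Rightarrow> complex" where
  "ell_K' \<tau> = - \<i> * \<tau> * ell_K \<tau>"

definition Ztilde :: "complex \<Rightarrow> complex \<Rightarrow> complex" where
  "Ztilde \<tau> u = of_real pi / (2 * ell_K \<tau>) * (deriv (theta4 \<tau>) u / theta4 \<tau> u)"


section \<open>Fock's operator\<close>

text \<open>
  The Abel map is lifted to the reals compatibly with the lift of the half-angles. Changing the
  latter changes neither \<open>fock_K\<close> nor the functions \<open>g_fun\<close> between a black and a white vertex below,
  the signs of the theta factors cancelling. A train-track with the white end of a
  spoke on its left (resp. the black end on its right) crosses the spoke, run through
  from this end, from right to left (resp. from left to right).
\<close>

definition abel_map :: "plane_graph \<Rightarrow> (track \<Rightarrow> real) \<Rightarrow> complex \<Rightarrow> (complex \<Rightarrow> real) \<Rightarrow> bool" where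
  "abel_map G \<alpha> v0 \<eta> \<longleftrightarrow>
     v0 \<in> pathstart ` spokes G \<union> pathfinish ` spokes G \<and> \<eta> v0 = 0 \<and>
     (\<forall>s\<in>spokes G. \<eta> (pathfinish s) =
        (if pathstart s \<in> whites G then \<eta> (pathstart s) + \<alpha> (track_of G s)
         else \<eta> (pathstart s) - \<alpha> (track_of G s)))"

definition fock_K ::
  "plane_graph \<Rightarrow> (track \<Rightarrow> real) \<Rightarrow> complex \<Rightarrow> complex \<Rightarrow> (complex \<Rightarrow> real) \<Rightarrow> curve \<Rightarrow> complex" where
  "fock_K G \<alpha> \<tau> t \<eta> e =
     (let a = of_real (\<alpha> (alpha_track G e)); b = of_real (\<alpha> (beta_track G e)); x = of_real (\<eta> (black e)) in
      theta \<tau> (b - a) / (theta \<tau> (t + x - b) * theta \<tau> (t + x - a)))"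


section \<open>The functions g and the sectors\<close>

text \<open>A dart is a spoke, run through forwards (\<open>True\<close>) or backwards (\<open>False\<close>).\<close>

type_synonym dart = "curve \<times> bool"

definition dart_src :: "dart \<Rightarrow> complex" where
  "dart_src d = (if snd d then pathstart (fst d) else pathfinish (fst d))"

definition dart_tgt :: "dart \<Rightarrow> complex" where
  "dart_tgt d = (if snd d then pathfinish (fst d) else pathstart (fst d))"

fun is_walk :: "plane_graph \<Rightarrow> complex \<Rightarrow> dart list \<Rightarrow> complex \<Rightarrow> bool" where
  "is_walk G x [] y \<longleftrightarrow> x = y"
| "is_walk G x (d # ds) y \<longleftrightarrow> fst d \<in> spokes G \<and> dart_src d = x \<and> is_walk G (dart_tgt d) ds y"

definition g_dart ::
  "plane_graph \<Rightarrow> (track \<Rightarrow> real) \<Rightarrow> complex \<Rightarrow> complex \<Rightarrow> (complex \<Rightarrow> real) \<Rightarrow> dart \<Rightarrow> complex \<Rightarrow> complex"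
where
  "g_dart G \<alpha> \<tau> t \<eta> d u =
     (let v = pathstart (fst d); x = of_real (\<eta> v); a = of_real (\<alpha> (track_of G (fst d)));
          g_fw = theta \<tau> (u + t + x) / theta \<tau> (u - a);
          g_bf = theta \<tau> (u - t - x) / theta \<tau> (u - a)
      in if v \<in> whites G then (if snd d then inverse g_fw else g_fw)
         else (if snd d then g_bf else inverse g_bf))"

definition g_fun ::
  "plane_graph \<Rightarrow> (track \<Rightarrow> real) \<Rightarrow> complex \<Rightarrow> complex \<Rightarrow> (complex \<Rightarrow> real) \<Rightarrow>
   complex \<Rightarrow> complex \<Rightarrow> complex \<Rightarrow> complex" where
  "g_fun G \<alpha> \<tau> t \<eta> x y u = prod_list (map (\<lambda>d. g_dart G \<alpha> \<tau> t \<eta> d u) (SOME ds. is_walk G x ds y))"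

text \<open>
  A sector is represented by its preimage in the reals. Zeros are detected by limits because the value
  of \<open>g_fun\<close> at its poles is \<open>0\<close> by convention.

  The three cases are: there are zeros on the real circle, and the sector is the hull of
  the poles in the complement of the zeros; \<open>b\<close> and \<open>w\<close> are neighbours, and the sector is the
  arc from \<open>\<alpha>\<close> to \<open>\<beta>\<close>; or there are no zeros and \<open>b\<close>, \<open>w\<close> are not neighbours (this occurs
  for two vertices of a common face), and any arc spanned by the poles is admitted. Statements
  are to be read for all systems of sectors.
\<close>

definition is_sector ::
  "plane_graph \<Rightarrow> (track \<Rightarrow> real) \<Rightarrow> complex \<Rightarrow> complex \<Rightarrow> (complex \<Rightarrow> real) \<Rightarrow>
   complex \<Rightarrow> complex \<Rightarrow> real set \<Rightarrow> bool" where
  "is_sector G \<alpha> \<tau> t \<eta> b w S \<longleftrightarrow> (\<exists>l r. l \<le> r \<and> r < l + pi \<and>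
     S = {x. \<exists>k::int. l \<le> x + of_int k * pi \<and> x + of_int k * pi \<le> r} \<and>
     is_pole (g_fun G \<alpha> \<tau> t \<eta> b w) (of_real l) \<and> is_pole (g_fun G \<alpha> \<tau> t \<eta> b w) (of_real r) \<and>
     (\<forall>x::real. is_pole (g_fun G \<alpha> \<tau> t \<eta> b w) (of_real x) \<longrightarrow> x \<in> S) \<and>
     (\<forall>x::real. (g_fun G \<alpha> \<tau> t \<eta> b w \<longlongrightarrow> 0) (at (of_real x)) \<longrightarrow> x \<notin> S) \<and>
     (\<forall>e\<in>edges G. black e = b \<and> white e = w \<longrightarrow> edge_angles G \<alpha> e l r))"

definition sector_system ::
  "plane_graph \<Rightarrow> (track \<Rightarrow> real) \<Rightarrow> complex \<Rightarrow> complex \<Rightarrow> (complex \<Rightarrow> real) \<Rightarrow>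
   (complex \<Rightarrow> complex \<Rightarrow> real set) \<Rightarrow> bool" where
  "sector_system G \<alpha> \<tau> t \<eta> s \<longleftrightarrow> (\<forall>b\<in>blacks G. \<forall>w\<in>whites G. is_sector G \<alpha> \<tau> t \<eta> b w (s b w))"


section \<open>Contours\<close>

text \<open>
  Points of the torus \<open>\<complex>/(\<pi>\<int> + \<pi>\<tau>\<int>)\<close> and paths on it are represented by lifts to the plane,
  those of the parameter \<open>u0\<close> by lifts to the strip between the real line and its translate by
  \<open>\<pi>\<tau>/2\<close>. It is assumed that \<open>\<tau>\<close> is purely imaginary.
\<close>

definition torus_eq :: "complex \<Rightarrow> complex \<Rightarrow> complex \<Rightarrow> bool" where
  "torus_eq \<tau> z w \<longleftrightarrow> (\<exists>m n::int. z - w = of_int m * of_real pi + of_int n * of_real pi * \<tau>)"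

definition on_C0 :: "complex \<Rightarrow> complex \<Rightarrow> bool" where
  "on_C0 \<tau> z \<longleftrightarrow> (\<exists>k::int. Im z = of_int k * pi * Im \<tau>)"

definition on_C1 :: "complex \<Rightarrow> complex \<Rightarrow> bool" where
  "on_C1 \<tau> z \<longleftrightarrow> (\<exists>k::int. Im z = (of_int k + 1/2) * pi * Im \<tau>)"

definition angle_points :: "plane_graph \<Rightarrow> (track \<Rightarrow> real) \<Rightarrow> real set" where
  "angle_points G \<alpha> = {x. \<exists>T\<in>tracks G. [x = \<alpha> T] (rmod pi)}"

definition domain_D :: "plane_graph \<Rightarrow> (track \<Rightarrow> real) \<Rightarrow> complex \<Rightarrow> complex set" where
  "domain_D G \<alpha> \<tau> = {u. 0 \<le> Im u \<and> Im u \<le> Im (of_real pi / 2 * \<tau>)} - of_real ` angle_points G \<alpha>"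

definition gas_points :: "complex \<Rightarrow> complex set" where
  "gas_points \<tau> = {u. Im u = Im (of_real pi / 2 * \<tau>)}"

definition liquid_points :: "plane_graph \<Rightarrow> (track \<Rightarrow> real) \<Rightarrow> complex \<Rightarrow> complex set" where
  "liquid_points G \<alpha> \<tau> = interior (domain_D G \<alpha> \<tau>)"

definition solid_points :: "plane_graph \<Rightarrow> (track \<Rightarrow> real) \<Rightarrow> complex set" where
  "solid_points G \<alpha> = of_real ` (- angle_points G \<alpha>)"

definition gas_contour :: "complex \<Rightarrow> real set \<Rightarrow> curve \<Rightarrow> bool" where
  "gas_contour \<tau> S C \<longleftrightarrow>
     valid_path C \<and> pathfinish C = pathstart C + of_real pi * \<tau> \<and>
     (\<forall>x\<in>{0..<1}. \<forall>y\<in>{0..<1}. torus_eq \<tau> (C x) (C y) \<longrightarrow> x = y) \<and>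
     (\<forall>x\<in>{0..1}. on_C0 \<tau> (C x) \<longrightarrow> Re (C x) \<notin> S)"

definition liquid_contour :: "complex \<Rightarrow> real set \<Rightarrow> complex \<Rightarrow> curve \<Rightarrow> bool" where
  "liquid_contour \<tau> S u0 C \<longleftrightarrow>
     valid_path C \<and> pathstart C = cnj u0 \<and> pathfinish C = u0 \<and>
     (\<forall>x\<in>{0..1}. \<forall>y\<in>{0..1}. torus_eq \<tau> (C x) (C y) \<longrightarrow> x = y) \<and>
     (\<exists>!x. x \<in> {0..1} \<and> on_C0 \<tau> (C x)) \<and>
     (\<forall>x\<in>{0..1}. \<not> on_C1 \<tau> (C x)) \<and>
     (\<forall>x\<in>{0..1}. on_C0 \<tau> (C x) \<longrightarrow> Re (C x) \<notin> S)"

text \<open>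
  The lift of a homologically trivial loop is a loop. It is chosen to cross the real line (upwards at
  time \<open>x1\<close> and downwards at time \<open>x2\<close>), to start below it, and to cross downwards in the interval
  around the lift of \<open>u0\<close> under consideration rather than in a translate of it.
\<close>

definition solid_contour ::
  "plane_graph \<Rightarrow> (track \<Rightarrow> real) \<Rightarrow> complex \<Rightarrow> real set \<Rightarrow> complex \<Rightarrow> curve \<Rightarrow> bool" where
  "solid_contour G \<alpha> \<tau> S u0 C \<longleftrightarrow>
     valid_path C \<and> pathfinish C = pathstart C \<and>
     (\<forall>x\<in>{0..<1}. \<forall>y\<in>{0..<1}. torus_eq \<tau> (C x) (C y) \<longrightarrow> x = y) \<and>
     (\<forall>z \<in> inside (path_image C). winding_number C z = 1) \<and>
     (\<exists>x1 x2. 0 < x1 \<and> x1 < x2 \<and> x2 < 1 \<and>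
        {x\<in>{0..1}. on_C0 \<tau> (C x)} = {x1, x2} \<and>
        Im (C 0) < 0 \<and> Im (C x1) = 0 \<and> (\<forall>x\<in>{x1<..<x2}. Im (C x) > 0) \<and> Im (C x2) = 0 \<and>
        Re (C x1) \<notin> S \<and>
        Re (C x2) \<in> connected_component_set (- angle_points G \<alpha>) (Re u0))"

definition is_contour ::
  "plane_graph \<Rightarrow> (track \<Rightarrow> real) \<Rightarrow> complex \<Rightarrow> real set \<Rightarrow> complex \<Rightarrow> curve \<Rightarrow> bool" where
  "is_contour G \<alpha> \<tau> S u0 C \<longleftrightarrow>
     (u0 \<in> gas_points \<tau> \<and> gas_contour \<tau> S C) \<or>
     (u0 \<in> liquid_points G \<alpha> \<tau> \<and> liquid_contour \<tau> S u0 C) \<or>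
     (u0 \<in> solid_points G \<alpha> \<and> solid_contour G \<alpha> \<tau> S u0 C)"

definition A_coeff ::
  "plane_graph \<Rightarrow> (track \<Rightarrow> real) \<Rightarrow> complex \<Rightarrow> complex \<Rightarrow> (complex \<Rightarrow> real) \<Rightarrow>
   (complex \<Rightarrow> complex \<Rightarrow> real set) \<Rightarrow> complex \<Rightarrow> complex \<Rightarrow> complex \<Rightarrow> complex" where
  "A_coeff G \<alpha> \<tau> t \<eta> s u0 b w =
     \<i> * deriv (theta \<tau>) 0 / (2 * of_real pi) *
     contour_integral (SOME C. is_contour G \<alpha> \<tau> (s b w) u0 C) (g_fun G \<alpha> \<tau> t \<eta> b w)"


section \<open>Dimers and Gibbs measures\<close>

definition dimer_configs :: "plane_graph \<Rightarrow> curve set set" where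
  "dimer_configs G = {\<omega>. \<omega> \<subseteq> edges G \<and>
     (\<forall>v \<in> whites G \<union> blacks G. \<exists>!e. e \<in> \<omega> \<and> v \<in> {white e, black e})}"

definition is_matching :: "curve set \<Rightarrow> bool" where
  "is_matching F \<longleftrightarrow> (\<forall>e\<in>F. \<forall>e'\<in>F. e \<noteq> e' \<longrightarrow> {white e, black e} \<inter> {white e', black e'} = {})"

definition covered :: "curve set \<Rightarrow> complex set" where
  "covered F = white ` F \<union> black ` F"

text \<open>
  The Gibbs property on cylinder events: given the configuration outside a finite set of edges,
  the configurations inside that cover the same vertices are weighted by the product of their
  edge weights. (The finite set \<open>F\<close> may include edges on which the two configurations agree.)
\<close>

definition gibbs_measure :: "plane_graph \<Rightarrow> (curve \<Rightarrow> real) \<Rightarrow> curve set measure \<Rightarrow> bool" where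
  "gibbs_measure G \<nu> M \<longleftrightarrow>
     prob_space M \<and> space M = dimer_configs G \<and>
     sets M = sigma_sets (dimer_configs G) ((\<lambda>e. {\<omega> \<in> dimer_configs G. e \<in> \<omega>}) ` edges G) \<and>
     (\<forall>F X Y. finite F \<and> F \<subseteq> edges G \<and> X \<subseteq> F \<and> Y \<subseteq> F \<and> is_matching X \<and> is_matching Y \<and>
        covered X = covered Y \<longrightarrow>
        measure M {\<omega> \<in> space M. \<omega> \<inter> F = X} * (\<Prod>e\<in>Y. \<nu> e) =
        measure M {\<omega> \<in> space M. \<omega> \<inter> F = Y} * (\<Prod>e\<in>X. \<nu> e))"

definition is_P ::
  "plane_graph \<Rightarrow> (track \<Rightarrow> real) \<Rightarrow> complex \<Rightarrow> complex \<Rightarrow> (complex \<Rightarrow> real) \<Rightarrow>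
   (complex \<Rightarrow> complex \<Rightarrow> real set) \<Rightarrow> complex \<Rightarrow> curve set measure \<Rightarrow> bool" where
  "is_P G \<alpha> \<tau> t \<eta> s u0 P \<longleftrightarrow>
     gibbs_measure G (\<lambda>e. norm (fock_K G \<alpha> \<tau> t \<eta> e)) P \<and>
     (\<forall>es. distinct es \<and> set es \<subseteq> edges G \<longrightarrow>
        complex_of_real (measure P {\<omega> \<in> space P. set es \<subseteq> \<omega>}) =
        prod_list (map (fock_K G \<alpha> \<tau> t \<eta>) es) *
        Determinant.det (Matrix.mat (length es) (length es)
          (\<lambda>(i, j). A_coeff G \<alpha> \<tau> t \<eta> s u0 (black (es ! i)) (white (es ! j)))))"

definition edge_prob :: "curve set measure \<Rightarrow> curve \<Rightarrow> real" where
  "edge_prob P e = measure P {\<omega> \<in> space P. e \<in> \<omega>}"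

definition log_variation :: "(real \<Rightarrow> complex) \<Rightarrow> real \<Rightarrow> real \<Rightarrow> complex \<Rightarrow> bool" where
  "log_variation f a b d \<longleftrightarrow>
     (\<exists>L. continuous_on {a..b} L \<and> (\<forall>x\<in>{a..b}. exp (L x) = f x) \<and> d = L b - L a)"

definition H_fun :: "complex \<Rightarrow> complex \<Rightarrow> complex" where
  "H_fun \<tau> u = ell_K' \<tau> / of_real pi * Ztilde \<tau> u + u / of_real pi"

end

theory Submission
  imports Defs
begin

text \<open>
  Taken for a single edge \<open>w b\<close>, the determinantal formula says that its probability is the Fock
  weight times \<open>A\<^sub>b\<^sub>,\<^sub>w\<close>, that is, one contour integral of \<open>g\<^sub>b\<^sub>,\<^sub>w\<close>. The proof makes the integrand
  explicit, finds primitives of it, and compares their values at the ends of the contour.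

  \<^bold>\<open>The integrand.\<close> Along the path \<open>b, f, w\<close> the function \<open>g\<^sub>b\<^sub>,\<^sub>w\<close> is a quotient of four theta functions,
  but it is defined by an arbitrary walk in the quad-graph. Its independence of the walk is a
  statement about the topology of the plane: every closed walk is an integer combination of
  boundaries of quads, the coefficient of a quad being the winding number of the walk around it
  (\<open>closed_walk_eq_quad_sum\<close>), and the product of \<open>g\<close> around a quad is \<open>1\<close>. With \<open>x = t + \<eta>(b)\<close> and
  \<open>L = \<theta>'/\<theta>\<close>, the identity \<open>fay_identity\<close> then turns \<open>\<theta>'(0) K\<^sub>w\<^sub>,\<^sub>b g\<^sub>b\<^sub>,\<^sub>w(u)\<close> into
  \<open>L(u - \<alpha>) - L(u - \<beta>) + c\<close> with \<open>c = L(x - \<beta>) - L(x - \<alpha>)\<close>. Both sides are elliptic functions of \<open>u\<close>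
  with the same simple poles and the same residues, and the constant is found by evaluating at the
  zero \<open>u = x\<close>. That there are no other poles amounts to \<open>\<theta>\<close> vanishing on the lattice only, which
  follows from Jacobi's infinite product. The latter is also a consequence of Liouville's theorem:
  the series and the product have the same multipliers, and the zeros of the product are simple.

  \<^bold>\<open>Gas and liquid.\<close> The function \<open>\<Lambda>(u)\<close>, the integral of \<open>L(u - s)\<close> over \<open>s\<close> from \<open>\<alpha>\<close> to \<open>\<beta>\<close>, is
  a single-valued primitive of \<open>L(u - \<alpha>) - L(u - \<beta>)\<close> on the torus slit along the sector, which is
  exactly where these contours run. One vertical turn changes \<open>\<Lambda>\<close> by \<open>-2 i (\<beta> - \<alpha>)\<close>, because
  \<open>L(u + \<pi>\<tau>) = L(u) - 2 i\<close>; this is the term \<open>(\<beta> - \<alpha>)/\<pi>\<close> of the gaseous phase. In the liquid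
  phase, \<open>\<Lambda>(cnj u\<^sub>0) - \<Lambda>(u\<^sub>0)\<close> is the variation of \<open>log (\<theta>(u - u\<^sub>0)/\<theta>(u - cnj u\<^sub>0))\<close> from \<open>\<alpha>\<close> to \<open>\<beta>\<close> since
  \<open>L\<close> is odd. The constant \<open>c\<close> gives the terms in \<open>Ztilde\<close>: a shift by \<open>\<pi>\<tau>/2\<close> exchanges \<open>\<theta>\<close> and
  \<open>\<theta>\<^sub>4\<close> up to an exponential.

  \<^bold>\<open>Solid.\<close> Here the contour may cross the sector on its way down, but it is closed and stays in
  the strip where \<open>\<theta>/sin\<close> has no zeros. So only \<open>sin (u - \<alpha>)/sin (u - \<beta>)\<close> matters. This quotient
  exchanges the upper and lower half-planes, is positive where the contour crosses the real axis
  upwards, and is negative at the second crossing exactly if \<open>u\<^sub>0\<close> lies between \<open>\<alpha>\<close> and \<open>\<beta>\<close>. Its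
  logarithm thus changes by \<open>-2 \<pi> i\<close> or by \<open>0\<close> (\<open>solid_contour_integral\<close>), and the probability is \<open>1\<close> or
  \<open>0\<close>. All edge probabilities being \<open>0\<close> or \<open>1\<close>, the set of edges of probability \<open>1\<close> is almost surely the
  dimer configuration, and hence is itself one.
\<close>

section \<open>Boundaries of the quads\<close>

lemma infinite_path_image_arc:
  fixes p :: "real \<Rightarrow> 'a::t2_space"
  assumes "arc p" shows "infinite (path_image p)"
proof -
  have "inj_on p {0..1}" using assms by (simp add: arc_def)
  moreover have "infinite {0..1::real}" by simp
  ultimately show ?thesis unfolding path_image_def using finite_image_iff by blast
qed

lemma interior_path_image_arc:
  fixes p :: "real \<Rightarrow> complex"
  assumes "arc p" shows "interior (path_image p) = {}"
proof (rule ccontr)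
  assume ne: "interior (path_image p) \<noteq> {}"
  from homeomorphism_arc[OF assms] obtain g where g: "homeomorphism {0..1} (path_image p) p g" by blast
  have "continuous_on (interior (path_image p)) g" "inj_on g (interior (path_image p))"
    using g interior_subset unfolding homeomorphism_def
    by (metis continuous_on_subset, metis inj_on_def subset_iff)
  then have "DIM(complex) \<le> DIM(real)"
    using invariance_of_dimension[of "interior (path_image p)" g] ne by auto
  then show False by simp
qed

text \<open>
  The boundary of a quad as a 1-chain. It runs through \<open>w, f', b, f, w\<close>, while spokes are
  oriented towards dual vertices, whence the alternating signs.
\<close>

definition quad_side :: "curve \<times> curve \<times> curve \<times> curve \<Rightarrow> curve \<Rightarrow> int" where
  "quad_side = (\<lambda>(s1, s2, s3, s4) s. of_bool (s = s1) - of_bool (s = s2) + of_bool (s = s3) - of_bool (s = s4))"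

text \<open>
  The pairing of the boundary of a quad with a function on spokes.
\<close>

definition quad_sum :: "curve \<times> curve \<times> curve \<times> curve \<Rightarrow> (curve \<Rightarrow> complex) \<Rightarrow> complex" where
  "quad_sum = (\<lambda>(s1, s2, s3, s4) X. X s1 - X s2 + X s3 - X s4)"

definition quad_set :: "curve \<times> curve \<times> curve \<times> curve \<Rightarrow> curve set" where
  "quad_set = (\<lambda>(s1, s2, s3, s4). {s1, s2, s3, s4})"

definition quad_loop :: "curve \<times> curve \<times> curve \<times> curve \<Rightarrow> curve" where
  "quad_loop = (\<lambda>(s1, s2, s3, s4). s1 +++ reversepath s2 +++ s3 +++ reversepath s4)"

text \<open>
  A 1-chain is given by its coefficients; the sum is only meaningful for a finite support.
\<close>

definition chain_sum :: "(curve \<Rightarrow> int) \<Rightarrow> (curve \<Rightarrow> complex) \<Rightarrow> complex" where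
  "chain_sum n X = (\<Sum>s | n s \<noteq> 0. of_int (n s) * X s)"

lemma chain_sum_superset:
  assumes "finite A" "{s. n s \<noteq> 0} \<subseteq> A"
  shows "chain_sum n X = (\<Sum>s\<in>A. of_int (n s) * X s)"
  unfolding chain_sum_def by (rule sum.mono_neutral_left) (use assms in auto)

lemma quad_side_eq_0: "s \<notin> quad_set q \<Longrightarrow> quad_side q s = 0"
  by (auto simp: quad_side_def quad_set_def split: prod.splits)

lemma finite_quad_set [simp]: "finite (quad_set q)"
  by (auto simp: quad_set_def split: prod.splits)

lemma sum_quad_side:
  assumes "finite A" "quad_set q \<subseteq> A"
  shows "(\<Sum>s\<in>A. of_int (quad_side q s) * X s) = quad_sum q X"
proof -
  obtain s1 s2 s3 s4 where q: "q = (s1, s2, s3, s4)" by (cases q)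
  have d: "(\<Sum>s\<in>A. of_bool (s = t) * X s) = X t" if "t \<in> A" for t
    using that assms(1) by (simp add: if_distrib[of "\<lambda>x. x * _"] of_bool_def sum.delta cong: if_cong)
  have "(\<Sum>s\<in>A. of_int (quad_side q s) * X s) = (\<Sum>s\<in>A. of_bool (s = s1) * X s) - (\<Sum>s\<in>A. of_bool (s = s2) * X s)
      + (\<Sum>s\<in>A. of_bool (s = s3) * X s) - (\<Sum>s\<in>A. of_bool (s = s4) * X s)"
    by (simp add: q quad_side_def sum.distrib sum_subtractf algebra_simps)
  also have "\<dots> = quad_sum q X" using assms(2) by (simp add: d quad_sum_def q quad_set_def)
  finally show ?thesis .
qed

lemma chain_sum_add_quad:
  assumes "finite {s. n s \<noteq> 0}"
  shows "chain_sum (\<lambda>s. n s + m * quad_side q s) X = chain_sum n X + of_int m * quad_sum q X"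
proof -
  let ?A = "{s. n s \<noteq> 0} \<union> quad_set q"
  have f: "finite ?A" using assms by simp
  have "chain_sum (\<lambda>s. n s + m * quad_side q s) X = (\<Sum>s\<in>?A. of_int (n s + m * quad_side q s) * X s)"
    by (rule chain_sum_superset) (use f quad_side_eq_0[of _ q] in auto)
  also have "\<dots> = (\<Sum>s\<in>?A. of_int (n s) * X s) + of_int m * (\<Sum>s\<in>?A. of_int (quad_side q s) * X s)"
    by (simp add: sum.distrib sum_distrib_left algebra_simps)
  also have "\<dots> = chain_sum n X + of_int m * quad_sum q X"
    using f by (simp add: sum_quad_side chain_sum_superset[of ?A n])
  finally show ?thesis .
qed

lemma is_quad_iff:
  "is_quad G e (s1, s2, s3, s4) \<longleftrightarrow>
     quad_set (s1, s2, s3, s4) \<subseteq> spokes G \<and>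
     pathstart s1 = white e \<and> pathstart s4 = white e \<and>
     pathstart s2 = black e \<and> pathstart s3 = black e \<and>
     pathfinish s1 = pathfinish s2 \<and> pathfinish s3 = pathfinish s4 \<and>
     simple_path (quad_loop (s1, s2, s3, s4)) \<and>
     inside (path_image (quad_loop (s1, s2, s3, s4))) \<in> faces (spokes G) \<and>
     open_arc e \<subseteq> inside (path_image (quad_loop (s1, s2, s3, s4))) \<and>
     (\<forall>z \<in> inside (path_image (quad_loop (s1, s2, s3, s4))).
        winding_number (quad_loop (s1, s2, s3, s4)) z = 1)"
  unfolding is_quad_def quad_loop_def quad_set_def by (simp add: Let_def)

locale quad_graph =
  fixes G :: plane_graph
  assumes bip: "bipartite_plane_graph G" and quads: "is_quad_graph G"
begin

lemma spoke_embedded: "embedded_arcs (spokes G)"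
  using quads by (simp add: is_quad_graph_def)

lemma spoke_arc: "s \<in> spokes G \<Longrightarrow> arc s"
  using spoke_embedded by (simp add: embedded_arcs_def)

lemma white_neq_black: "e \<in> edges G \<Longrightarrow> e' \<in> edges G \<Longrightarrow> white e \<noteq> black e'"
  using bip by (auto simp: bipartite_plane_graph_def whites_def blacks_def)

lemma quad_loop_facts:
  assumes "is_quad G e (s1, s2, s3, s4)"
  shows "path_image (quad_loop (s1, s2, s3, s4)) = path_image s1 \<union> path_image s2 \<union> path_image s3 \<union> path_image s4"
    and "pathfinish s1 \<noteq> pathfinish s3"
    and "pathstart (quad_loop (s1, s2, s3, s4)) = pathfinish (quad_loop (s1, s2, s3, s4))"
    and "z \<notin> path_image (quad_loop (s1, s2, s3, s4)) \<Longrightarrow>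
      winding_number (quad_loop (s1, s2, s3, s4)) z = quad_sum (s1, s2, s3, s4) (\<lambda>s. winding_number s z)"
proof -
  have q: "{s1, s2, s3, s4} \<subseteq> spokes G" "pathstart s1 = white e" "pathstart s4 = white e"
    "pathstart s2 = black e" "pathstart s3 = black e"
    "pathfinish s1 = pathfinish s2" "pathfinish s3 = pathfinish s4"
    "simple_path (quad_loop (s1, s2, s3, s4))"
    using assms by (simp_all add: is_quad_iff quad_set_def)
  have arcs: "arc s1" "arc s2" "arc s3" "arc s4" using q(1) spoke_arc by auto
  then have paths: "path s1" "path s2" "path s3" "path s4" by (auto simp: arc_imp_path)
  show im: "path_image (quad_loop (s1, s2, s3, s4)) = path_image s1 \<union> path_image s2 \<union> path_image s3 \<union> path_image s4"
    unfolding quad_loop_def using q by (simp add: path_image_join Un_assoc)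
  show "pathstart (quad_loop (s1, s2, s3, s4)) = pathfinish (quad_loop (s1, s2, s3, s4))"
    using q by (simp add: quad_loop_def)
  have "arc (reversepath s2 +++ s3 +++ reversepath s4)"
    using q(8) q by (simp add: quad_loop_def simple_path_join_loop_eq)
  then have d: "path_image s2 \<inter> path_image (s3 +++ reversepath s4) \<subseteq> {black e}"
    using q by (simp add: arc_join_eq)
  show "pathfinish s1 \<noteq> pathfinish s3"
  proof
    assume "pathfinish s1 = pathfinish s3"
    then have "pathfinish s2 \<in> path_image s2 \<inter> path_image (s3 +++ reversepath s4)"
      using q by (simp add: path_image_join) (metis pathfinish_in_path_image)
    then have "pathfinish s2 = black e" using d by blast
    then show False using arcs(2) q(4) by (metis arc_distinct_ends)
  qed
  show "winding_number (quad_loop (s1, s2, s3, s4)) z = quad_sum (s1, s2, s3, s4) (\<lambda>s. winding_number s z)"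
    if "z \<notin> path_image (quad_loop (s1, s2, s3, s4))"
    using that q paths unfolding im
    by (simp add: quad_loop_def quad_sum_def winding_number_join winding_number_reversepath path_image_join)
qed

lemma is_quad_inside:
  assumes "is_quad G e (s1, s2, s3, s4)"
  shows "frontier (inside (path_image (quad_loop (s1, s2, s3, s4)))) = path_image (quad_loop (s1, s2, s3, s4))"
    and "inside (path_image (quad_loop (s1, s2, s3, s4))) \<union> outside (path_image (quad_loop (s1, s2, s3, s4))) 
      = - path_image (quad_loop (s1, s2, s3, s4))"
    and "frontier (outside (path_image (quad_loop (s1, s2, s3, s4)))) = path_image (quad_loop (s1, s2, s3, s4))"
  using Jordan_inside_outside[of "quad_loop (s1, s2, s3, s4)"] assms quad_loop_facts(3)[OF assms]
  by (auto simp: is_quad_iff)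

lemma open_arc_mid: "e (1/2) \<in> open_arc e"
  unfolding open_arc_def by force

lemma faces_eqI: "F \<in> faces A \<Longrightarrow> F' \<in> faces A \<Longrightarrow> z \<in> F \<Longrightarrow> z \<in> F' \<Longrightarrow> F = F'"
  unfolding faces_def by (metis components_eq disjoint_iff)

lemma spoke_eqI:
  assumes "s \<in> spokes G" "finite A" "A \<subseteq> spokes G" "path_image s \<subseteq> (\<Union>t\<in>A. path_image t)"
  shows "s \<in> A"
proof (rule ccontr)
  assume n: "s \<notin> A"
  have "path_image s \<subseteq> {pathstart s, pathfinish s}"
  proof
    fix x assume x: "x \<in> path_image s"
    then obtain t where t: "t \<in> A" "x \<in> path_image t" using assms(4) by blast
    then have "s \<noteq> t" "t \<in> spokes G" using n assms(3) by auto
    then have "path_image s \<inter> path_image t \<subseteq> {pathstart s, pathfinish s} \<inter> {pathstart t, pathfinish t}"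
      using spoke_embedded assms(1) by (simp add: embedded_arcs_def)
    with x t show "x \<in> {pathstart s, pathfinish s}" by blast
  qed
  then have "finite (path_image s)" by (rule finite_subset) simp
  with infinite_path_image_arc[OF spoke_arc[OF assms(1)]] show False by blast
qed

text \<open>
  Two quads around the same edge bound the same face, hence consist of the same spokes. The only
  remaining freedom is to exchange the two spokes at \<open>w\<close> and simultaneously those at \<open>b\<close>; this
  reverses the boundary loop and is excluded by its winding number.
\<close>

lemma is_quad_unique:
  assumes e: "e \<in> edges G" and q: "is_quad G e (s1, s2, s3, s4)" and q': "is_quad G e (t1, t2, t3, t4)"
  shows "(s1, s2, s3, s4) = (t1, t2, t3, t4)"
proof -
  let ?I = "inside (path_image (quad_loop (s1, s2, s3, s4)))" and ?J = "inside (path_image (quad_loop (t1, t2, t3, t4)))"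
  let ?z = "e (1/2)"
  have s: "quad_set (s1, s2, s3, s4) \<subseteq> spokes G" "pathstart s1 = white e" "pathstart s4 = white e"
    "pathstart s2 = black e" "pathstart s3 = black e"
    "pathfinish s1 = pathfinish s2" "pathfinish s3 = pathfinish s4"
    "?I \<in> faces (spokes G)" "open_arc e \<subseteq> ?I" "winding_number (quad_loop (s1, s2, s3, s4)) ?z = 1"
    using q open_arc_mid[of e] by (auto simp: is_quad_iff)
  have t: "quad_set (t1, t2, t3, t4) \<subseteq> spokes G" "pathstart t1 = white e" "pathstart t4 = white e"
    "pathstart t2 = black e" "pathstart t3 = black e"
    "pathfinish t1 = pathfinish t2" "pathfinish t3 = pathfinish t4"
    "?J \<in> faces (spokes G)" "open_arc e \<subseteq> ?J" "winding_number (quad_loop (t1, t2, t3, t4)) ?z = 1"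
    using q' open_arc_mid[of e] by (auto simp: is_quad_iff)
  have zI: "?z \<in> ?I" "?z \<in> ?J" using s t open_arc_mid[of e] by auto
  then have IJ: "?I = ?J" using faces_eqI s(8) t(8) by blast
  then have im: "path_image (quad_loop (s1, s2, s3, s4)) = path_image (quad_loop (t1, t2, t3, t4))"
    by (metis is_quad_inside(1)[OF q] is_quad_inside(1)[OF q'])
  have mem: "x \<in> {t1, t2, t3, t4}" if "x \<in> {s1, s2, s3, s4}" for x
  proof (rule spoke_eqI)
    show "x \<in> spokes G" "finite {t1, t2, t3, t4}" "{t1, t2, t3, t4} \<subseteq> spokes G"
      using that s(1) t(1) by (auto simp: quad_set_def)
    show "path_image x \<subseteq> (\<Union>t\<in>{t1, t2, t3, t4}. path_image t)"
      using that im quad_loop_facts(1)[OF q] quad_loop_facts(1)[OF q'] by blast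
  qed
  have wb: "white e \<noteq> black e" using white_neq_black e by blast
  have m: "s1 \<in> {t1, t4}" "s4 \<in> {t1, t4}" "s2 \<in> {t2, t3}" "s3 \<in> {t2, t3}"
    using mem[of s1] mem[of s2] mem[of s3] mem[of s4] s(2-5) t(2-5) wb by auto
  note d = quad_loop_facts(2)[OF q] quad_loop_facts(2)[OF q']
  show ?thesis
  proof (cases "s1 = t1")
    case True
    have "s4 = t4" using m(2) d s t True by auto
    moreover have "s2 = t2" using m(3) d s t True by auto
    moreover have "s3 = t3" using m(4) d s t True by auto
    ultimately show ?thesis using True by simp
  next
    case False
    then have 1: "s1 = t4" using m by auto
    have 2: "s4 = t1" using m(2) d s t 1 by auto
    have 3: "s2 = t3" using m(3) d s t 1 by auto
    have 4: "s3 = t2" using m(4) d s t 1 by auto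
    have "?z \<notin> path_image (quad_loop (s1, s2, s3, s4))" using zI
      by (meson inside_no_overlap disjoint_iff)
    then have "winding_number (quad_loop (s1, s2, s3, s4)) ?z = - winding_number (quad_loop (t1, t2, t3, t4)) ?z"
      using quad_loop_facts(4)[OF q, of ?z] quad_loop_facts(4)[OF q', of ?z] im
      by (simp add: quad_sum_def 1 2 3 4)
    with s(10) t(10) show ?thesis by simp
  qed
qed

lemma is_quad_quad: assumes "e \<in> edges G" shows "is_quad G e (quad G e)"
proof -
  obtain q where "is_quad G e q" using quads assms by (auto simp: is_quad_graph_def)
  moreover have "q' = q''" if "is_quad G e q'" "is_quad G e q''" for q' q''
    using is_quad_unique[OF assms] that by (cases q', cases q'') blast
  ultimately show ?thesis unfolding quad_def by (metis theI)
qed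

end

section \<open>Closed walks in the quad-graph\<close>

context quad_graph begin

text \<open>
  The face of the quad-graph that contains the edge; these faces partition the complement of the
  spokes.
\<close>

definition cell :: "curve \<Rightarrow> complex set" where
  "cell e = inside (path_image (quad_loop (quad G e)))"

lemma quad_tuple:
  assumes "e \<in> edges G"
  obtains s1 s2 s3 s4 where "quad G e = (s1, s2, s3, s4)" "is_quad G e (s1, s2, s3, s4)"
  using is_quad_quad[OF assms] by (cases "quad G e") auto

lemma cell_face: "e \<in> edges G \<Longrightarrow> cell e \<in> faces (spokes G)"
  and open_arc_cell: "e \<in> edges G \<Longrightarrow> open_arc e \<subseteq> cell e"
  and quad_spokes: "e \<in> edges G \<Longrightarrow> quad_set (quad G e) \<subseteq> spokes G"
  by (erule quad_tuple; simp add: cell_def is_quad_iff)+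

lemma cell_support: "e \<in> edges G \<Longrightarrow> cell e \<inter> support (spokes G) = {}"
  using cell_face[of e] in_components_subset unfolding faces_def by fastforce

lemma mid_cell: "e \<in> edges G \<Longrightarrow> e (1/2) \<in> cell e"
  using open_arc_cell open_arc_mid by blast

lemma cell_cover:
  assumes "z \<notin> support (spokes G)"
  obtains e where "e \<in> edges G" "z \<in> cell e"
proof -
  let ?F = "connected_component_set (- support (spokes G)) z"
  have F: "?F \<in> faces (spokes G)" unfolding faces_def components_def using assms by auto
  then obtain e where e: "e \<in> edges G" "open_arc e \<subseteq> ?F"
    using quads unfolding is_quad_graph_def by metis
  then have "cell e = ?F"
    using faces_eqI[OF cell_face[OF e(1)] F, of "e (1/2)"] mid_cell open_arc_mid by blast
  moreover have "z \<in> ?F" using assms by simp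
  ultimately show ?thesis using that e by blast
qed

lemma cell_unique:
  assumes "e \<in> edges G" "e' \<in> edges G" "z \<in> cell e" "z \<in> cell e'"
  shows "e = e'"
proof -
  have "cell e = cell e'" using faces_eqI[OF cell_face cell_face] assms by blast
  then have "open_arc e \<subseteq> cell e" "open_arc e' \<subseteq> cell e" using open_arc_cell assms by auto
  then show ?thesis using quads cell_face[OF assms(1)] assms(1,2) unfolding is_quad_graph_def by blast
qed

lemma quad_loop_support:
  "e \<in> edges G \<Longrightarrow> path_image (quad_loop (quad G e)) = (\<Union>s\<in>quad_set (quad G e). path_image s)"
  by (erule quad_tuple) (auto simp: quad_loop_facts(1) quad_set_def)

lemma winding_quad:
  assumes "e \<in> edges G" "z \<notin> support (spokes G)"
  shows "quad_sum (quad G e) (\<lambda>s. winding_number s z) = (if z \<in> cell e then 1 else 0)"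
proof -
  obtain s1 s2 s3 s4 where q: "quad G e = (s1, s2, s3, s4)" "is_quad G e (s1, s2, s3, s4)"
    using quad_tuple[OF assms(1)] .
  let ?l = "quad_loop (s1, s2, s3, s4)"
  have "z \<notin> path_image ?l"
    using assms quad_loop_support[OF assms(1)] quad_spokes[OF assms(1)] unfolding q(1) support_def by blast
  then have w: "quad_sum (quad G e) (\<lambda>s. winding_number s z) = winding_number ?l z"
    using quad_loop_facts(4)[OF q(2), of z] q(1) by simp
  show ?thesis
  proof (cases "z \<in> cell e")
    case True
    then show ?thesis using q w unfolding cell_def is_quad_iff by auto
  next
    case False
    then have "z \<in> outside (path_image ?l)"
      using is_quad_inside(2)[OF q(2)] \<open>z \<notin> path_image ?l\<close> unfolding cell_def q(1) by blast
    moreover have "path ?l" using q(2) by (simp add: is_quad_iff simple_path_imp_path)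
    ultimately have "winding_number ?l z = 0"
      using winding_number_zero_in_outside quad_loop_facts(3)[OF q(2)] by metis
    then show ?thesis using False w by simp
  qed
qed

lemma open_arc_disjoint:
  assumes "s \<in> spokes G" "t \<in> spokes G" "t \<noteq> s" "z \<in> open_arc s"
  shows "z \<notin> path_image t"
proof
  assume z: "z \<in> path_image t"
  have zs: "z \<in> path_image s" using assms(4) by (auto simp: open_arc_def path_image_def)
  have "path_image s \<inter> path_image t \<subseteq> {pathstart s, pathfinish s} \<inter> {pathstart t, pathfinish t}"
    using spoke_embedded assms(1-3) unfolding embedded_arcs_def by blast
  then have "z \<in> {s 0, s 1}" using z zs by (auto simp: pathstart_def pathfinish_def)
  moreover obtain x where "0 < x" "x < 1" "z = s x" using assms(4) by (auto simp: open_arc_def)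
  moreover have "inj_on s {0..1}" using spoke_arc[OF assms(1)] by (simp add: arc_def)
  ultimately have "x = 0 \<or> x = 1"
    using inj_onD[of s "{0..1}" x 0] inj_onD[of s "{0..1}" x 1] by auto
  with \<open>0 < x\<close> \<open>x < 1\<close> show False by simp
qed

lemma spoke_local:
  assumes "s \<in> spokes G" "z \<in> open_arc s"
  obtains d where "d > 0" "\<And>t. t \<in> spokes G \<Longrightarrow> t \<noteq> s \<Longrightarrow> ball z d \<inter> path_image t = {}"
proof -
  define A where "A = {t \<in> spokes G. path_image t \<inter> cball z 1 \<noteq> {}} - {s}"
  have "finite A"
    using spoke_embedded unfolding A_def embedded_arcs_def by auto
  have "closed (\<Union>t\<in>A. path_image t)"
    using \<open>finite A\<close> spoke_arc by (intro closed_UN) (auto simp: A_def closed_path_image arc_imp_path)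
  moreover have "z \<notin> (\<Union>t\<in>A. path_image t)" using open_arc_disjoint[OF assms(1) _ _ assms(2)] by (auto simp: A_def)
  ultimately obtain d where d: "d > 0" "ball z d \<subseteq> - (\<Union>t\<in>A. path_image t)"
    by (meson ComplI open_Compl openE)
  show ?thesis
  proof (rule that[of "min d 1"])
    show "min d 1 > 0" using d by simp
    fix t assume t: "t \<in> spokes G" "t \<noteq> s"
    show "ball z (min d 1) \<inter> path_image t = {}"
    proof (rule ccontr)
      assume "ball z (min d 1) \<inter> path_image t \<noteq> {}"
      then obtain u where u: "u \<in> ball z (min d 1)" "u \<in> path_image t" by blast
      have "u \<in> cball z 1" "u \<in> ball z d" using u by auto
      then show False using t u(2) d(2) unfolding A_def by blast
    qed
  qed
qed

text \<open>
  Some face \<open>cell e\<close> has points close to the midpoint of the spoke because an arc has empty interior.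
  The frontier of this face separates these points from the midpoint, and close to the midpoint it
  can only consist of points of the spoke itself.
\<close>

lemma spoke_in_quad:
  assumes "s \<in> spokes G"
  obtains e where "e \<in> edges G" "s \<in> quad_set (quad G e)"
proof -
  let ?z = "s (1/2)"
  have z: "?z \<in> open_arc s" by (rule open_arc_mid)
  then have zs: "?z \<in> path_image s" by (auto simp: open_arc_def path_image_def)
  obtain d where d: "d > 0" "\<And>t. t \<in> spokes G \<Longrightarrow> t \<noteq> s \<Longrightarrow> ball ?z d \<inter> path_image t = {}"
    using spoke_local[OF assms z] by blast
  have "\<not> ball ?z d \<subseteq> path_image s"
  proof
    assume "ball ?z d \<subseteq> path_image s"
    then have "ball ?z d \<subseteq> interior (path_image s)" by (simp add: interior_maximal)
    then show False using interior_path_image_arc[OF spoke_arc[OF assms]] d by auto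
  qed
  then obtain u where u: "u \<in> ball ?z d" "u \<notin> path_image s" by blast
  then have "u \<notin> support (spokes G)" using d(2) unfolding support_def by blast
  then obtain e where e: "e \<in> edges G" "u \<in> cell e" using cell_cover by blast
  have zc: "?z \<notin> cell e" using cell_support[OF e(1)] zs assms unfolding support_def by blast
  have "ball ?z d \<inter> frontier (cell e) \<noteq> {}"
  proof (rule connected_Int_frontier)
    show "connected (ball ?z d)" by simp
    show "ball ?z d \<inter> cell e \<noteq> {}" using u e by blast
    have "?z \<in> ball ?z d" using d by simp
    then show "ball ?z d - cell e \<noteq> {}" using zc by blast
  qed
  then obtain v where v: "v \<in> ball ?z d" "v \<in> frontier (cell e)" by blast
  obtain s1 s2 s3 s4 where q: "quad G e = (s1, s2, s3, s4)" "is_quad G e (s1, s2, s3, s4)"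
    using quad_tuple[OF e(1)] .
  have "frontier (cell e) = path_image (quad_loop (quad G e))"
    using is_quad_inside(1)[OF q(2)] unfolding cell_def q(1) .
  then obtain t where t: "t \<in> quad_set (quad G e)" "v \<in> path_image t"
    using v quad_loop_support[OF e(1)] by auto
  have "t \<in> spokes G" using t quad_spokes[OF e(1)] by blast
  then have "t = s" using d(2) v(1) t(2) by blast
  then show ?thesis using that e t by blast
qed


text \<open>
  Spokes are not closed, so that the single terms are not integers and depend continuously on the
  point; for cycles the sum is an integer and is constant on faces.
\<close>

definition chain_winding :: "(curve \<Rightarrow> int) \<Rightarrow> complex \<Rightarrow> complex" where
  "chain_winding n z = chain_sum n (\<lambda>s. winding_number s z)"

lemma chain_winding_add_quad:
  assumes "finite {s. n s \<noteq> 0}" "e \<in> edges G" "z \<notin> support (spokes G)"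
  shows "chain_winding (\<lambda>s. n s + m * quad_side (quad G e) s) z
       = chain_winding n z + of_int m * (if z \<in> cell e then 1 else 0)"
  unfolding chain_winding_def chain_sum_add_quad[OF assms(1)] winding_quad[OF assms(2,3)] ..

lemma isCont_chain_winding:
  assumes "{s. n s \<noteq> 0} \<subseteq> spokes G" "\<And>s. n s \<noteq> 0 \<Longrightarrow> z \<notin> path_image s"
  shows "isCont (chain_winding n) z"
  unfolding chain_winding_def chain_sum_def
  using assms by (intro continuous_intros continuous_at_winding_number) (auto simp: spoke_arc arc_imp_path subset_iff)

lemma chain_winding_constant:
  assumes "{s. n s \<noteq> 0} \<subseteq> spokes G"
    and int: "\<And>z. z \<notin> support (spokes G) \<Longrightarrow> chain_winding n z \<in> \<int>"
    and e: "e \<in> edges G" "z \<in> cell e" "z' \<in> cell e"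
  shows "chain_winding n z = chain_winding n z'"
proof -
  have "chain_winding n constant_on cell e"
  proof (rule continuous_discrete_range_constant)
    show "connected (cell e)" using cell_face[OF e(1)] unfolding faces_def by (rule in_components_connected)
    have "isCont (chain_winding n) x" if "x \<in> cell e" for x
      using isCont_chain_winding[OF assms(1)] assms(1) cell_support[OF e(1)] that unfolding support_def by blast
    then show "continuous_on (cell e) (chain_winding n)" by (simp add: continuous_at_imp_continuous_on)
    fix x assume x: "x \<in> cell e"
    show "\<exists>d>0. \<forall>y. y \<in> cell e \<and> chain_winding n y \<noteq> chain_winding n x \<longrightarrow> d \<le> norm (chain_winding n y - chain_winding n x)"
    proof (intro exI[of _ 1] conjI allI impI)
      fix y assume y: "y \<in> cell e \<and> chain_winding n y \<noteq> chain_winding n x"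
      have "chain_winding n y - chain_winding n x \<in> \<int>"
        using int x y cell_support[OF e(1)] by (intro Ints_diff) blast+
      then obtain k where k: "chain_winding n y - chain_winding n x = of_int k" by (auto elim: Ints_cases)
      with y have "k \<noteq> 0" by auto
      then show "1 \<le> norm (chain_winding n y - chain_winding n x)" unfolding k by simp
    qed simp
  qed
  then show ?thesis using e unfolding constant_on_def by metis
qed

lemma quad_side_unit:
  assumes "e \<in> edges G" "s \<in> quad_set (quad G e)"
  shows "quad_side (quad G e) s = 1 \<or> quad_side (quad G e) s = - 1"
proof -
  obtain s1 s2 s3 s4 where q: "quad G e = (s1, s2, s3, s4)" "is_quad G e (s1, s2, s3, s4)"
    using quad_tuple[OF assms(1)] .
  have "white e \<noteq> black e" using white_neq_black assms(1) by blast
  then have "s1 \<noteq> s2" "s1 \<noteq> s3" "s4 \<noteq> s2" "s4 \<noteq> s3" "s1 \<noteq> s4" "s2 \<noteq> s3"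
    using q(2) quad_loop_facts(2)[OF q(2)] by (auto simp: is_quad_iff)
  then show ?thesis using assms(2) by (auto simp: q(1) quad_side_def quad_set_def)
qed

text \<open>
  A quad through \<open>s\<close> is subtracted such that \<open>s\<close> no longer occurs in the chain. The winding
  function of the new chain is then continuous across \<open>s\<close>, but jumps there by the original
  coefficient of \<open>s\<close>. This replaces a jump formula, which would be delicate for
  arcs that are merely continuous.
\<close>

lemma chain_zero_if_winding_zero:
  assumes fin: "finite {s. n s \<noteq> 0}" and sub: "{s. n s \<noteq> 0} \<subseteq> spokes G"
    and zero: "\<And>z. z \<notin> support (spokes G) \<Longrightarrow> chain_winding n z = 0"
  shows "n s = 0"
proof (rule ccontr)
  assume ns: "n s \<noteq> 0"
  then have s: "s \<in> spokes G" using sub by blast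
  obtain e where e: "e \<in> edges G" "s \<in> quad_set (quad G e)" using spoke_in_quad[OF s] .
  \<comment> \<open>the coefficient of \<open>s\<close> in the boundary of the quad is \<open>1\<close> or \<open>-1\<close>, hence its own inverse\<close>
  define m where "m = - n s * quad_side (quad G e) s"
  define n' where "n' = (\<lambda>t. n t + m * quad_side (quad G e) t)"
  have m: "m \<noteq> 0" "n' s = 0" using ns quad_side_unit[OF e] by (auto simp: m_def n'_def)
  let ?z = "s (1/2)"
  have z: "?z \<in> open_arc s" by (rule open_arc_mid)
  have "n' t = 0" if "t \<notin> spokes G" for t
    using that sub quad_spokes[OF e(1)] quad_side_eq_0[of t "quad G e"] unfolding n'_def by fastforce
  then have n': "{t. n' t \<noteq> 0} \<subseteq> spokes G" by blast
  have val: "chain_winding n' u = of_int m * (if u \<in> cell e then 1 else 0)" if "u \<notin> support (spokes G)" for u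
    unfolding n'_def chain_winding_add_quad[OF fin e(1) that] zero[OF that] by simp
  have "isCont (chain_winding n') ?z"
    using isCont_chain_winding[OF n'] open_arc_disjoint[OF s _ _ z] n' m(2) by blast
  then obtain d where d: "d > 0" "\<And>u. dist u ?z < d \<Longrightarrow> dist (chain_winding n' u) (chain_winding n' ?z) < 1/2"
    unfolding continuous_at_eps_delta by (elim allE[of _ "1/2"]) auto
  obtain d' where d': "d' > 0" "\<And>t. t \<in> spokes G \<Longrightarrow> t \<noteq> s \<Longrightarrow> ball ?z d' \<inter> path_image t = {}"
    using spoke_local[OF s z] by blast
  obtain s1 s2 s3 s4 where q: "quad G e = (s1, s2, s3, s4)" "is_quad G e (s1, s2, s3, s4)"
    using quad_tuple[OF e(1)] .
  let ?p = "path_image (quad_loop (quad G e))"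
  have sp: "path_image s \<subseteq> ?p" using quad_loop_support[OF e(1)] e(2) by auto
  have zp: "?z \<in> ?p" using sp z by (auto simp: open_arc_def path_image_def)
  have fr: "frontier (cell e) = ?p" "frontier (outside ?p) = ?p"
    using is_quad_inside(1,3)[OF q(2)] by (simp_all only: q(1) cell_def)
  have d0: "min d d' > 0" using d d' by simp
  have "?z \<in> closure (cell e)" "?z \<in> closure (outside ?p)"
    using zp fr by (auto simp: frontier_def)
  then obtain u u' where u: "u \<in> cell e" "dist u ?z < min d d'" and u': "u' \<in> outside ?p" "dist u' ?z < min d d'"
    using d0 unfolding closure_approachable by metis
  have "u \<notin> support (spokes G)" using u(1) cell_support[OF e(1)] by blast
  then have 1: "chain_winding n' u = of_int m" using val u(1) by simp
  have "u' \<notin> ?p" using u'(1) outside_no_overlap by blast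
  have "u' \<notin> path_image t" if t: "t \<in> spokes G" for t
  proof (cases "t = s")
    case True then show ?thesis using sp \<open>u' \<notin> ?p\<close> by blast
  next
    case False
    have "u' \<in> ball ?z d'" using u'(2) by (simp add: dist_commute)
    then show ?thesis using d'(2)[OF t False] by blast
  qed
  then have "u' \<notin> support (spokes G)" by (auto simp: support_def)
  moreover have "u' \<notin> cell e" using u'(1) inside_Int_outside unfolding cell_def by blast
  ultimately have 2: "chain_winding n' u' = 0" using val by simp
  have "dist (chain_winding n' u) (chain_winding n' u') < 1"
    using d(2)[of u] d(2)[of u'] u(2) u'(2) dist_triangle_half_r[of "chain_winding n' ?z" "chain_winding n' u" 1 "chain_winding n' u'"]
    by (simp add: dist_commute)
  then show False using m(1) unfolding 1 2 by simp
qed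

text \<open>
  Integrality and vanishing near infinity of the winding function express that the chain is a cycle.
  Subtracting the boundaries of the finitely many quads that it winds around, with multiplicities,
  leaves a cycle that winds around no face at all, and such a cycle is zero.
\<close>

lemma cycle_eq_quad_sum:
  assumes "finite {s. n s \<noteq> 0}" "{s. n s \<noteq> 0} \<subseteq> spokes G"
    and "\<And>z. z \<notin> support (spokes G) \<Longrightarrow> chain_winding n z \<in> \<int>"
    and "\<And>z. z \<notin> support (spokes G) \<Longrightarrow> norm z > R \<Longrightarrow> chain_winding n z = 0"
  shows "\<exists>l. fst ` set l \<subseteq> edges G \<and> (\<forall>X. chain_sum n X = (\<Sum>(e, m)\<leftarrow>l. of_int m * quad_sum (quad G e) X))"
  using assms
proof (induction "card {e \<in> edges G. chain_winding n (e (1/2)) \<noteq> 0}" arbitrary: n rule: less_induct)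
  case less
  let ?S = "\<lambda>n. {e \<in> edges G. chain_winding n (e (1/2)) \<noteq> 0}"
  have finS: "finite (?S n)"
  proof (rule finite_subset)
    show "?S n \<subseteq> {e \<in> edges G. path_image e \<inter> cball 0 R \<noteq> {}}"
    proof
      fix e assume e: "e \<in> ?S n"
      then have "e (1/2) \<notin> support (spokes G)" using mid_cell cell_support by blast
      then have "e (1/2) \<in> cball 0 R" using less.prems(4)[of "e (1/2)"] e by (cases "norm (e (1/2)) > R") auto
      moreover have "e (1/2) \<in> path_image e" by (auto simp: path_image_def)
      ultimately show "e \<in> {e \<in> edges G. path_image e \<inter> cball 0 R \<noteq> {}}" using e by blast
    qed
    show "finite {e \<in> edges G. path_image e \<inter> cball 0 R \<noteq> {}}"
      using bip by (simp add: bipartite_plane_graph_def embedded_arcs_def)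
  qed
  show ?case
  proof (cases "?S n = {}")
    case True
    have "chain_winding n z = 0" if z: "z \<notin> support (spokes G)" for z
    proof -
      obtain e where e: "e \<in> edges G" "z \<in> cell e" using cell_cover[OF z] .
      have "chain_winding n z = chain_winding n (e (1/2))"
        by (rule chain_winding_constant[OF less.prems(2,3) e(1,2) mid_cell[OF e(1)]])
      then show ?thesis using True e(1) by simp
    qed
    then have "n s = 0" for s using chain_zero_if_winding_zero[OF less.prems(1,2)] by blast
    then show ?thesis by (intro exI[of _ "[]"]) (simp add: chain_sum_def)
  next
    case False
    then obtain e where e: "e \<in> edges G" "chain_winding n (e (1/2)) \<noteq> 0" by blast
    have "e (1/2) \<notin> support (spokes G)" using mid_cell[OF e(1)] cell_support[OF e(1)] by blast
    then obtain m where m: "chain_winding n (e (1/2)) = of_int m"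
      using less.prems(3) by (auto elim: Ints_cases)
    define n' where "n' = (\<lambda>t. n t + (- m) * quad_side (quad G e) t)"
    have val: "chain_winding n' u = chain_winding n u - of_int m * (if u \<in> cell e then 1 else 0)"
      if "u \<notin> support (spokes G)" for u
      unfolding n'_def chain_winding_add_quad[OF less.prems(1) e(1) that] by simp
    have sub': "{t. n' t \<noteq> 0} \<subseteq> {t. n t \<noteq> 0} \<union> quad_set (quad G e)"
      using quad_side_eq_0[of _ "quad G e"] by (auto simp: n'_def)
    have val': "chain_winding n' (f (1/2)) = (if f = e then 0 else chain_winding n (f (1/2)))" if f: "f \<in> edges G" for f
    proof -
      have "f (1/2) \<notin> support (spokes G)" using mid_cell[OF f] cell_support[OF f] by blast
      moreover have "f (1/2) \<in> cell e \<longleftrightarrow> f = e" using cell_unique[OF f e(1) mid_cell[OF f]] mid_cell[OF f] by blast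
      ultimately show ?thesis using val m by simp
    qed
    have "?S n' \<subseteq> ?S n" using val' by (auto split: if_splits)
    moreover have "e \<in> ?S n" "e \<notin> ?S n'" using val' e by simp_all
    ultimately have "?S n' \<subset> ?S n" by blast
    then have "card (?S n') < card (?S n)" by (rule psubset_card_mono[OF finS])
    moreover have "finite {t. n' t \<noteq> 0}" using finite_subset[OF sub'] less.prems(1) by simp
    moreover have "{t. n' t \<noteq> 0} \<subseteq> spokes G" using sub' less.prems(2) quad_spokes[OF e(1)] by blast
    moreover have "chain_winding n' z \<in> \<int>" if "z \<notin> support (spokes G)" for z
      using val[OF that] less.prems(3)[OF that] by auto
    moreover have "chain_winding n' z = 0" if z: "z \<notin> support (spokes G)" "norm z > R" for z
    proof -
      have "chain_winding n z = 0" using less.prems(4) z by blast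
      then have "z \<notin> cell e" using chain_winding_constant[OF less.prems(2,3) e(1) _ mid_cell[OF e(1)]] e(2) by metis
      then show ?thesis using val[OF z(1)] \<open>chain_winding n z = 0\<close> by simp
    qed
    ultimately obtain l where l: "fst ` set l \<subseteq> edges G"
      "\<And>X. chain_sum n' X = (\<Sum>(e, m)\<leftarrow>l. of_int m * quad_sum (quad G e) X)"
      using less.hyps[of n'] by blast
    have "chain_sum n X = (\<Sum>(e, m)\<leftarrow>(e, m) # l. of_int m * quad_sum (quad G e) X)" for X
      using l(2)[of X] unfolding n'_def chain_sum_add_quad[OF less.prems(1)] by (simp add: algebra_simps)
    then show ?thesis using l(1) e(1) by (intro exI[of _ "(e, m) # l"]) auto
  qed
qed

end

definition dart_sign :: "dart \<Rightarrow> int" where "dart_sign d = (if snd d then 1 else - 1)"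

definition walk_chain :: "dart list \<Rightarrow> curve \<Rightarrow> int" where
  "walk_chain ds s = (\<Sum>d\<leftarrow>ds. dart_sign d * of_bool (s = fst d))"

lemma walk_chain_eq_0: "s \<notin> fst ` set ds \<Longrightarrow> walk_chain ds s = 0"
  by (induction ds) (auto simp: walk_chain_def)

lemma chain_sum_walk_chain:
  "chain_sum (walk_chain ds) X = (\<Sum>d\<leftarrow>ds. of_int (dart_sign d) * X (fst d))"
proof -
  have "(\<Sum>s\<in>A. of_int (walk_chain ds s) * X s) = (\<Sum>d\<leftarrow>ds. of_int (dart_sign d) * X (fst d))"
    if "finite A" "fst ` set ds \<subseteq> A" for A using that
  proof (induction ds)
    case Nil then show ?case by (simp add: walk_chain_def)
  next
    case (Cons d ds)
    have "(\<Sum>s\<in>A. of_int (walk_chain (d # ds) s) * X s) =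
      (\<Sum>s\<in>A. if s = fst d then of_int (dart_sign d) * X s else 0) + (\<Sum>s\<in>A. of_int (walk_chain ds s) * X s)"
      by (simp add: walk_chain_def sum.distrib [symmetric] algebra_simps of_bool_def if_distrib cong: if_cong)
         (rule sum.cong, auto simp: algebra_simps)
    then show ?case using Cons by (simp add: sum.delta)
  qed
  from this[of "fst ` set ds"] show ?thesis
    using chain_sum_superset[of "fst ` set ds" "walk_chain ds" X] walk_chain_eq_0 by fastforce
qed

context quad_graph begin

lemma walk_path:
  assumes "is_walk G x ds y" "x \<in> support (spokes G)"
  shows "\<exists>p. path p \<and> pathstart p = x \<and> pathfinish p = y \<and> path_image p \<subseteq> support (spokes G) \<and>
    (\<forall>z. z \<notin> support (spokes G) \<longrightarrow>
      winding_number p z = (\<Sum>d\<leftarrow>ds. of_int (dart_sign d) * winding_number (fst d) z))"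
  using assms
proof (induction ds arbitrary: x)
  case Nil
  then show ?case by (intro exI[of _ "\<lambda>_. x"]) (auto simp: path_def pathstart_def pathfinish_def path_image_def intro!: winding_number_zero_const)
next
  case (Cons d ds)
  have s: "fst d \<in> spokes G" "dart_src d = x" "is_walk G (dart_tgt d) ds y" using Cons.prems by auto
  have a: "path (fst d)" using spoke_arc[OF s(1)] by (rule arc_imp_path)
  have i: "path_image (fst d) \<subseteq> support (spokes G)" using s(1) by (auto simp: support_def)
  define r where "r = (if snd d then fst d else reversepath (fst d))"
  have r: "path r" "pathstart r = x" "pathfinish r = dart_tgt d" "path_image r = path_image (fst d)"
    using a s(2) by (auto simp: r_def dart_src_def dart_tgt_def)
  have rw: "winding_number r z = of_int (dart_sign d) * winding_number (fst d) z" if "z \<notin> support (spokes G)" for z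
  proof -
    have "z \<notin> path_image (fst d)" using i that by blast
    then show ?thesis using winding_number_reversepath[OF a] by (simp add: r_def dart_sign_def)
  qed
  have "dart_tgt d \<in> path_image r" using r(3) pathfinish_in_path_image by metis
  then have "dart_tgt d \<in> support (spokes G)" using i r(4) by blast
  then obtain p where p: "path p" "pathstart p = dart_tgt d" "pathfinish p = y" "path_image p \<subseteq> support (spokes G)"
    "\<And>z. z \<notin> support (spokes G) \<Longrightarrow>
      winding_number p z = (\<Sum>d\<leftarrow>ds. of_int (dart_sign d) * winding_number (fst d) z)"
    using Cons.IH[OF s(3)] by blast
  show ?case
  proof (intro exI[of _ "r +++ p"] conjI allI impI)
    show "path_image (r +++ p) \<subseteq> support (spokes G)" using r p i by (simp add: path_image_join)
    fix z assume z: "z \<notin> support (spokes G)"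
    then have "z \<notin> path_image r" "z \<notin> path_image p" using r p i by blast+
    then show "winding_number (r +++ p) z = (\<Sum>d\<leftarrow>d # ds. of_int (dart_sign d) * winding_number (fst d) z)"
      using rw[OF z] p(5)[OF z] r p by (simp add: winding_number_join)
  qed (use r p in auto)
qed

lemma walk_spokes: "is_walk G x ds y \<Longrightarrow> fst ` set ds \<subseteq> spokes G"
  by (induction ds arbitrary: x) auto

text \<open>
  Simple connectedness of the plane, in the form used for the functions \<open>g\<close>: a function on spokes
  with trivial sums around all quads has trivial sums along all closed walks.
\<close>

lemma closed_walk_eq_quad_sum:
  assumes w: "is_walk G x ds x" and x: "x \<in> support (spokes G)"
  shows "\<exists>l. fst ` set l \<subseteq> edges G \<and>
    (\<forall>X. (\<Sum>d\<leftarrow>ds. of_int (dart_sign d) * X (fst d)) = (\<Sum>(e, m)\<leftarrow>l. of_int m * quad_sum (quad G e) X))"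
proof -
  obtain p where p: "path p" "pathstart p = x" "pathfinish p = x" "path_image p \<subseteq> support (spokes G)"
    "\<And>z. z \<notin> support (spokes G) \<Longrightarrow> winding_number p z = chain_winding (walk_chain ds) z"
    using walk_path[OF w x] unfolding chain_winding_def chain_sum_walk_chain by blast
  obtain R where R: "path_image p \<subseteq> ball 0 R"
    using bounded_subset_ballD[OF bounded_path_image[OF p(1)]] by blast
  have sub: "{s. walk_chain ds s \<noteq> 0} \<subseteq> fst ` set ds" using walk_chain_eq_0 by blast
  have "\<exists>l. fst ` set l \<subseteq> edges G \<and>
    (\<forall>X. chain_sum (walk_chain ds) X = (\<Sum>(e, m)\<leftarrow>l. of_int m * quad_sum (quad G e) X))"
  proof (rule cycle_eq_quad_sum)
    show "finite {s. walk_chain ds s \<noteq> 0}" using sub by (rule finite_subset) simp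
    show "{s. walk_chain ds s \<noteq> 0} \<subseteq> spokes G" using sub walk_spokes[OF w] by blast
    fix z assume z: "z \<notin> support (spokes G)"
    then have "z \<notin> path_image p" using p(4) by blast
    then show "chain_winding (walk_chain ds) z \<in> \<int>"
      using integer_winding_number[of p z] p z by simp
    show "chain_winding (walk_chain ds) z = 0" if "norm z > R"
      using winding_number_zero_outside[of p "ball 0 R" z] p R z that by simp
  qed
  then show ?thesis by (simp only: chain_sum_walk_chain)
qed

end

section \<open>Theta functions and quasi-periodicity\<close>

text \<open>
  Up to exponential factors, \<open>\<theta>\<close> and \<open>\<theta>\<^sub>4\<close> are Laurent series in \<open>w = exp (2 i z)\<close> whose two halves are
  values of this entire function. It satisfies a single functional equation, from which all the
  quasi-periodicity follows, and which avoids shifting the index of two-sided series.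
\<close>

definition half_theta :: "complex \<Rightarrow> complex \<Rightarrow> complex" where
  "half_theta \<tau> w = (\<Sum>n. (-1) ^ n * exp (\<i> * of_real pi * \<tau> * (of_nat n * (of_nat n + 1))) * w ^ n)"

lemma norm_nome: "norm (exp (\<i> * of_real pi * \<tau> * x)) = exp (- pi * (Im \<tau> * Re x + Re \<tau> * Im x))"
  by (simp add: norm_exp_eq_Re algebra_simps)

context
  fixes \<tau> :: complex
  assumes tau: "Im \<tau> > 0"
begin

lemma summable_half_theta:
  "summable (\<lambda>n. (-1) ^ n * exp (\<i> * of_real pi * \<tau> * (of_nat n * (of_nat n + 1))) * w ^ n)"
proof -
  let ?f = "\<lambda>n. (-1) ^ n * exp (\<i> * of_real pi * \<tau> * (of_nat n * (of_nat n + 1))) * w ^ n"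
  define r where "r = exp (- 2 * pi * Im \<tau>)"
  have r: "0 < r" "r < 1" using tau by (auto simp: r_def)
  have "(\<lambda>n. r ^ Suc n * norm w) \<longlonglongrightarrow> 0 * norm w"
    by (intro tendsto_mult tendsto_const LIMSEQ_Suc LIMSEQ_power_zero) (use r in auto)
  then have "eventually (\<lambda>n. r ^ Suc n * norm w < 1/2) sequentially"
    by (intro order_tendstoD(2)) auto
  then obtain N where N: "\<And>n. n \<ge> N \<Longrightarrow> r ^ Suc n * norm w < 1/2" by (auto simp: eventually_sequentially)
  show ?thesis
  proof (rule summable_ratio_test[of "1/2" N])
    fix n assume n: "N \<le> n"
    have e: "exp (- pi * (Im \<tau> * Re (of_nat (Suc n) * (of_nat (Suc n) + 1)) + 0))
        = exp (- pi * (Im \<tau> * Re (of_nat n * (of_nat n + 1)) + 0)) * r ^ Suc n"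
      unfolding r_def exp_of_nat_mult[symmetric] exp_add[symmetric]
      by (rule arg_cong[of _ _ exp]) (simp add: algebra_simps)
    have "norm (?f (Suc n)) = norm (?f n) * (r ^ Suc n * norm w)"
      using e by (simp add: norm_mult norm_power norm_nome mult.assoc)
    also have "\<dots> \<le> norm (?f n) * (1/2)" using N[OF n] by (intro mult_left_mono) auto
    finally show "norm (?f (Suc n)) \<le> 1/2 * norm (?f n)" by simp
  qed simp
qed

lemma half_theta_shift:
  "half_theta \<tau> w = 1 - exp (2 * \<i> * of_real pi * \<tau>) * w * half_theta \<tau> (exp (2 * \<i> * of_real pi * \<tau>) * w)"
proof -
  let ?Q = "exp (2 * \<i> * of_real pi * \<tau>)"
  let ?f = "\<lambda>w n. (-1) ^ n * exp (\<i> * of_real pi * \<tau> * (of_nat n * (of_nat n + 1))) * w ^ n"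
  have s: "?f w (Suc n) = - (?Q * w) * ?f (?Q * w) n" for n
  proof -
    have "exp (\<i> * of_real pi * \<tau> * (of_nat (Suc n) * (of_nat (Suc n) + 1)))
        = exp (\<i> * of_real pi * \<tau> * (of_nat n * (of_nat n + 1))) * ?Q ^ Suc n"
      unfolding exp_of_nat_mult[symmetric] exp_add[symmetric]
      by (rule arg_cong[of _ _ exp]) (simp add: algebra_simps)
    then show ?thesis by (simp add: power_mult_distrib)
  qed
  have "half_theta \<tau> w = ?f w 0 + (\<Sum>n. ?f w (Suc n))"
    unfolding half_theta_def using suminf_split_head[OF summable_half_theta[of w]] by simp
  also have "(\<Sum>n. ?f w (Suc n)) = - (?Q * w) * (\<Sum>n. ?f (?Q * w) n)"
    unfolding s by (rule suminf_mult[OF summable_half_theta])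
  finally show ?thesis by (simp add: half_theta_def)
qed

lemma half_theta_0: "half_theta \<tau> 0 = 1"
  using half_theta_shift[of 0] by simp

lemma half_theta_holomorphic: "half_theta \<tau> holomorphic_on A"
proof -
  have "half_theta \<tau> holomorphic_on ball 0 r" for r
    using power_series_holomorphic[of 0 r "\<lambda>n. (-1) ^ n * exp (\<i> * of_real pi * \<tau> * (of_nat n * (of_nat n + 1)))" "half_theta \<tau>"]
      summable_sums[OF summable_half_theta] by (simp add: half_theta_def)
  then have "half_theta \<tau> field_differentiable at z" for z
    using holomorphic_on_imp_differentiable_at[of "half_theta \<tau>" "ball 0 (norm z + 1)" z] by simp
  then show ?thesis by (simp add: holomorphic_on_def field_differentiable_at_within)
qed

lemma theta_eq_half_theta:
  "theta \<tau> z = - \<i> * exp (\<i> * of_real pi * \<tau> / 4) *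
     (exp (\<i> * z) * half_theta \<tau> (exp (2 * \<i> * z)) - exp (- (\<i> * z)) * half_theta \<tau> (exp (- (2 * \<i> * z))))"
proof -
  let ?c = "exp (\<i> * of_real pi * \<tau> / 4)"
  let ?f = "\<lambda>w n. (-1) ^ n * exp (\<i> * of_real pi * \<tau> * (of_nat n * (of_nat n + 1))) * w ^ n"
  have s: "?f w sums half_theta \<tau> w" for w
    unfolding half_theta_def by (rule summable_sums[OF summable_half_theta])
  have "(\<lambda>n. ?c / (2 * \<i>) * (exp (\<i> * z) * ?f (exp (2 * \<i> * z)) n - exp (- (\<i> * z)) * ?f (exp (- (2 * \<i> * z))) n))
     sums (?c / (2 * \<i>) * (exp (\<i> * z) * half_theta \<tau> (exp (2 * \<i> * z)) - exp (- (\<i> * z)) * half_theta \<tau> (exp (- (2 * \<i> * z)))))"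
    by (intro sums_mult sums_diff s)
  moreover have "?c / (2 * \<i>) * (exp (\<i> * z) * ?f (exp (2 * \<i> * z)) n - exp (- (\<i> * z)) * ?f (exp (- (2 * \<i> * z))) n)
     = (-1) ^ n * exp (\<i> * of_real pi * \<tau> * (of_nat n + 1/2)\<^sup>2) * sin (of_nat (2 * n + 1) * z)" for n
  proof -
    have 1: "exp (\<i> * of_real pi * \<tau> * (of_nat n + 1/2)\<^sup>2) = ?c * exp (\<i> * of_real pi * \<tau> * (of_nat n * (of_nat n + 1)))"
      unfolding exp_add[symmetric] by (rule arg_cong[of _ _ exp]) (simp add: power2_eq_square algebra_simps)
    have 2: "exp (\<i> * (of_nat (2 * n + 1) * z)) = exp (\<i> * z) * exp (2 * \<i> * z) ^ n"
      unfolding exp_of_nat_mult[symmetric] exp_add[symmetric] by (rule arg_cong[of _ _ exp]) (simp add: algebra_simps)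
    have 3: "exp (- (\<i> * (of_nat (2 * n + 1) * z))) = exp (- (\<i> * z)) * exp (- (2 * \<i> * z)) ^ n"
      unfolding exp_of_nat_mult[symmetric] exp_add[symmetric] by (rule arg_cong[of _ _ exp]) (simp add: algebra_simps)
    show ?thesis unfolding sin_exp_eq 1 2 3 by (simp add: algebra_simps diff_divide_distrib)
  qed
  ultimately have "(\<lambda>n. (-1) ^ n * exp (\<i> * of_real pi * \<tau> * (of_nat n + 1/2)\<^sup>2) * sin (of_nat (2 * n + 1) * z))
     sums (?c / (2 * \<i>) * (exp (\<i> * z) * half_theta \<tau> (exp (2 * \<i> * z)) - exp (- (\<i> * z)) * half_theta \<tau> (exp (- (2 * \<i> * z)))))"
    by simp
  then show ?thesis unfolding theta_def by (subst sums_unique[symmetric], assumption) simp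
qed

lemma theta4_eq_half_theta:
  "theta4 \<tau> z = half_theta \<tau> (exp (2 * \<i> * z - \<i> * of_real pi * \<tau>)) + half_theta \<tau> (exp (- (2 * \<i> * z) - \<i> * of_real pi * \<tau>)) - 1"
proof -
  let ?f = "\<lambda>w n. (-1) ^ n * exp (\<i> * of_real pi * \<tau> * (of_nat n * (of_nat n + 1))) * w ^ n"
  let ?w = "exp (2 * \<i> * z - \<i> * of_real pi * \<tau>)" and ?v = "exp (- (2 * \<i> * z) - \<i> * of_real pi * \<tau>)"
  have s: "(\<lambda>n. ?f w (Suc n)) sums (half_theta \<tau> w - 1)" for w
    unfolding half_theta_def using summable_sums[OF summable_half_theta[of w]] by (subst sums_Suc_iff) simp
  have "(\<lambda>n. ?f ?w (Suc n) + ?f ?v (Suc n)) sums ((half_theta \<tau> ?w - 1) + (half_theta \<tau> ?v - 1))"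
    by (intro sums_add s)
  moreover have "?f ?w (Suc n) + ?f ?v (Suc n) = 2 * ((-1) ^ Suc n * exp (\<i> * of_real pi * \<tau> * (of_nat (Suc n))\<^sup>2)
      * cos (2 * of_nat (Suc n) * z))" for n
  proof -
    have 1: "exp (\<i> * of_real pi * \<tau> * (of_nat (Suc n) * (of_nat (Suc n) + 1))) * ?w ^ Suc n
        = exp (\<i> * of_real pi * \<tau> * (of_nat (Suc n))\<^sup>2) * exp (\<i> * (2 * of_nat (Suc n) * z))"
      unfolding exp_of_nat_mult[symmetric] exp_add[symmetric]
      by (rule arg_cong[of _ _ exp]) (simp add: power2_eq_square algebra_simps)
    have 2: "exp (\<i> * of_real pi * \<tau> * (of_nat (Suc n) * (of_nat (Suc n) + 1))) * ?v ^ Suc n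
        = exp (\<i> * of_real pi * \<tau> * (of_nat (Suc n))\<^sup>2) * exp (- (\<i> * (2 * of_nat (Suc n) * z)))"
      unfolding exp_of_nat_mult[symmetric] exp_add[symmetric]
      by (rule arg_cong[of _ _ exp]) (simp add: power2_eq_square algebra_simps)
    have "?f ?w (Suc n) + ?f ?v (Suc n) = (-1) ^ Suc n * (exp (\<i> * of_real pi * \<tau> * (of_nat (Suc n))\<^sup>2) *
       (exp (\<i> * (2 * of_nat (Suc n) * z)) + exp (- (\<i> * (2 * of_nat (Suc n) * z)))))"
      unfolding mult.assoc 1[unfolded mult.assoc] 2[unfolded mult.assoc] by (simp only: distrib_left)
    then show ?thesis unfolding cos_exp_eq by simp
  qed
  ultimately have h: "(\<lambda>n. 2 * ((-1) ^ Suc n * exp (\<i> * of_real pi * \<tau> * (of_nat (Suc n))\<^sup>2) * cos (2 * of_nat (Suc n) * z)))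
    sums ((half_theta \<tau> ?w - 1) + (half_theta \<tau> ?v - 1))" by simp
  have "(\<lambda>n. ((-1) ^ Suc n * exp (\<i> * of_real pi * \<tau> * (of_nat (Suc n))\<^sup>2) * cos (2 * of_nat (Suc n) * z)))
    sums (((half_theta \<tau> ?w - 1) + (half_theta \<tau> ?v - 1)) / 2)" using sums_divide[OF h, of 2] by simp
  from sums_unique[OF this] show ?thesis unfolding theta4_def by (simp add: field_simps)
qed

lemma theta_holomorphic: "theta \<tau> holomorphic_on A"
proof -
  have "(\<lambda>z. - \<i> * exp (\<i> * of_real pi * \<tau> / 4) *
     (exp (\<i> * z) * half_theta \<tau> (exp (2 * \<i> * z)) - exp (- (\<i> * z)) * half_theta \<tau> (exp (- (2 * \<i> * z))))) holomorphic_on A"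
    by (intro holomorphic_intros holomorphic_on_compose_gen[OF _ half_theta_holomorphic[of UNIV], unfolded o_def]) auto
  then show ?thesis using theta_eq_half_theta by (metis (no_types, lifting) holomorphic_cong)
qed

lemma theta4_holomorphic: "theta4 \<tau> holomorphic_on A"
proof -
  have "(\<lambda>z. half_theta \<tau> (exp (2 * \<i> * z - \<i> * of_real pi * \<tau>)) + half_theta \<tau> (exp (- (2 * \<i> * z) - \<i> * of_real pi * \<tau>)) - 1) holomorphic_on A"
    by (intro holomorphic_intros holomorphic_on_compose_gen[OF _ half_theta_holomorphic[of UNIV], unfolded o_def]) auto
  then show ?thesis using theta4_eq_half_theta by (metis (no_types, lifting) holomorphic_cong)
qed

lemma theta_minus: "theta \<tau> (- z) = - theta \<tau> z"
  unfolding theta_eq_half_theta by (simp add: algebra_simps)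

lemma theta4_minus: "theta4 \<tau> (- z) = theta4 \<tau> z"
  unfolding theta4_eq_half_theta by (simp add: algebra_simps)

lemma theta_0: "theta \<tau> 0 = 0"
  using theta_minus[of 0] by simp

lemma theta_add_pi: "theta \<tau> (z + of_real pi) = - theta \<tau> z"
proof -
  have 1: "exp (\<i> * (z + of_real pi)) = - exp (\<i> * z)" "exp (- (\<i> * (z + of_real pi))) = - exp (- (\<i> * z))"
    using exp_add[of "\<i> * z" "\<i> * of_real pi"] exp_diff[of "- (\<i> * z)" "\<i> * of_real pi"]
    by (simp_all add: distrib_left)
  have 2: "exp (2 * \<i> * (z + of_real pi)) = exp (2 * \<i> * z)" "exp (- (2 * \<i> * (z + of_real pi))) = exp (- (2 * \<i> * z))"
    using 1 exp_double[of "\<i> * (z + of_real pi)"] exp_double[of "\<i> * z"]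
      exp_double[of "- (\<i> * (z + of_real pi))"] exp_double[of "- (\<i> * z)"] by (simp_all add: mult.assoc)
  show ?thesis unfolding theta_eq_half_theta 1 2 by (simp add: algebra_simps)
qed

lemma theta_add_tau: "theta \<tau> (z + of_real pi * \<tau>) = - exp (- (\<i> * of_real pi * \<tau>) - 2 * \<i> * z) * theta \<tau> z"
proof -
  define q where "q = exp (\<i> * of_real pi * \<tau>)"
  define y where "y = exp (\<i> * z)"
  have nz: "q \<noteq> 0" "y \<noteq> 0" by (simp_all add: q_def y_def)
  have e: "exp (\<i> * (z + of_real pi * \<tau>)) = q * y" "exp (- (\<i> * (z + of_real pi * \<tau>))) = inverse (q * y)"
    "exp (2 * \<i> * (z + of_real pi * \<tau>)) = q\<^sup>2 * y\<^sup>2" "exp (- (2 * \<i> * (z + of_real pi * \<tau>))) = inverse (q\<^sup>2 * y\<^sup>2)"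
    "exp (- (\<i> * of_real pi * \<tau>) - 2 * \<i> * z) = inverse (q * y\<^sup>2)"
    "exp (- (\<i> * z)) = inverse y" "exp (2 * \<i> * z) = y\<^sup>2" "exp (- (2 * \<i> * z)) = inverse (y\<^sup>2)"
    "exp (2 * \<i> * of_real pi * \<tau>) = q\<^sup>2"
    unfolding q_def y_def exp_double[symmetric] power2_eq_square exp_add[symmetric] exp_minus[symmetric]
    by (rule arg_cong[of _ _ exp], simp add: algebra_simps)+
  have h1: "half_theta \<tau> (y\<^sup>2) = 1 - q\<^sup>2 * y\<^sup>2 * half_theta \<tau> (q\<^sup>2 * y\<^sup>2)"
    using half_theta_shift[of "y\<^sup>2"] unfolding e by simp
  have h2: "half_theta \<tau> (inverse (q\<^sup>2 * y\<^sup>2)) = 1 - inverse (y\<^sup>2) * half_theta \<tau> (inverse (y\<^sup>2))"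
    using half_theta_shift[of "inverse (q\<^sup>2 * y\<^sup>2)"] nz unfolding e by (simp add: field_simps)
  \<comment> \<open>one shift of \<open>half_theta\<close> at each of the two arguments, in opposite directions\<close>
  show ?thesis
    unfolding theta_eq_half_theta e h1 h2 y_def[symmetric] using nz by (simp add: field_simps power2_eq_square)
qed

lemma theta_add_half_tau:
  "theta \<tau> (z + of_real pi / 2 * \<tau>) = \<i> * exp (- (\<i> * of_real pi * \<tau> / 4)) * exp (- (\<i> * z)) * theta4 \<tau> z"
proof -
  define q where "q = exp (\<i> * of_real pi * \<tau> / 4)"
  define y where "y = exp (\<i> * z)"
  have nz: "q \<noteq> 0" "y \<noteq> 0" by (simp_all add: q_def y_def)
  have e: "exp (\<i> * (z + of_real pi / 2 * \<tau>)) = q\<^sup>2 * y" "exp (- (\<i> * (z + of_real pi / 2 * \<tau>))) = inverse (q\<^sup>2 * y)"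
    "exp (2 * \<i> * (z + of_real pi / 2 * \<tau>)) = q ^ 4 * y\<^sup>2" "exp (- (2 * \<i> * (z + of_real pi / 2 * \<tau>))) = inverse (q ^ 4 * y\<^sup>2)"
    "exp (- (\<i> * z)) = inverse y" "exp (2 * \<i> * of_real pi * \<tau>) = q ^ 8"
    "exp (2 * \<i> * z - \<i> * of_real pi * \<tau>) = y\<^sup>2 * inverse (q ^ 4)"
    "exp (- (2 * \<i> * z) - \<i> * of_real pi * \<tau>) = inverse (q ^ 4 * y\<^sup>2)"
    "exp (- (\<i> * of_real pi * \<tau> / 4)) = inverse q"
    unfolding q_def y_def exp_of_nat_mult[symmetric] exp_add[symmetric] exp_minus[symmetric]
    by (rule arg_cong[of _ _ exp], simp add: algebra_simps)+
  have h: "half_theta \<tau> (y\<^sup>2 * inverse (q ^ 4)) = 1 - q ^ 4 * y\<^sup>2 * half_theta \<tau> (q ^ 4 * y\<^sup>2)"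
  proof -
    have "q ^ 8 * (y\<^sup>2 * inverse (q ^ 4)) = q ^ 4 * y\<^sup>2" using nz by (simp add: field_simps flip: power_add)
    then show ?thesis using half_theta_shift[of "y\<^sup>2 * inverse (q ^ 4)"] unfolding e by (simp only:)
  qed
  show ?thesis
    unfolding theta_eq_half_theta theta4_eq_half_theta e h q_def[symmetric] y_def[symmetric] using nz
    by (simp add: field_simps eval_nat_numeral)
qed

text \<open>
  Otherwise \<open>half_theta\<close> would satisfy \<open>A(x) = A(1/x)/x\<close> and thus be an entire function that tends to \<open>0\<close>
  at infinity, against \<open>A(0) = 1\<close>.
\<close>

lemma theta_not_identically_0: "\<exists>z. theta \<tau> z \<noteq> 0"
proof (rule ccontr)
  assume "\<nexists>z. theta \<tau> z \<noteq> 0"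
  then have z: "exp (\<i> * z) * half_theta \<tau> (exp (2 * \<i> * z)) = exp (- (\<i> * z)) * half_theta \<tau> (exp (- (2 * \<i> * z)))" for z
    using theta_eq_half_theta[of z] by simp
  have inv: "half_theta \<tau> x = half_theta \<tau> (inverse x) * inverse x" if "x \<noteq> 0" for x
  proof -
    define z where "z = Ln x / (2 * \<i>)"
    define y where "y = exp (\<i> * z)"
    have "exp (2 * \<i> * z) = x" using that by (simp add: z_def)
    then have y: "x = y\<^sup>2" "y \<noteq> 0" unfolding y_def exp_double[symmetric] by (simp_all add: mult.assoc)
    have "exp (- (2 * \<i> * z)) = inverse x" "exp (- (\<i> * z)) = inverse y"
      using \<open>exp (2 * \<i> * z) = x\<close> by (simp_all add: exp_minus y_def)
    then have "y * half_theta \<tau> x = inverse y * half_theta \<tau> (inverse x)"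
      using z[of z] \<open>exp (2 * \<i> * z) = x\<close> by (simp add: y_def)
    then show ?thesis using y by (simp add: field_simps power2_eq_square)
  qed
  have "((\<lambda>x. half_theta \<tau> (inverse x) * inverse x) \<longlongrightarrow> half_theta \<tau> 0 * 0) at_infinity"
  proof (rule tendsto_mult)
    show "(inverse \<longlongrightarrow> (0::complex)) at_infinity" by (rule tendsto_inverse_0)
    have "isCont (half_theta \<tau>) 0"
      using half_theta_holomorphic[of UNIV] holomorphic_on_imp_continuous_on continuous_on_eq_continuous_at by blast
    then show "((\<lambda>x. half_theta \<tau> (inverse x)) \<longlongrightarrow> half_theta \<tau> 0) at_infinity"
      by (rule isCont_tendsto_compose) (rule tendsto_inverse_0)
  qed
  then have lim: "((\<lambda>x. half_theta \<tau> (inverse x) * inverse x) \<longlongrightarrow> 0) at_infinity" by simp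
  have "eventually (\<lambda>x. half_theta \<tau> (inverse x) * inverse x = half_theta \<tau> x) at_infinity"
    unfolding eventually_at_infinity
  proof (intro exI[of _ 1] allI impI)
    fix x :: complex assume "1 \<le> norm x"
    then have "x \<noteq> 0" by auto
    then show "half_theta \<tau> (inverse x) * inverse x = half_theta \<tau> x" using inv[of x] by simp
  qed
  with lim have "(half_theta \<tau> \<longlongrightarrow> 0) at_infinity" by (rule Lim_transform_eventually)
  then have "half_theta \<tau> 0 = 0" by (rule Liouville_weak[OF half_theta_holomorphic])
  then show False by (simp add: half_theta_0)
qed

end

section \<open>Elliptic functions\<close>

lemma torus_eq_refl [simp]: "torus_eq \<tau> z z"
  unfolding torus_eq_def by (intro exI[of _ 0]) simp

lemma torus_eq_sym: "torus_eq \<tau> z w \<Longrightarrow> torus_eq \<tau> w z"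
proof -
  assume "torus_eq \<tau> z w"
  then obtain m n :: int where "z - w = of_int m * of_real pi + of_int n * of_real pi * \<tau>" by (auto simp: torus_eq_def)
  then have "w - z = of_int (- m) * of_real pi + of_int (- n) * of_real pi * \<tau>" by (simp add: algebra_simps)
  then show ?thesis unfolding torus_eq_def by blast
qed

lemma torus_eq_trans: "torus_eq \<tau> x y \<Longrightarrow> torus_eq \<tau> y z \<Longrightarrow> torus_eq \<tau> x z"
proof -
  assume "torus_eq \<tau> x y" "torus_eq \<tau> y z"
  then obtain m n m' n' :: int where "x - y = of_int m * of_real pi + of_int n * of_real pi * \<tau>"
    "y - z = of_int m' * of_real pi + of_int n' * of_real pi * \<tau>" by (auto simp: torus_eq_def)
  then have "x - z = of_int (m + m') * of_real pi + of_int (n + n') * of_real pi * \<tau>" by (simp add: algebra_simps)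
  then show ?thesis unfolding torus_eq_def by blast
qed

lemma torus_eq_periodic:
  assumes "\<And>z. f (z + of_real pi) = f z" "\<And>z. f (z + of_real pi * \<tau>) = f z" "torus_eq \<tau> z w"
  shows "f z = f w"
proof -
  have shift: "f (z + of_int m * p) = f z" if "\<And>z. f (z + p) = f z" for m :: int and p z
  proof (induction m rule: int_induct[of _ 0])
    case (step1 i)
    then show ?case using that[of "z + of_int i * p"] by (simp add: algebra_simps)
  next
    case (step2 i)
    then show ?case using that[of "z + of_int (i - 1) * p"] by (simp add: algebra_simps)
  qed simp
  obtain m n :: int where "z - w = of_int m * of_real pi + of_int n * of_real pi * \<tau>"
    using assms(3) by (auto simp: torus_eq_def)
  then have "z = (w + of_int m * of_real pi) + of_int n * (of_real pi * \<tau>)" by (simp add: algebra_simps)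
  then show ?thesis using shift[OF assms(1)] shift[OF assms(2)] by simp
qed

lemma torus_reduce:
  assumes "Im \<tau> > 0"
  obtains w where "torus_eq \<tau> z w" "w \<in> (\<lambda>(x, y). of_real x + of_real y * \<tau>) ` ({0..pi} \<times> {0..pi})"
proof -
  define y where "y = Im z / Im \<tau>"
  define x where "x = Re (z - of_real y * \<tau>)"
  have z: "z = of_real x + of_real y * \<tau>" using assms by (simp add: complex_eq_iff x_def y_def)
  have r: "c - of_int \<lfloor>c / pi\<rfloor> * pi \<in> {0..pi}" for c
    using floor_divide_lower[of pi c] floor_divide_upper[of pi c] by (auto simp: algebra_simps)
  let ?x = "x - of_int \<lfloor>x / pi\<rfloor> * pi" and ?y = "y - of_int \<lfloor>y / pi\<rfloor> * pi"
  show ?thesis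
  proof (rule that)
    show "torus_eq \<tau> z (of_real ?x + of_real ?y * \<tau>)"
      unfolding torus_eq_def by (intro exI[of _ "\<lfloor>x / pi\<rfloor>"] exI[of _ "\<lfloor>y / pi\<rfloor>"]) (simp add: z algebra_simps)
    show "of_real ?x + of_real ?y * \<tau> \<in> (\<lambda>(x, y). of_real x + of_real y * \<tau>) ` ({0..pi} \<times> {0..pi})"
      using r[of x] r[of y] by (intro image_eqI[of _ _ "(?x, ?y)"]) auto
  qed
qed

lemma elliptic_entire_constant:
  assumes "Im \<tau> > 0" "f holomorphic_on UNIV"
    and "\<And>z. f (z + of_real pi) = f z" "\<And>z. f (z + of_real pi * \<tau>) = f z"
  shows "\<exists>c. \<forall>z. f z = c"
proof -
  let ?K = "(\<lambda>(x, y). of_real x + of_real y * \<tau>) ` ({0..pi} \<times> {0..pi})"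
  have "compact ?K"
  proof (rule compact_continuous_image)
    show "continuous_on ({0..pi} \<times> {0..pi}) (\<lambda>(x, y). of_real x + of_real y * \<tau>)"
      unfolding case_prod_unfold by (intro continuous_intros)
    show "compact ({0..pi} \<times> {0..pi})" by (intro compact_Times compact_Icc)
  qed
  then have "compact (f ` ?K)"
  proof (rule compact_continuous_image[rotated])
    show "continuous_on ?K f"
      using assms(2) by (meson continuous_on_subset holomorphic_on_imp_continuous_on subset_UNIV)
  qed
  moreover have "range f \<subseteq> f ` ?K"
  proof
    fix y assume "y \<in> range f"
    then obtain z where z: "y = f z" by blast
    obtain w where "torus_eq \<tau> z w" "w \<in> ?K" using torus_reduce[OF assms(1)] .
    then show "y \<in> f ` ?K" using torus_eq_periodic[OF assms(3,4)] z by (metis imageI)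
  qed
  ultimately have "bounded (range f)" using compact_imp_bounded bounded_subset by blast
  then have "f constant_on UNIV" using Liouville_theorem assms(2) by blast
  then show ?thesis by (auto simp: constant_on_def)
qed

lemma tendsto_ratio_simple_zero:
  fixes f g :: "complex \<Rightarrow> complex"
  assumes "f field_differentiable at z" "g field_differentiable at z" "f z = 0" "g z = 0" "deriv g z \<noteq> 0"
  shows "((\<lambda>w. f w / g w) \<longlongrightarrow> deriv f z / deriv g z) (at z)"
proof -
  have "((\<lambda>w. (f w - f z) / (w - z)) \<longlongrightarrow> deriv f z) (at z)" "((\<lambda>w. (g w - g z) / (w - z)) \<longlongrightarrow> deriv g z) (at z)"
    using assms(1,2) DERIV_deriv_iff_field_differentiable unfolding has_field_derivative_iff by blast+
  then have "((\<lambda>w. ((f w - f z) / (w - z)) / ((g w - g z) / (w - z))) \<longlongrightarrow> deriv f z / deriv g z) (at z)"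
    using assms(5) by (intro tendsto_divide)
  then show ?thesis
    by (rule Lim_transform_eventually) (auto simp: eventually_at_filter assms(3,4))
qed

text \<open>
  The quotient is elliptic, and its singularities are removable at one zero of \<open>g\<close> in each class
  modulo the lattice, hence everywhere.
\<close>

lemma elliptic_ratio_constant:
  assumes tau: "Im \<tau> > 0" and hol: "f holomorphic_on UNIV" "g holomorphic_on UNIV"
    and per: "\<And>z. f (z + of_real pi) / g (z + of_real pi) = f z / g z"
      "\<And>z. f (z + of_real pi * \<tau>) / g (z + of_real pi * \<tau>) = f z / g z"
    and zeros: "\<And>z. g z = 0 \<Longrightarrow> \<exists>w. torus_eq \<tau> w z \<and> f w = 0 \<and> g w = 0 \<and> deriv g w \<noteq> 0"
  shows "\<exists>c. \<forall>z. f z = c * g z"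
proof -
  let ?F = "\<lambda>z. f z / g z"
  have diff: "f field_differentiable at z" "g field_differentiable at z" for z
    using hol holomorphic_on_imp_differentiable_at by auto
  have cont: "isCont f z" "isCont g z" for z using diff field_differentiable_imp_continuous_at by blast+
  have ana: "f analytic_on A" "g analytic_on A" for A
    using hol analytic_on_subset[of _ UNIV A] by (simp_all add: analytic_on_open)
  have shift: "?F (u + p) = ?F u" if "torus_eq \<tau> (z + p) z" for u z p
  proof (rule torus_eq_periodic[where f = ?F and \<tau> = \<tau>])
    show "torus_eq \<tau> (u + p) u" using that by (simp add: torus_eq_def)
  qed (use per in auto)
  have lim: "\<exists>l. ?F \<midarrow>z\<rightarrow> l" for z
  proof (cases "g z = 0")
    case False
    then have "isCont ?F z" using cont by (intro continuous_intros) auto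
    then show ?thesis by (auto simp: isCont_def)
  next
    case True
    then obtain w where w: "torus_eq \<tau> w z" "f w = 0" "g w = 0" "deriv g w \<noteq> 0" using zeros by blast
    have "?F \<midarrow>w\<rightarrow> deriv f w / deriv g w" by (rule tendsto_ratio_simple_zero[OF diff w(2-4)])
    then have "(\<lambda>u. ?F (u + (w - z))) \<midarrow>z\<rightarrow> deriv f w / deriv g w"
      using LIM_offset[of ?F _ w "w - z"] by simp
    moreover have "?F (u + (w - z)) = ?F u" for u using shift[of z "w - z" u] w(1) by simp
    ultimately show ?thesis by auto
  qed
  have "?F meromorphic_on UNIV"
    by (intro meromorphic_on_divide analytic_on_imp_meromorphic_on ana)
  then have iso: "isolated_singularity_at ?F z" for z
    using meromorphic_on_isolated_singularity meromorphic_on_subset by blast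
  define H where "H = remove_sings ?F"
  have "H analytic_on {z}" for z
    using lim[of z] remove_sings_analytic_at[OF iso] unfolding H_def by blast
  then have H: "H holomorphic_on UNIV"
    using analytic_on_analytic_at analytic_imp_holomorphic by blast
  have Hper: "H (z + p) = H z" if "\<And>u. ?F (u + p) = ?F u" for z p
  proof -
    have "H (z + p) = remove_sings (\<lambda>w. ?F (z + p + w)) 0" unfolding H_def by (rule remove_sings_shift_0)
    also have "(\<lambda>w. ?F (z + p + w)) = (\<lambda>w. ?F (z + w))"
    proof
      fix w show "?F (z + p + w) = ?F (z + w)" using that[of "z + w"] by (simp add: ac_simps)
    qed
    also have "remove_sings \<dots> 0 = H z" unfolding H_def by (rule remove_sings_shift_0[symmetric])
    finally show ?thesis .
  qed
  obtain c where c: "\<And>z. H z = c"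
    using elliptic_entire_constant[OF tau H] Hper per by blast
  have main: "f z = c * g z" if "g z \<noteq> 0" for z
  proof -
    have "?F analytic_on {z}" using that ana by (intro analytic_intros) auto
    then have "H z = ?F z" unfolding H_def by simp
    then show ?thesis using c[of z] that by (simp add: field_simps)
  qed
  have "f z = c * g z" for z
  proof (cases "g z = 0")
    case True
    then obtain w where w: "deriv g w \<noteq> 0" using zeros by blast
    have "\<exists>b. g b \<noteq> 0"
    proof (rule ccontr)
      assume "\<nexists>b. g b \<noteq> 0"
      then have "g = (\<lambda>_. 0)" by auto
      then show False using w by simp
    qed
    then obtain b where "g b \<noteq> 0" by blast
    then obtain r where r: "r > 0" "\<And>u. u \<in> ball z r - {z} \<Longrightarrow> g u \<noteq> 0"
      using isolated_zeros[OF hol(2) open_UNIV connected_UNIV _ True] by (metis UNIV_I)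
    have ev: "eventually (\<lambda>u. f u - c * g u = 0) (at z)"
      unfolding eventually_at using r main by (intro exI[of _ r]) (auto simp: dist_commute)
    have "isCont (\<lambda>u. f u - c * g u) z"
      using cont by (intro continuous_intros) auto
    then have "(\<lambda>u. f u - c * g u) \<midarrow>z\<rightarrow> f z - c * g z" by (simp add: isCont_def)
    moreover have "(\<lambda>u. f u - c * g u) \<midarrow>z\<rightarrow> 0" by (rule tendsto_eventually[OF ev])
    ultimately have "f z - c * g z = 0" by (rule LIM_unique)
    then show ?thesis by simp
  qed (rule main)
  then show ?thesis by blast
qed

section \<open>The infinite product and the zeros of theta\<close>

text \<open>
  The \<open>q\<close>-Pochhammer symbol \<open>(w; Q)\<close> with infinitely many factors. The definition by a limit covers the
  points where a factor vanishes.
\<close>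

definition q_product :: "complex \<Rightarrow> complex \<Rightarrow> complex" where
  "q_product Q w = lim (\<lambda>N. \<Prod>n<N. 1 - Q ^ n * w)"

context
  fixes Q :: complex
  assumes Q: "norm Q < 1"
begin

lemma q_product_uniform:
  "uniform_limit (cball 0 R) (\<lambda>N w. \<Prod>n<N. 1 - Q ^ n * w) (q_product Q) sequentially"
proof -
  have "uniformly_convergent_on (cball 0 R) (\<lambda>N w. \<Prod>n<N. 1 + - (Q ^ n * w))"
  proof (rule uniformly_convergent_on_prod)
    show "uniformly_convergent_on (cball 0 R) (\<lambda>N w. \<Sum>n<N. norm (- (Q ^ n * w)))"
    proof (rule Weierstrass_m_test')
      show "summable (\<lambda>n. norm Q ^ n * R)" using Q by (intro summable_mult2 summable_geometric) simp
    qed (auto simp: norm_mult norm_power intro!: mult_left_mono)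
  qed (auto intro!: continuous_intros)
  then obtain l where l: "uniform_limit (cball 0 R) (\<lambda>N w. \<Prod>n<N. 1 - Q ^ n * w) l sequentially"
    by (auto simp: uniformly_convergent_on_def)
  moreover have "q_product Q w = l w" if "w \<in> cball 0 R" for w
    unfolding q_product_def using tendsto_uniform_limitI[OF l that] by (rule limI)
  ultimately show ?thesis by (metis (no_types, lifting) uniform_limit_cong')
qed

lemma q_product_LIMSEQ: "(\<lambda>N. \<Prod>n<N. 1 - Q ^ n * w) \<longlonglongrightarrow> q_product Q w"
  using tendsto_uniform_limitI[OF q_product_uniform[of "norm w"], of w] by simp

lemma q_product_holomorphic: "q_product Q holomorphic_on A"
proof -
  have "q_product Q holomorphic_on ball 0 R" for R
  proof (rule holomorphic_uniform_limit[OF _ q_product_uniform[of R]])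
    show "\<forall>\<^sub>F n in sequentially. continuous_on (cball 0 R) (\<lambda>w. \<Prod>n<n. 1 - Q ^ n * w) \<and>
        (\<lambda>w. \<Prod>n<n. 1 - Q ^ n * w) holomorphic_on ball 0 R"
      by (intro always_eventually allI conjI continuous_intros holomorphic_intros)
  qed simp
  then have "q_product Q field_differentiable at z" for z
    using holomorphic_on_imp_differentiable_at[of "q_product Q" "ball 0 (norm z + 1)" z] by simp
  then show ?thesis by (simp add: holomorphic_on_def field_differentiable_at_within)
qed

lemma q_product_shift: "q_product Q w = (1 - w) * q_product Q (Q * w)"
proof -
  have eq: "(\<Prod>n<Suc N. 1 - Q ^ n * w) = (1 - w) * (\<Prod>n<N. 1 - Q ^ n * (Q * w))" for N
    by (subst prod.lessThan_Suc_shift) (simp add: mult.assoc mult.left_commute)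
  have "(\<lambda>N. \<Prod>n<Suc N. 1 - Q ^ n * w) \<longlonglongrightarrow> q_product Q w"
    by (rule LIMSEQ_Suc[OF q_product_LIMSEQ])
  then have "(\<lambda>N. (1 - w) * (\<Prod>n<N. 1 - Q ^ n * (Q * w))) \<longlonglongrightarrow> q_product Q w"
    unfolding eq .
  moreover have "(\<lambda>N. (1 - w) * (\<Prod>n<N. 1 - Q ^ n * (Q * w))) \<longlonglongrightarrow> (1 - w) * q_product Q (Q * w)"
    by (intro tendsto_intros q_product_LIMSEQ)
  ultimately show ?thesis by (rule LIMSEQ_unique)
qed

lemma q_product_nonzero:
  assumes "\<And>n. Q ^ n * w \<noteq> 1" shows "q_product Q w \<noteq> 0"
proof -
  have "summable (\<lambda>n. norm (1 - Q ^ n * w - 1))"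
    using Q by (simp add: norm_mult norm_power summable_mult2 summable_geometric)
  then have "convergent_prod (\<lambda>n. 1 - Q ^ n * w)"
    by (intro abs_convergent_prod_imp_convergent_prod summable_imp_abs_convergent_prod)
  moreover have "1 - Q ^ n * w \<noteq> 0" for n using assms[of n] by simp
  ultimately show ?thesis unfolding q_product_def
    using prodinf_eq_lim'[of "\<lambda>n. 1 - Q ^ n * w"] prodinf_nonzero[of "\<lambda>n. 1 - Q ^ n * w"] by simp
qed

end


text \<open>
  Up to a constant, this is \<open>\<theta>(z)/sin z\<close> by Jacobi's triple product.
\<close>

definition theta_regular :: "complex \<Rightarrow> complex \<Rightarrow> complex" where
  "theta_regular \<tau> z = (let Q = exp (2 * \<i> * of_real pi * \<tau>) in
     q_product Q (Q * exp (2 * \<i> * z)) * q_product Q (Q * exp (- (2 * \<i> * z))))"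

definition dlog_theta :: "complex \<Rightarrow> complex \<Rightarrow> complex" where
  "dlog_theta \<tau> z = deriv (theta \<tau>) z / theta \<tau> z"

context
  fixes \<tau> :: complex
  assumes tau: "Im \<tau> > 0"
begin

lemma nome_lt_1: "norm (exp (2 * \<i> * of_real pi * \<tau>)) < 1"
  using tau by (simp add: norm_exp_eq_Re)

lemma theta_regular_holomorphic: "theta_regular \<tau> holomorphic_on A"
  unfolding theta_regular_def Let_def
  by (intro holomorphic_intros holomorphic_on_compose_gen[OF _ q_product_holomorphic[OF nome_lt_1, of UNIV], unfolded o_def]) auto

lemma theta_regular_nonzero_aux:
  assumes "\<And>n. exp (2 * \<i> * of_real pi * \<tau> * of_nat (Suc n) + 2 * \<i> * z) \<noteq> 1"
    and "\<And>n. exp (2 * \<i> * of_real pi * \<tau> * of_nat (Suc n) - 2 * \<i> * z) \<noteq> 1"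
  shows "theta_regular \<tau> z \<noteq> 0"
proof -
  let ?Q = "exp (2 * \<i> * of_real pi * \<tau>)"
  have 1: "?Q ^ n * (?Q * exp (2 * \<i> * z)) = exp (2 * \<i> * of_real pi * \<tau> * of_nat (Suc n) + 2 * \<i> * z)" for n
    unfolding exp_of_nat_mult[symmetric] exp_add[symmetric] by (rule arg_cong[of _ _ exp]) (simp add: algebra_simps)
  have 2: "?Q ^ n * (?Q * exp (- (2 * \<i> * z))) = exp (2 * \<i> * of_real pi * \<tau> * of_nat (Suc n) - 2 * \<i> * z)" for n
    unfolding exp_of_nat_mult[symmetric] exp_add[symmetric] by (rule arg_cong[of _ _ exp]) (simp add: algebra_simps)
  show ?thesis unfolding theta_regular_def Let_def
    using q_product_nonzero[OF nome_lt_1] assms unfolding mult_eq_0_iff 1[symmetric] 2[symmetric] by metis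
qed

lemma theta_regular_nonzero:
  assumes "\<bar>Im z\<bar> < pi * Im \<tau>" shows "theta_regular \<tau> z \<noteq> 0"
proof (rule theta_regular_nonzero_aux)
  fix n :: nat
  have "pi * Im \<tau> * 1 \<le> pi * Im \<tau> * real (Suc n)" using tau by (intro mult_left_mono) auto
  then have a: "\<bar>Im z\<bar> < pi * Im \<tau> * real (Suc n)" using assms by linarith
  have "norm (exp (2 * \<i> * of_real pi * \<tau> * of_nat (Suc n) + 2 * \<i> * z)) < 1"
       "norm (exp (2 * \<i> * of_real pi * \<tau> * of_nat (Suc n) - 2 * \<i> * z)) < 1"
    using a by (simp_all add: norm_exp_eq_Re algebra_simps abs_less_iff)
  then show "exp (2 * \<i> * of_real pi * \<tau> * of_nat (Suc n) + 2 * \<i> * z) \<noteq> 1"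
    "exp (2 * \<i> * of_real pi * \<tau> * of_nat (Suc n) - 2 * \<i> * z) \<noteq> 1" by (metis less_irrefl norm_one)+
qed

lemma theta_regular_zero: "theta_regular \<tau> z = 0 \<Longrightarrow> torus_eq \<tau> 0 z"
proof -
  assume "theta_regular \<tau> z = 0"
  then obtain n and \<sigma> :: complex where \<sigma>: "\<sigma> = 1 \<or> \<sigma> = - 1"
    "exp (2 * \<i> * of_real pi * \<tau> * of_nat (Suc n) + 2 * \<i> * (\<sigma> * z)) = 1"
    using theta_regular_nonzero_aux[of z] by (metis diff_conv_add_uminus mult_1 mult_minus1 mult_minus_right)
  then obtain k :: int where
    "2 * \<i> * of_real pi * \<tau> * of_nat (Suc n) + 2 * \<i> * (\<sigma> * z) = of_int (2 * k) * of_real pi * \<i>"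
    unfolding exp_eq_1 by (force simp: complex_eq_iff)
  then have "(2 * \<i>) * (of_real pi * \<tau> * of_nat (Suc n) + \<sigma> * z) = (2 * \<i>) * (of_int k * of_real pi)"
    by (simp add: algebra_simps)
  then have "of_real pi * \<tau> * of_nat (Suc n) + \<sigma> * z = of_int k * of_real pi"
    unfolding mult_cancel_left by simp
  then have z: "\<sigma> * z = of_int k * of_real pi - of_real pi * \<tau> * of_nat (Suc n)" by (simp add: algebra_simps)
  from \<sigma>(1) show ?thesis
  proof
    assume "\<sigma> = 1"
    then have "0 - z = of_int (- k) * of_real pi + of_int (int (Suc n)) * of_real pi * \<tau>"
      using z by (simp add: algebra_simps)
    then show ?thesis unfolding torus_eq_def by blast
  next
    assume "\<sigma> = - 1"
    then have "0 - z = of_int k * of_real pi + of_int (- int (Suc n)) * of_real pi * \<tau>"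
      using z by (simp add: algebra_simps)
    then show ?thesis unfolding torus_eq_def by blast
  qed
qed

lemma theta_regular_add_pi: "theta_regular \<tau> (z + of_real pi) = theta_regular \<tau> z"
proof -
  have "2 * \<i> * (z + of_real pi) = 2 * \<i> * z + 2 * of_real pi * \<i>" by (simp add: algebra_simps)
  then have "exp (2 * \<i> * (z + of_real pi)) = exp (2 * \<i> * z)" by (simp only: exp_add exp_two_pi_i mult_1_right)
  moreover from this have "exp (- (2 * \<i> * (z + of_real pi))) = exp (- (2 * \<i> * z))" by (simp only: exp_minus)
  ultimately show ?thesis unfolding theta_regular_def Let_def by simp
qed

lemma sin_theta_regular_add_tau:
  "sin (z + of_real pi * \<tau>) * theta_regular \<tau> (z + of_real pi * \<tau>)
   = - exp (- (\<i> * of_real pi * \<tau>) - 2 * \<i> * z) * (sin z * theta_regular \<tau> z)"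
proof -
  define q where "q = exp (\<i> * of_real pi * \<tau>)"
  define y where "y = exp (\<i> * z)"
  have nz: "q \<noteq> 0" "y \<noteq> 0" by (simp_all add: q_def y_def)
  have e: "exp (\<i> * (z + of_real pi * \<tau>)) = q * y" "exp (- (\<i> * (z + of_real pi * \<tau>))) = inverse (q * y)"
    "exp (2 * \<i> * (z + of_real pi * \<tau>)) = q\<^sup>2 * y\<^sup>2" "exp (- (2 * \<i> * (z + of_real pi * \<tau>))) = inverse (q\<^sup>2 * y\<^sup>2)"
    "exp (- (\<i> * of_real pi * \<tau>) - 2 * \<i> * z) = inverse (q * y\<^sup>2)"
    "exp (- (\<i> * z)) = inverse y" "exp (2 * \<i> * z) = y\<^sup>2" "exp (- (2 * \<i> * z)) = inverse (y\<^sup>2)"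
    "exp (2 * \<i> * of_real pi * \<tau>) = q\<^sup>2"
    unfolding q_def y_def exp_double[symmetric] power2_eq_square exp_add[symmetric] exp_minus[symmetric]
    by (rule arg_cong[of _ _ exp], simp add: algebra_simps)+
  have h1: "q_product (q\<^sup>2) (q\<^sup>2 * y\<^sup>2) = (1 - q\<^sup>2 * y\<^sup>2) * q_product (q\<^sup>2) (q\<^sup>2 * (q\<^sup>2 * y\<^sup>2))"
    using q_product_shift[OF nome_lt_1, of "q\<^sup>2 * y\<^sup>2"] unfolding e .
  have h2: "q_product (q\<^sup>2) (q\<^sup>2 * inverse (q\<^sup>2 * y\<^sup>2)) = (1 - inverse (y\<^sup>2)) * q_product (q\<^sup>2) (q\<^sup>2 * inverse (y\<^sup>2))"
  proof -
    have "q\<^sup>2 * inverse (q\<^sup>2 * y\<^sup>2) = inverse (y\<^sup>2)" using nz by (simp add: field_simps)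
    then show ?thesis using q_product_shift[OF nome_lt_1, of "inverse (y\<^sup>2)"] unfolding e by (simp only:)
  qed
  have alg: "(q * y - inverse (q * y)) / (2 * \<i>) * (A * ((1 - inverse (y\<^sup>2)) * B))
      = - inverse (q * y\<^sup>2) * ((y - inverse y) / (2 * \<i>) * ((1 - q\<^sup>2 * y\<^sup>2) * A * B))" for A B
    using nz by (simp add: field_simps power2_eq_square)
  show ?thesis
    unfolding theta_regular_def Let_def sin_exp_eq e h1 h2 y_def[symmetric] by (rule alg)
qed

lemma theta_field_differentiable: "theta \<tau> field_differentiable at z"
  using theta_holomorphic[OF tau] holomorphic_on_imp_differentiable_at by blast

lemma theta_regular_field_differentiable: "theta_regular \<tau> field_differentiable at z"
  using theta_regular_holomorphic holomorphic_on_imp_differentiable_at by blast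

lemma theta_regular_deriv: "(theta_regular \<tau> has_field_derivative deriv (theta_regular \<tau>) z) (at z)"
  using theta_regular_field_differentiable DERIV_deriv_iff_field_differentiable by blast

text \<open>
  Jacobi's triple product, up to the value of the constant: both sides have the same multipliers
  under \<open>\<pi>\<close> and \<open>\<pi>\<tau>\<close>, the right-hand side vanishes at lattice points only, to first
  order, and the left-hand side vanishes there too.
\<close>

lemma theta_product: "\<exists>C. C \<noteq> 0 \<and> (\<forall>z. theta \<tau> z = C * (sin z * theta_regular \<tau> z))"
proof -
  let ?P = "\<lambda>z. sin z * theta_regular \<tau> z"
  have dP: "(?P has_field_derivative theta_regular \<tau> 0) (at 0)"
    by (rule derivative_eq_intros theta_regular_deriv refl | simp)+
  have "\<exists>c. \<forall>z. theta \<tau> z = c * ?P z"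
  proof (rule elliptic_ratio_constant[OF tau theta_holomorphic[OF tau]])
    show "?P holomorphic_on UNIV" by (intro holomorphic_intros theta_regular_holomorphic)
    show "theta \<tau> (z + of_real pi) / ?P (z + of_real pi) = theta \<tau> z / ?P z" for z
      by (simp add: theta_add_pi[OF tau] theta_regular_add_pi sin_add)
    show "theta \<tau> (z + of_real pi * \<tau>) / ?P (z + of_real pi * \<tau>) = theta \<tau> z / ?P z" for z
      unfolding theta_add_tau[OF tau] sin_theta_regular_add_tau by simp
    fix z assume "?P z = 0"
    then have "torus_eq \<tau> 0 z"
    proof (cases "sin z = 0")
      case True
      then obtain k :: int where "z = of_int k * of_real pi" using sin_eq_0 by (metis of_real_mult of_real_of_int_eq)
      then have "0 - z = of_int (- k) * of_real pi + of_int 0 * of_real pi * \<tau>" by simp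
      then show ?thesis unfolding torus_eq_def by blast
    qed (use theta_regular_zero in auto)
    moreover have "deriv ?P 0 \<noteq> 0"
      using DERIV_imp_deriv[OF dP] theta_regular_nonzero[of 0] tau by simp
    ultimately show "\<exists>w. torus_eq \<tau> w z \<and> theta \<tau> w = 0 \<and> ?P w = 0 \<and> deriv ?P w \<noteq> 0"
      using theta_0[OF tau] by (intro exI[of _ 0]) auto
  qed
  then obtain C where C: "\<And>z. theta \<tau> z = C * ?P z" by blast
  moreover have "C \<noteq> 0" using C theta_not_identically_0[OF tau] by auto
  ultimately show ?thesis by blast
qed

lemma theta_eq_0_iff: "theta \<tau> z = 0 \<longleftrightarrow> torus_eq \<tau> z 0"
proof
  obtain C where C: "C \<noteq> 0" "\<And>z. theta \<tau> z = C * (sin z * theta_regular \<tau> z)" using theta_product by blast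
  assume "theta \<tau> z = 0"
  then have "sin z = 0 \<or> theta_regular \<tau> z = 0" using C by simp
  then show "torus_eq \<tau> z 0"
  proof
    assume "sin z = 0"
    then obtain k :: int where "z = of_int k * of_real pi" using sin_eq_0 by (metis of_real_mult of_real_of_int_eq)
    then have "z - 0 = of_int k * of_real pi + of_int 0 * of_real pi * \<tau>" by simp
    then show ?thesis unfolding torus_eq_def by blast
  qed (use theta_regular_zero torus_eq_sym in blast)
next
  assume "torus_eq \<tau> z 0"
  then have "(theta \<tau> z = 0) = (theta \<tau> 0 = 0)"
    by (rule torus_eq_periodic[where f = "\<lambda>z. theta \<tau> z = 0" and \<tau> = \<tau>, rotated 2])
       (simp_all add: theta_add_pi[OF tau] theta_add_tau[OF tau])
  then show "theta \<tau> z = 0" using theta_0[OF tau] by simp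
qed

section \<open>The logarithmic derivative of theta\<close>

lemma theta_deriv: "(theta \<tau> has_field_derivative deriv (theta \<tau>) z) (at z)"
  using theta_field_differentiable DERIV_deriv_iff_field_differentiable by blast

lemma theta4_deriv: "(theta4 \<tau> has_field_derivative deriv (theta4 \<tau>) z) (at z)"
  using theta4_holomorphic[OF tau] holomorphic_on_imp_differentiable_at DERIV_deriv_iff_field_differentiable by blast

lemma deriv_theta_add_pi: "deriv (theta \<tau>) (z + of_real pi) = - deriv (theta \<tau>) z"
proof -
  have "((\<lambda>z. theta \<tau> (z + of_real pi)) has_field_derivative deriv (theta \<tau>) (z + of_real pi)) (at z)"
    using theta_deriv DERIV_shift by blast
  moreover have "((\<lambda>z. - theta \<tau> z) has_field_derivative - deriv (theta \<tau>) z) (at z)"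
    by (intro derivative_intros theta_deriv)
  ultimately show ?thesis unfolding theta_add_pi[OF tau] by (rule DERIV_unique)
qed

lemma deriv_theta_add_tau: "deriv (theta \<tau>) (z + of_real pi * \<tau>)
   = - exp (- (\<i> * of_real pi * \<tau>) - 2 * \<i> * z) * (deriv (theta \<tau>) z - 2 * \<i> * theta \<tau> z)"
proof -
  have "((\<lambda>z. theta \<tau> (z + of_real pi * \<tau>)) has_field_derivative deriv (theta \<tau>) (z + of_real pi * \<tau>)) (at z)"
    using theta_deriv DERIV_shift by blast
  moreover have "((\<lambda>z. - exp (- (\<i> * of_real pi * \<tau>) - 2 * \<i> * z) * theta \<tau> z) has_field_derivative
      - exp (- (\<i> * of_real pi * \<tau>) - 2 * \<i> * z) * (deriv (theta \<tau>) z - 2 * \<i> * theta \<tau> z)) (at z)"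
    by (rule derivative_eq_intros theta_deriv refl | simp add: algebra_simps)+
  ultimately show ?thesis unfolding theta_add_tau[OF tau] by (rule DERIV_unique)
qed

lemma deriv_theta_minus: "deriv (theta \<tau>) (- z) = deriv (theta \<tau>) z"
proof -
  have "((\<lambda>z. theta \<tau> (- z)) has_field_derivative deriv (theta \<tau>) (- z) * (- 1)) (at z)"
    by (rule DERIV_chain2[OF theta_deriv]) (rule derivative_eq_intros refl)+
  moreover have "((\<lambda>z. - theta \<tau> z) has_field_derivative - deriv (theta \<tau>) z) (at z)"
    by (intro derivative_intros theta_deriv)
  ultimately have "deriv (theta \<tau>) (- z) * (- 1) = - deriv (theta \<tau>) z"
    unfolding theta_minus[OF tau] by (rule DERIV_unique)
  then show ?thesis by simp
qed

lemma deriv_theta_0_nonzero: "deriv (theta \<tau>) 0 \<noteq> 0"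
proof -
  obtain C where C: "C \<noteq> 0" "\<And>z. theta \<tau> z = C * (sin z * theta_regular \<tau> z)" using theta_product by blast
  have "((\<lambda>z. C * (sin z * theta_regular \<tau> z)) has_field_derivative C * theta_regular \<tau> 0) (at 0)"
    by (rule derivative_eq_intros theta_regular_deriv refl | simp)+
  then have "deriv (theta \<tau>) 0 = C * theta_regular \<tau> 0"
    unfolding C(2)[symmetric] by (rule DERIV_imp_deriv)
  then show ?thesis using C(1) theta_regular_nonzero[of 0] tau by simp
qed

lemma dlog_theta_add_pi: "dlog_theta \<tau> (z + of_real pi) = dlog_theta \<tau> z"
  unfolding dlog_theta_def by (simp add: deriv_theta_add_pi theta_add_pi[OF tau])

lemma dlog_theta_add_int_pi: "dlog_theta \<tau> (z + of_int k * of_real pi) = dlog_theta \<tau> z"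
proof (induction k rule: int_induct[of _ 0])
  case (step1 i)
  then show ?case using dlog_theta_add_pi[of "z + of_int i * of_real pi"] by (simp add: algebra_simps)
next
  case (step2 i)
  then show ?case using dlog_theta_add_pi[of "z + of_int (i - 1) * of_real pi"] by (simp add: algebra_simps)
qed simp

lemma dlog_theta_add_tau:
  assumes "theta \<tau> z \<noteq> 0" shows "dlog_theta \<tau> (z + of_real pi * \<tau>) = dlog_theta \<tau> z - 2 * \<i>"
  unfolding dlog_theta_def deriv_theta_add_tau theta_add_tau[OF tau] using assms by (simp add: field_simps)

lemma dlog_theta_minus: "dlog_theta \<tau> (- z) = - dlog_theta \<tau> z"
  unfolding dlog_theta_def by (simp add: deriv_theta_minus theta_minus[OF tau])

lemma dlog_theta_add_half_tau:
  assumes "theta4 \<tau> z \<noteq> 0"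
  shows "dlog_theta \<tau> (z + of_real pi / 2 * \<tau>) = deriv (theta4 \<tau>) z / theta4 \<tau> z - \<i>"
proof -
  define c where "c = \<i> * exp (- (\<i> * of_real pi * \<tau> / 4))"
  have c: "c \<noteq> 0" by (simp add: c_def)
  have t: "theta \<tau> (z + of_real pi / 2 * \<tau>) = c * exp (- (\<i> * z)) * theta4 \<tau> z" for z
    unfolding theta_add_half_tau[OF tau] c_def ..
  have "((\<lambda>z. theta \<tau> (z + of_real pi / 2 * \<tau>)) has_field_derivative deriv (theta \<tau>) (z + of_real pi / 2 * \<tau>)) (at z)"
    using theta_deriv DERIV_shift by blast
  moreover have "((\<lambda>z. c * exp (- (\<i> * z)) * theta4 \<tau> z) has_field_derivative
      c * exp (- (\<i> * z)) * (deriv (theta4 \<tau>) z - \<i> * theta4 \<tau> z)) (at z)"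
    by (rule derivative_eq_intros theta4_deriv refl | simp add: algebra_simps)+
  ultimately have "deriv (theta \<tau>) (z + of_real pi / 2 * \<tau>) = c * exp (- (\<i> * z)) * (deriv (theta4 \<tau>) z - \<i> * theta4 \<tau> z)"
    unfolding t by (rule DERIV_unique)
  then show ?thesis unfolding dlog_theta_def t using assms c by (simp add: field_simps)
qed

text \<open>
  As functions of \<open>u\<close>, both sides are elliptic with simple poles at \<open>a\<close> and \<open>b\<close>, with residues \<open>1\<close>
  and \<open>-1\<close>. The proof compares the numerators over the common denominator \<open>\<theta>(u - a) \<theta>(u - b)\<close>;
  equality of residues says that the numerator \<open>N\<close> vanishes at \<open>a\<close> and \<open>b\<close>. The remaining constant
  is found at \<open>u = x\<close>, where the left-hand side is zero.
\<close>

lemma fay_identity: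
  assumes "theta \<tau> (a - b) \<noteq> 0" "theta \<tau> (x - a) \<noteq> 0" "theta \<tau> (x - b) \<noteq> 0"
    and "theta \<tau> (u - a) \<noteq> 0" "theta \<tau> (u - b) \<noteq> 0"
  shows "theta \<tau> (b - a) * deriv (theta \<tau>) 0 * theta \<tau> (u - x) * theta \<tau> (u + x - a - b) /
      (theta \<tau> (u - a) * theta \<tau> (u - b) * theta \<tau> (x - b) * theta \<tau> (x - a))
    = dlog_theta \<tau> (u - a) - dlog_theta \<tau> (u - b) + dlog_theta \<tau> (x - b) - dlog_theta \<tau> (x - a)"
proof -
  define k where "k = theta \<tau> (b - a) * deriv (theta \<tau>) 0 / (theta \<tau> (x - b) * theta \<tau> (x - a))"
  define N where "N = (\<lambda>u. k * theta \<tau> (u - x) * theta \<tau> (u + x - a - b)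
     - deriv (theta \<tau>) (u - a) * theta \<tau> (u - b) + theta \<tau> (u - a) * deriv (theta \<tau>) (u - b))"
  define g where "g = (\<lambda>u. theta \<tau> (u - a) * theta \<tau> (u - b))"
  have flip: "theta \<tau> (p - r) = - theta \<tau> (r - p)" for p r using theta_minus[OF tau, of "r - p"] by simp
  have th: "(\<lambda>u. theta \<tau> (h u)) holomorphic_on UNIV" if "h holomorphic_on UNIV" for h
    using holomorphic_on_compose_gen[OF that theta_holomorphic[OF tau, of UNIV]] by (simp add: o_def)
  have dth: "(\<lambda>u. deriv (theta \<tau>) (h u)) holomorphic_on UNIV" if "h holomorphic_on UNIV" for h
    using holomorphic_on_compose_gen[OF that holomorphic_deriv[OF theta_holomorphic[OF tau, of UNIV]]] by (simp add: o_def)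
  have ex: "\<exists>c. \<forall>u. N u = c * g u"
  proof (rule elliptic_ratio_constant[OF tau])
    show "N holomorphic_on UNIV" unfolding N_def by (intro holomorphic_intros th dth)
    show "g holomorphic_on UNIV" unfolding g_def by (intro holomorphic_intros th)
    fix u
    have s1: "u + of_real pi - r = (u - r) + of_real pi" "u + of_real pi + x - a - b = (u + x - a - b) + of_real pi" for r
      by simp_all
    have "N (u + of_real pi) = N u" "g (u + of_real pi) = g u"
      unfolding N_def g_def s1 theta_add_pi[OF tau] deriv_theta_add_pi by simp_all
    then show "N (u + of_real pi) / g (u + of_real pi) = N u / g u" by simp
    have s2: "u + of_real pi * \<tau> - r = (u - r) + of_real pi * \<tau>" "u + of_real pi * \<tau> + x - a - b = (u + x - a - b) + of_real pi * \<tau>" for r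
      by simp_all
    define M where "M = (\<lambda>z. - exp (- (\<i> * of_real pi * \<tau>) - 2 * \<i> * z))"
    have M: "M (u - x) * M (u + x - a - b) = M (u - a) * M (u - b)" "M (u - a) \<noteq> 0" "M (u - b) \<noteq> 0"
      unfolding M_def by (simp_all add: exp_add[symmetric] algebra_simps)
    have "N (u + of_real pi * \<tau>) = (M (u - x) * M (u + x - a - b)) * (k * theta \<tau> (u - x) * theta \<tau> (u + x - a - b))
      + M (u - a) * M (u - b) * (- deriv (theta \<tau>) (u - a) * theta \<tau> (u - b) + theta \<tau> (u - a) * deriv (theta \<tau>) (u - b))"
      unfolding N_def s2 theta_add_tau[OF tau] deriv_theta_add_tau M_def[symmetric] M_def[THEN fun_cong, symmetric]
      by (simp add: algebra_simps)
    then have "N (u + of_real pi * \<tau>) = (M (u - a) * M (u - b)) * N u"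
      unfolding M N_def by (simp add: algebra_simps)
    moreover have "g (u + of_real pi * \<tau>) = (M (u - a) * M (u - b)) * g u"
      unfolding g_def s2 theta_add_tau[OF tau] M_def[THEN fun_cong, symmetric] by (simp add: algebra_simps)
    ultimately show "N (u + of_real pi * \<tau>) / g (u + of_real pi * \<tau>) = N u / g u" using M by simp
  next
    fix u assume "g u = 0"
    then have "torus_eq \<tau> (u - a) 0 \<or> torus_eq \<tau> (u - b) 0" unfolding g_def by (simp add: theta_eq_0_iff)
    then have "torus_eq \<tau> u a \<or> torus_eq \<tau> u b" by (simp add: torus_eq_def)
    then have "torus_eq \<tau> a u \<or> torus_eq \<tau> b u" using torus_eq_sym by blast
    moreover have dg: "(g has_field_derivative deriv (theta \<tau>) (u - a) * theta \<tau> (u - b) + theta \<tau> (u - a) * deriv (theta \<tau>) (u - b)) (at u)" for u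
      unfolding g_def by (rule derivative_eq_intros DERIV_chain2[OF theta_deriv] refl | simp)+
    have "N a = 0" unfolding N_def k_def using assms flip[of a x] flip[of b a] by (simp add: theta_0[OF tau])
    moreover have "N b = 0" unfolding N_def k_def using assms flip[of b x] by (simp add: theta_0[OF tau])
    moreover have "g a = 0" "g b = 0" by (simp_all add: g_def theta_0[OF tau])
    moreover have "deriv g a \<noteq> 0" "deriv g b \<noteq> 0"
      using DERIV_imp_deriv[OF dg] assms(1) deriv_theta_0_nonzero flip[of b a] by (simp_all add: theta_0[OF tau])
    ultimately show "\<exists>w. torus_eq \<tau> w u \<and> N w = 0 \<and> g w = 0 \<and> deriv g w \<noteq> 0" by blast
  qed
  then obtain c where c: "\<And>u. N u = c * g u" by blast
  have "c = dlog_theta \<tau> (x - b) - dlog_theta \<tau> (x - a)"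
    using c[of x] assms unfolding N_def g_def dlog_theta_def by (simp add: theta_0[OF tau] field_simps)
  then have "N u / g u = dlog_theta \<tau> (x - b) - dlog_theta \<tau> (x - a)"
    using c[of u] assms by (simp add: g_def)
  moreover have "N u / g u = theta \<tau> (b - a) * deriv (theta \<tau>) 0 * theta \<tau> (u - x) * theta \<tau> (u + x - a - b) /
      (theta \<tau> (u - a) * theta \<tau> (u - b) * theta \<tau> (x - b) * theta \<tau> (x - a)) - dlog_theta \<tau> (u - a) + dlog_theta \<tau> (u - b)"
    unfolding N_def g_def k_def dlog_theta_def using assms by (simp add: field_simps)
  ultimately show ?thesis by (simp add: algebra_simps)
qed

end

section \<open>A primitive on the slit torus\<close>

text \<open>
  The preimage in \<open>\<real>\<close> of the arc from \<open>a\<close> to \<open>b\<close>.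
\<close>

definition sector :: "real \<Rightarrow> real \<Rightarrow> real set" where
  "sector a b = {x. \<exists>k::int. a \<le> x + of_int k * pi \<and> x + of_int k * pi \<le> b}"

text \<open>
  The plane without the translates of the segment \<open>[a, b]\<close> by the lattice.
\<close>

definition slit_domain :: "complex \<Rightarrow> real \<Rightarrow> real \<Rightarrow> complex set" where
  "slit_domain \<tau> a b = {u. \<forall>s\<in>{a..b}. theta \<tau> (u - of_real s) \<noteq> 0}"

text \<open>
  Up to an additive constant, a single-valued branch of \<open>log (\<theta>(u - a)/\<theta>(u - b))\<close> on the slit domain,
  although the latter is not simply connected.
\<close>

definition dlog_theta_integral :: "complex \<Rightarrow> real \<Rightarrow> real \<Rightarrow> complex \<Rightarrow> complex" where
  "dlog_theta_integral \<tau> a b u = integral {a..b} (\<lambda>s. dlog_theta \<tau> (u - of_real s))"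

text \<open>
  A contour that is injective modulo the lattice visits finitely many classes at finitely many
  times only. So an integrand may be changed on these classes, in particular at the zeros and poles
  of the factors by which \<open>g\<close> is defined.
\<close>

lemma has_contour_integral_spike_torus:
  assumes I: "(f has_contour_integral I) C" and fin: "finite P"
    and inj: "\<And>x y. x \<in> {0..<1} \<Longrightarrow> y \<in> {0..<1} \<Longrightarrow> torus_eq \<tau> (C x) (C y) \<Longrightarrow> x = y"
    and eq: "\<And>u. (\<And>p. p \<in> P \<Longrightarrow> \<not> torus_eq \<tau> u p) \<Longrightarrow> g u = f u"
  shows "(g has_contour_integral I) C"
proof -
  have "finite {x \<in> {0..<1}. torus_eq \<tau> (C x) p}" for p
  proof (cases "\<exists>y \<in> {0..<1}. torus_eq \<tau> (C y) p")
    case True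
    then obtain y where y: "y \<in> {0..<1}" "torus_eq \<tau> (C y) p" by blast
    have "{x \<in> {0..<1}. torus_eq \<tau> (C x) p} \<subseteq> {y}"
      using inj y torus_eq_trans torus_eq_sym by blast
    then show ?thesis by (rule finite_subset) simp
  next
    case False
    then have "{x \<in> {0..<1}. torus_eq \<tau> (C x) p} = {}" by blast
    then show ?thesis by (simp only: finite.emptyI)
  qed
  then have f: "finite (insert 1 (\<Union>p\<in>P. {x \<in> {0..<1}. torus_eq \<tau> (C x) p}))" using fin by simp
  show ?thesis unfolding has_contour_integral_def
  proof (rule has_integral_spike_finite[OF f])
    show "((\<lambda>x. f (C x) * vector_derivative C (at x within {0..1})) has_integral I) {0..1}"
      using I by (simp add: has_contour_integral_def)
    fix x assume x: "x \<in> {0..1} - insert 1 (\<Union>p\<in>P. {x \<in> {0..<1}. torus_eq \<tau> (C x) p})"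
    then have "\<not> torus_eq \<tau> (C x) p" if "p \<in> P" for p using that by auto
    then show "g (C x) * vector_derivative C (at x within {0..1}) = f (C x) * vector_derivative C (at x within {0..1})"
      using eq[of "C x"] by simp
  qed
qed

context
  fixes \<tau> :: complex
  assumes tau: "Im \<tau> > 0"
begin

lemma open_theta_nonzero: "open {z. theta \<tau> z \<noteq> 0}"
  using theta_holomorphic[OF tau, of UNIV] holomorphic_on_imp_continuous_on
  by (intro open_Collect_neq) (auto simp: continuous_on_const)

lemma dlog_theta_holomorphic: "dlog_theta \<tau> holomorphic_on {z. theta \<tau> z \<noteq> 0}"
  unfolding dlog_theta_def
  by (intro holomorphic_intros theta_holomorphic[OF tau] holomorphic_deriv[OF theta_holomorphic[OF tau] open_theta_nonzero]) auto

lemma dlog_theta_deriv: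
  "theta \<tau> z \<noteq> 0 \<Longrightarrow> (dlog_theta \<tau> has_field_derivative deriv (dlog_theta \<tau>) z) (at z)"
  using holomorphic_derivI[OF dlog_theta_holomorphic open_theta_nonzero, of z] by simp

lemma open_slit_domain: "open (slit_domain \<tau> a b)"
proof -
  have "closed (\<Union>x\<in>{z. theta \<tau> z = 0}. \<Union>y\<in>complex_of_real ` {a..b}. {x + y})"
  proof (rule closed_compact_sums)
    have "{z. theta \<tau> z = 0} = - {z. theta \<tau> z \<noteq> 0}" by auto
    then show "closed {z. theta \<tau> z = 0}" using open_theta_nonzero by (simp add: closed_open)
    show "compact (complex_of_real ` {a..b})" by (intro compact_continuous_image continuous_intros compact_Icc)
  qed
  moreover have "slit_domain \<tau> a b = - (\<Union>x\<in>{z. theta \<tau> z = 0}. \<Union>y\<in>complex_of_real ` {a..b}. {x + y})"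
  proof -
    have "(\<exists>s\<in>{a..b}. theta \<tau> (u - of_real s) = 0) \<longleftrightarrow> (\<exists>x\<in>{z. theta \<tau> z = 0}. \<exists>y\<in>complex_of_real ` {a..b}. u = x + y)" for u
    proof
      assume "\<exists>s\<in>{a..b}. theta \<tau> (u - of_real s) = 0"
      then obtain s where "s \<in> {a..b}" "theta \<tau> (u - of_real s) = 0" by blast
      then show "\<exists>x\<in>{z. theta \<tau> z = 0}. \<exists>y\<in>complex_of_real ` {a..b}. u = x + y"
        by (intro bexI[of _ "u - of_real s"] bexI[of _ "of_real s"]) auto
    next
      assume "\<exists>x\<in>{z. theta \<tau> z = 0}. \<exists>y\<in>complex_of_real ` {a..b}. u = x + y"
      then obtain x s where "s \<in> {a..b}" "theta \<tau> x = 0" "u = x + of_real s" by auto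
      then show "\<exists>s\<in>{a..b}. theta \<tau> (u - of_real s) = 0" by (intro bexI[of _ s]) auto
    qed
    then show ?thesis unfolding slit_domain_def by auto
  qed
  ultimately show ?thesis by (simp only: open_Compl)
qed

lemma continuous_on_dlog_theta_shift:
  assumes "u \<in> slit_domain \<tau> a b" shows "continuous_on {a..b} (\<lambda>s. dlog_theta \<tau> (u - of_real s))"
  by (rule continuous_on_compose2[OF holomorphic_on_imp_continuous_on[OF dlog_theta_holomorphic]])
     (use assms in \<open>auto simp: slit_domain_def intro!: continuous_intros\<close>)

lemma dlog_theta_integral_deriv:
  assumes u: "u \<in> slit_domain \<tau> a b" and ab: "a \<le> b"
  shows "(dlog_theta_integral \<tau> a b has_field_derivative
     dlog_theta \<tau> (u - of_real a) - dlog_theta \<tau> (u - of_real b)) (at u)"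
proof -
  obtain r where r: "r > 0" "ball u r \<subseteq> slit_domain \<tau> a b" using open_slit_domain u openE by blast
  have nz: "theta \<tau> (x - of_real s) \<noteq> 0" if "x \<in> ball u r" "s \<in> {a..b}" for x s
    using that r(2) by (auto simp: slit_domain_def)
  have "((\<lambda>x. integral (cbox a b) (\<lambda>s. dlog_theta \<tau> (x - of_real s))) has_field_derivative
      integral (cbox a b) (\<lambda>s. deriv (dlog_theta \<tau>) (u - of_real s))) (at u within ball u r)"
  proof (rule leibniz_rule_field_derivative)
    fix x s assume x: "x \<in> ball u r" and s: "s \<in> cbox a b"
    then have "((\<lambda>x. dlog_theta \<tau> (x - of_real s)) has_field_derivative deriv (dlog_theta \<tau>) (x - of_real s) * 1) (at x)"
      using nz[of x s] by (intro DERIV_chain2[OF dlog_theta_deriv]) (auto intro!: derivative_eq_intros)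
    then show "((\<lambda>x. dlog_theta \<tau> (x - of_real s)) has_field_derivative deriv (dlog_theta \<tau>) (x - of_real s)) (at x within ball u r)"
      using has_field_derivative_at_within by fastforce
  next
    fix x assume "x \<in> ball u r"
    then have "x \<in> slit_domain \<tau> a b" using r by blast
    then show "(\<lambda>s. dlog_theta \<tau> (x - of_real s)) integrable_on cbox a b"
      using integrable_continuous_real[OF continuous_on_dlog_theta_shift] by simp
  next
    have "continuous_on {z. theta \<tau> z \<noteq> 0} (deriv (dlog_theta \<tau>))"
      by (intro holomorphic_on_imp_continuous_on holomorphic_deriv dlog_theta_holomorphic open_theta_nonzero)
    then show "continuous_on (ball u r \<times> cbox a b) (\<lambda>(x, s). deriv (dlog_theta \<tau>) (x - of_real s))"
      unfolding case_prod_unfold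
      by (rule continuous_on_compose2) (use nz in \<open>force intro!: continuous_intros\<close>)+
  qed (use r in auto)
  moreover have "((\<lambda>s. deriv (dlog_theta \<tau>) (u - of_real s)) has_integral
      - dlog_theta \<tau> (u - of_real b) - (- dlog_theta \<tau> (u - of_real a))) {a..b}"
  proof (rule fundamental_theorem_of_calculus[OF ab])
    fix s assume s: "s \<in> {a..b}"
    have "((\<lambda>z. - dlog_theta \<tau> (u - z)) has_field_derivative deriv (dlog_theta \<tau>) (u - of_real s)) (at (of_real s))"
    proof -
      have "((\<lambda>z. u - z) has_field_derivative - 1) (at (of_real s))" by (rule derivative_eq_intros refl | simp)+
      from DERIV_minus[OF DERIV_chain2[OF dlog_theta_deriv this]] show ?thesis using nz[of u s] s r by simp
    qed
    then show "((\<lambda>s. - dlog_theta \<tau> (u - of_real s)) has_vector_derivative deriv (dlog_theta \<tau>) (u - of_real s)) (at s within {a..b})"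
      by (rule has_vector_derivative_at_within[OF has_vector_derivative_real_field])
  qed
  then have "integral {a..b} (\<lambda>s. deriv (dlog_theta \<tau>) (u - of_real s)) = dlog_theta \<tau> (u - of_real a) - dlog_theta \<tau> (u - of_real b)"
    by (simp add: integral_unique)
  ultimately show ?thesis
    using at_within_open[of u "ball u r"] r(1) by (simp add: dlog_theta_integral_def[abs_def])
qed

lemma dlog_theta_integral_add_tau:
  assumes u: "u \<in> slit_domain \<tau> a b" and ab: "a \<le> b"
  shows "dlog_theta_integral \<tau> a b (u + of_real pi * \<tau>) = dlog_theta_integral \<tau> a b u - 2 * \<i> * of_real (b - a)"
proof -
  have "dlog_theta_integral \<tau> a b (u + of_real pi * \<tau>) = integral {a..b} (\<lambda>s. dlog_theta \<tau> (u - of_real s) - 2 * \<i>)"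
    unfolding dlog_theta_integral_def
  proof (rule integral_cong)
    fix s assume "s \<in> {a..b}"
    then have "theta \<tau> (u - of_real s) \<noteq> 0" using u by (auto simp: slit_domain_def)
    then show "dlog_theta \<tau> (u + of_real pi * \<tau> - of_real s) = dlog_theta \<tau> (u - of_real s) - 2 * \<i>"
      using dlog_theta_add_tau[OF tau, of "u - of_real s"] by (simp add: algebra_simps)
  qed
  also have "\<dots> = dlog_theta_integral \<tau> a b u - integral {a..b} (\<lambda>s. 2 * \<i>)"
    unfolding dlog_theta_integral_def
    by (rule integral_diff[OF integrable_continuous_real[OF continuous_on_dlog_theta_shift[OF u]]])
       (intro integrable_continuous_real continuous_on_const)
  also have "integral {a..b} (\<lambda>s. 2 * \<i>) = 2 * \<i> * of_real (b - a)"
    using ab by (simp add: scaleR_conv_of_real mult.commute)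
  finally show ?thesis .
qed

lemma has_contour_integral_dlog_theta:
  assumes "valid_path C" "path_image C \<subseteq> slit_domain \<tau> a b" "a \<le> b"
  shows "((\<lambda>u. dlog_theta \<tau> (u - of_real a) - dlog_theta \<tau> (u - of_real b) + c) has_contour_integral
    dlog_theta_integral \<tau> a b (pathfinish C) - dlog_theta_integral \<tau> a b (pathstart C) + c * (pathfinish C - pathstart C)) C"
proof -
  have "((\<lambda>u. dlog_theta_integral \<tau> a b u + c * u) has_field_derivative
    dlog_theta \<tau> (x - of_real a) - dlog_theta \<tau> (x - of_real b) + c) (at x within slit_domain \<tau> a b)"
    if "x \<in> slit_domain \<tau> a b" for x
    by (rule derivative_eq_intros has_field_derivative_at_within[OF dlog_theta_integral_deriv[OF that assms(3)]] refl | simp)+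
  from contour_integral_primitive[OF this assms(1,2)] show ?thesis by (simp add: algebra_simps)
qed

lemma path_image_subset_slit_domain:
  assumes re: "Re \<tau> = 0" and avoid: "\<And>x. x \<in> {0..1} \<Longrightarrow> on_C0 \<tau> (C x) \<Longrightarrow> Re (C x) \<notin> sector a b"
  shows "path_image C \<subseteq> slit_domain \<tau> a b"
proof
  fix u assume "u \<in> path_image C"
  then obtain x where x: "x \<in> {0..1}" "u = C x" by (auto simp: path_image_def)
  show "u \<in> slit_domain \<tau> a b"
  proof (rule ccontr)
    assume "u \<notin> slit_domain \<tau> a b"
    then obtain s where s: "s \<in> {a..b}" "torus_eq \<tau> (u - of_real s) 0"
      unfolding slit_domain_def by (auto simp: theta_eq_0_iff[OF tau])
    then obtain m n :: int where "u - of_real s - 0 = of_int m * of_real pi + of_int n * of_real pi * \<tau>"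
      unfolding torus_eq_def by blast
    then have u: "u = of_real s + of_int m * of_real pi + of_int n * of_real pi * \<tau>" by (simp add: algebra_simps)
    then have "on_C0 \<tau> u" "Re u + of_int (- m) * pi = s" using re by (simp_all add: on_C0_def)
    moreover from this(2) have "Re u \<in> sector a b" unfolding sector_def using s(1) by (auto intro!: exI[of _ "- m"])
    ultimately show False using avoid x by blast
  qed
qed

text \<open>
  The quotient has a holomorphic logarithm on a strip around the real axis. Its derivative is
  \<open>L(u - u0) - L(u - cnj u0)\<close>, which equals \<open>L(cnj u0 - u) - L(u0 - u)\<close> because \<open>L\<close> is odd.
\<close>

lemma log_variation_theta_quotient:
  assumes u0: "0 < Im u0" "Im u0 < pi * Im \<tau>" and re: "Re \<tau> = 0" and ab: "a \<le> b"
  shows "log_variation (\<lambda>u. theta \<tau> (of_real u - u0) / theta \<tau> (of_real u - cnj u0)) a b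
    (dlog_theta_integral \<tau> a b (cnj u0) - dlog_theta_integral \<tau> a b u0)"
proof -
  let ?S = "{z. \<bar>Im z\<bar> < min (Im u0) (pi * Im \<tau> - Im u0)}"
  let ?F = "\<lambda>z. theta \<tau> (z - u0) / theta \<tau> (z - cnj u0)"
  have S: "?S = {z. Im z < min (Im u0) (pi * Im \<tau> - Im u0)} \<inter> {z. Im z > - min (Im u0) (pi * Im \<tau> - Im u0)}" by auto
  have oS: "open ?S" unfolding S by (intro open_Int open_halfspace_Im_lt open_halfspace_Im_gt)
  have cS: "convex ?S" unfolding S by (intro convex_Int convex_halfspace_Im_lt convex_halfspace_Im_gt)
  have nz: "theta \<tau> w \<noteq> 0" if "0 < \<bar>Im w\<bar>" "\<bar>Im w\<bar> < pi * Im \<tau>" for w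
  proof
    assume "theta \<tau> w = 0"
    then obtain m n :: int where "w - 0 = of_int m * of_real pi + of_int n * of_real pi * \<tau>"
      unfolding theta_eq_0_iff[OF tau] torus_eq_def by blast
    then have w: "Im w = of_int n * (pi * Im \<tau>)" by simp
    then have "\<bar>real_of_int n\<bar> * (pi * Im \<tau>) < 1 * (pi * Im \<tau>)" using that(2) tau by (simp add: abs_mult)
    then have "\<bar>real_of_int n\<bar> < 1" using tau by (simp only: mult_less_cancel_right) (auto simp: mult_less_0_iff)
    then have "n = 0" by linarith
    then show False using w that by simp
  qed
  have nzS: "theta \<tau> (z - u0) \<noteq> 0" "theta \<tau> (z - cnj u0) \<noteq> 0" if "z \<in> ?S" for z
    using that u0 nz[of "z - u0"] nz[of "z - cnj u0"] by (auto simp: abs_if split: if_splits)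
  have th: "(\<lambda>u. theta \<tau> (h u)) holomorphic_on A" if "h holomorphic_on A" for h A
    using holomorphic_on_compose_gen[OF that theta_holomorphic[OF tau, of UNIV]] by (simp add: o_def)
  have "?F holomorphic_on ?S" by (intro holomorphic_intros th) (use nzS in auto)
  then obtain g where g: "g holomorphic_on ?S" "\<And>z. z \<in> ?S \<Longrightarrow> ?F z = exp (g z)"
    using contractible_imp_holomorphic_log[OF _ convex_imp_contractible[OF cS]] nzS by (metis (no_types, lifting) divide_eq_0_iff)
  have dg: "(g has_field_derivative dlog_theta \<tau> (z - u0) - dlog_theta \<tau> (z - cnj u0)) (at z)" if z: "z \<in> ?S" for z
  proof -
    have d: "(g has_field_derivative deriv g z) (at z)" using holomorphic_derivI[OF g(1) oS z] .
    then have d': "((\<lambda>z. exp (g z)) has_field_derivative exp (g z) * deriv g z) (at z)" by (rule DERIV_fun_exp)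
    have 1: "(?F has_field_derivative ?F z * deriv g z) (at z)"
    proof (rule has_field_derivative_transform_within_open[OF _ oS z])
      show "((\<lambda>z. exp (g z)) has_field_derivative ?F z * deriv g z) (at z)"
        using d' unfolding g(2)[OF z] .
    qed (simp only: g(2))
    have "((\<lambda>z. theta \<tau> (z - r)) has_field_derivative deriv (theta \<tau>) (z - r) * 1) (at z)" for r
      by (rule DERIV_chain2[OF theta_deriv[OF tau]]) (rule derivative_eq_intros refl | simp)+
    then have "(?F has_field_derivative (deriv (theta \<tau>) (z - u0) * theta \<tau> (z - cnj u0) - theta \<tau> (z - u0) * deriv (theta \<tau>) (z - cnj u0)) / (theta \<tau> (z - cnj u0) * theta \<tau> (z - cnj u0))) (at z)"
      using nzS[OF z] by (intro DERIV_divide) auto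
    from DERIV_unique[OF 1 this] have "deriv g z = dlog_theta \<tau> (z - u0) - dlog_theta \<tau> (z - cnj u0)"
      using nzS[OF z] unfolding dlog_theta_def by (simp add: field_simps)
    then show ?thesis using d by simp
  qed
  have real: "of_real x \<in> ?S" for x using u0 by auto
  have slit: "u0 \<in> slit_domain \<tau> a b" "cnj u0 \<in> slit_domain \<tau> a b"
  proof -
    have "theta \<tau> (u0 - of_real s) \<noteq> 0" "theta \<tau> (cnj u0 - of_real s) \<noteq> 0" for s
      using u0 nz[of "u0 - of_real s"] nz[of "cnj u0 - of_real s"] by auto
    then show "u0 \<in> slit_domain \<tau> a b" "cnj u0 \<in> slit_domain \<tau> a b" by (simp_all add: slit_domain_def)
  qed
  have "((\<lambda>x. dlog_theta \<tau> (of_real x - u0) - dlog_theta \<tau> (of_real x - cnj u0)) has_integral g (of_real b) - g (of_real a)) {a..b}"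
    by (rule fundamental_theorem_of_calculus[OF ab has_vector_derivative_at_within[OF has_vector_derivative_real_field[OF dg[OF real]]]])
  moreover have "((\<lambda>x. - dlog_theta \<tau> (u0 - of_real x) - - dlog_theta \<tau> (cnj u0 - of_real x)) has_integral
      - dlog_theta_integral \<tau> a b u0 - - dlog_theta_integral \<tau> a b (cnj u0)) {a..b}"
    unfolding dlog_theta_integral_def
    by (intro has_integral_diff has_integral_neg integrable_integral integrable_continuous_real continuous_on_dlog_theta_shift slit)
  moreover have "- dlog_theta \<tau> (u0 - of_real x) - - dlog_theta \<tau> (cnj u0 - of_real x) = dlog_theta \<tau> (of_real x - u0) - dlog_theta \<tau> (of_real x - cnj u0)" for x
    using dlog_theta_minus[OF tau, of "u0 - of_real x"] dlog_theta_minus[OF tau, of "cnj u0 - of_real x"] by simp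
  ultimately have "g (of_real b) - g (of_real a) = - dlog_theta_integral \<tau> a b u0 - - dlog_theta_integral \<tau> a b (cnj u0)"
    by (simp only:) (rule has_integral_unique)
  moreover have "continuous_on {a..b} (\<lambda>x. g (of_real x))"
    by (rule continuous_on_compose2[OF holomorphic_on_imp_continuous_on[OF g(1)]]) (use real in \<open>auto intro!: continuous_intros\<close>)
  ultimately show ?thesis unfolding log_variation_def using g(2)[OF real]
    by (intro exI[of _ "\<lambda>x. g (of_real x)"]) auto
qed

end

section \<open>Existence of the contours\<close>

lemma not_in_sector:
  assumes "b < x" "x < a + pi" shows "x \<notin> sector a b"
proof
  assume "x \<in> sector a b"
  then obtain k :: int where k: "a \<le> x + of_int k * pi" "x + of_int k * pi \<le> b" by (auto simp: sector_def)
  show False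
  proof (cases "k \<ge> 0")
    case True
    then have "0 \<le> of_int k * pi" by simp
    then show False using k assms by linarith
  next
    case False
    then have "of_int k * pi \<le> (- 1) * pi" by (intro mult_right_mono) auto
    then show False using k assms by linarith
  qed
qed

lemma sector_shift: "x + of_int k * pi \<in> sector a b \<longleftrightarrow> x \<in> sector a b"
proof -
  have "x + of_int k * pi \<in> sector a b" if x: "x \<in> sector a b" for x and k :: int
  proof -
    obtain j :: int where "a \<le> x + of_int j * pi" "x + of_int j * pi \<le> b" using x unfolding sector_def by blast
    moreover have "x + of_int j * pi = x + of_int k * pi + of_int (j - k) * pi" by (simp add: algebra_simps)
    ultimately show ?thesis unfolding sector_def by (intro CollectI exI[of _ "j - k"]) simp
  qed
  from this[of x k] this[of "x + of_int k * pi" "- k"] show ?thesis by auto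
qed

lemma int_mult_bounded_eq_0:
  fixes n :: int and h :: real
  assumes "\<bar>of_int n * h\<bar> < h" shows "n = 0"
proof (rule ccontr)
  assume "n \<noteq> 0"
  then have "1 \<le> \<bar>real_of_int n\<bar>" by linarith
  moreover have "h > 0" using assms by linarith
  ultimately have "1 * h \<le> \<bar>real_of_int n\<bar> * h" by (intro mult_right_mono) auto
  then show False using assms \<open>h > 0\<close> by (simp add: abs_mult)
qed

context
  fixes \<tau> :: complex
  assumes tau: "Im \<tau> > 0" and re: "Re \<tau> = 0"
begin

lemma torus_eq_narrow:
  assumes "torus_eq \<tau> z w" "\<bar>Im z - Im w\<bar> < pi * Im \<tau>"
  shows "Im z = Im w" "\<exists>m::int. Re z - Re w = of_int m * pi"
proof -
  obtain m n :: int where mn: "z - w = of_int m * of_real pi + of_int n * of_real pi * \<tau>"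
    using assms(1) by (auto simp: torus_eq_def)
  have "Im (z - w) = of_int n * (pi * Im \<tau>)" unfolding mn by simp
  then have n: "Im z - Im w = of_int n * (pi * Im \<tau>)" by simp
  then have "n = 0" using assms(2) int_mult_bounded_eq_0[of n "pi * Im \<tau>"] by simp
  then show "Im z = Im w" using n by simp
  have "Re (z - w) = of_int m * pi" unfolding mn using re by simp
  then show "\<exists>m::int. Re z - Re w = of_int m * pi" by auto
qed

lemma on_C0_narrow: "\<bar>Im z\<bar> < pi * Im \<tau> \<Longrightarrow> on_C0 \<tau> z \<longleftrightarrow> Im z = 0"
  unfolding on_C0_def using int_mult_bounded_eq_0[of _ "pi * Im \<tau>"]
  by (metis mult.assoc mult_zero_left of_int_0)

lemma gas_contour_exists:
  assumes "x \<notin> S" shows "\<exists>C. gas_contour \<tau> S C"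
proof
  let ?C = "linepath (complex_of_real x) (of_real x + of_real pi * \<tau>)"
  have C: "?C t = of_real x + of_real t * of_real pi * \<tau>" for t
    by (simp add: linepath_def scaleR_conv_of_real algebra_simps)
  show "gas_contour \<tau> S ?C"
    unfolding gas_contour_def
  proof (intro conjI ballI impI)
    fix s t :: real assume st: "s \<in> {0..<1}" "t \<in> {0..<1}" "torus_eq \<tau> (?C s) (?C t)"
    then obtain m n :: int where "?C s - ?C t = of_int m * of_real pi + of_int n * of_real pi * \<tau>" by (auto simp: torus_eq_def)
    then have "Im (?C s - ?C t) = of_int n * pi * Im \<tau>" by simp
    then have "(s - t) * (pi * Im \<tau>) = of_int n * (pi * Im \<tau>)" unfolding C by (simp add: algebra_simps)
    then have "s - t = of_int n" using tau by simp
    moreover from this have "\<bar>of_int n * (1::real)\<bar> < 1" using st by auto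
    then have "n = 0" by (rule int_mult_bounded_eq_0)
    ultimately show "s = t" by simp
  next
    fix t :: real show "Re (?C t) \<notin> S" unfolding C using assms re by simp
  qed simp_all
qed

text \<open>
  Two segments suffice. The imaginary part is then an affine function of time, which settles
  injectivity and the crossings.
\<close>

lemma liquid_contour_exists:
  assumes u0: "0 < Im u0" "Im u0 < pi / 2 * Im \<tau>" and x: "x \<notin> S"
  shows "\<exists>C. liquid_contour \<tau> S u0 C"
proof
  let ?C = "linepath (cnj u0) (complex_of_real x) +++ linepath (of_real x) u0"
  have Im: "Im (?C t) = (2 * t - 1) * Im u0" for t
    by (auto simp: joinpaths_def linepath_def algebra_simps)
  have half: "?C (1/2) = of_real x" by (simp add: joinpaths_def linepath_def)
  have bd: "\<bar>Im (?C t)\<bar> \<le> Im u0" if "t \<in> {0..1}" for t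
  proof -
    have "\<bar>2 * t - 1\<bar> \<le> 1" using that by auto
    then have "\<bar>2 * t - 1\<bar> * Im u0 \<le> 1 * Im u0" using u0 by (intro mult_right_mono) auto
    then show ?thesis unfolding Im using u0 by (simp add: abs_mult)
  qed
  have C0: "on_C0 \<tau> (?C t) \<longleftrightarrow> t = 1/2" if "t \<in> {0..1}" for t
    using on_C0_narrow[of "?C t"] bd[OF that] u0 unfolding Im by auto
  show "liquid_contour \<tau> S u0 ?C"
    unfolding liquid_contour_def
  proof (intro conjI ballI impI)
    show "valid_path ?C" by (intro valid_path_join) auto
    fix s t :: real assume st: "s \<in> {0..1}" "t \<in> {0..1}" "torus_eq \<tau> (?C s) (?C t)"
    have "Im (?C s) = Im (?C t)"
      using torus_eq_narrow(1)[OF st(3)] bd[OF st(1)] bd[OF st(2)] u0 by linarith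
    then show "s = t" unfolding Im using u0 by simp
  next
    show "\<exists>!t. t \<in> {0..1} \<and> on_C0 \<tau> (?C t)" using C0 by (intro ex1I[of _ "1/2"]) auto
  next
    fix t :: real assume t: "t \<in> {0..1}"
    show "\<not> on_C1 \<tau> (?C t)"
    proof
      assume "on_C1 \<tau> (?C t)"
      then obtain k :: int where k: "Im (?C t) = (of_int k + 1/2) * pi * Im \<tau>" by (auto simp: on_C1_def)
      have "\<bar>of_int k + 1/2 :: real\<bar> \<ge> 1/2" by (cases "k \<ge> 0") (auto simp: abs_if)
      then have "1/2 * (pi * Im \<tau>) \<le> \<bar>of_int k + 1/2\<bar> * (pi * Im \<tau>)" using tau by (intro mult_right_mono) auto
      then have "1/2 * (pi * Im \<tau>) \<le> \<bar>Im (?C t)\<bar>" unfolding k using tau by (simp add: abs_mult)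
      then show False using bd[OF t] u0 by simp
    qed
    assume "on_C0 \<tau> (?C t)"
    then have "t = 1/2" using C0[OF t] by blast
    then show "Re (?C t) \<notin> S" by (simp only: half Re_complex_of_real) (rule x)
  qed simp_all
qed

lemma rectpath_formula:
  "rectpath p q t =
    (if t \<le> 1/2 then linepath p (Complex (Re q) (Im p)) (2 * t)
     else if t \<le> 3/4 then linepath (Complex (Re q) (Im p)) q (4 * t - 2)
     else if t \<le> 7/8 then linepath q (Complex (Re p) (Im q)) (8 * t - 6)
     else linepath (Complex (Re p) (Im q)) p (8 * t - 7))"
  by (auto simp: rectpath_def Let_def joinpaths_def algebra_simps)

lemma inside_rectpath_subset:
  assumes "Re p < Re q" "Im p < Im q" shows "inside (path_image (rectpath p q)) \<subseteq> box p q"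
proof
  fix z assume z: "z \<in> inside (path_image (rectpath p q))"
  show "z \<in> box p q"
  proof (rule ccontr)
    assume n: "z \<notin> box p q"
    have "path_image (rectpath p q) = cbox p q - box p q"
      using path_image_rectpath_cbox_minus_box assms by simp
    moreover have "z \<notin> path_image (rectpath p q)" using z inside_no_overlap by blast
    ultimately have "z \<notin> cbox p q" using n by blast
    moreover have "path_image (rectpath p q) \<subseteq> cbox p q" by (simp add: \<open>path_image (rectpath p q) = cbox p q - box p q\<close>)
    ultimately have "z \<in> outside (path_image (rectpath p q))" using outside_subset_convex[OF convex_box(1)] by blast
    then show False using z inside_Int_outside by blast
  qed
qed

text \<open>
  A flat rectangle does, with left side through \<open>Re u0\<close>, where it runs downwards, and right side
  through a point outside the sector. It must be narrower than \<open>\<pi>\<close> to remain injective on the torus.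
\<close>

lemma solid_contour_exists:
  assumes ab: "a < b" "b < a + pi" and S: "S = sector a b" and u0: "Re u0 \<notin> angle_points G \<alpha>"
  shows "\<exists>C. solid_contour G \<alpha> \<tau> S u0 C"
proof -
  define Y where "Y = Re u0"
  obtain X where X: "Y < X" "X < Y + pi" "X \<notin> S"
  proof -
    \<comment> \<open>two candidates off the sector: they differ by less than \<open>\<pi>\<close>, so at most one is a translate of \<open>Y\<close>\<close>
    define x1 where "x1 = (a + pi + b) / 2"
    define x2 where "x2 = (a + pi + 3 * b) / 4"
    have x12: "b < x1" "x1 < a + pi" "b < x2" "x2 < a + pi" using ab by (simp_all add: x1_def x2_def field_simps)
    have "\<exists>x. b < x \<and> x < a + pi \<and> (\<forall>k::int. x \<noteq> Y + of_int k * pi)"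
    proof (rule ccontr)
      assume "\<not> ?thesis"
      then obtain k l :: int where kl: "x1 = Y + of_int k * pi" "x2 = Y + of_int l * pi" using x12 by metis
      have "x1 - x2 = (a + pi - b) / 4" by (simp add: x1_def x2_def field_simps)
      then have d: "0 < x1 - x2" "x1 - x2 < pi" using ab by simp_all
      have "x1 - x2 = of_int (k - l) * pi" unfolding kl by (simp add: algebra_simps)
      then have "k - l = 0" using d int_mult_bounded_eq_0[of "k - l" pi] by simp
      then show False using d \<open>x1 - x2 = of_int (k - l) * pi\<close> by simp
    qed
    then obtain x where x: "b < x" "x < a + pi" "\<And>k::int. x \<noteq> Y + of_int k * pi" by blast
    define k where "k = \<lfloor>(x - Y) / pi\<rfloor>"
    have "of_int k * pi \<le> x - Y" "x - Y < (of_int k + 1) * pi"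
      unfolding k_def using floor_divide_lower[of pi "x - Y"] floor_divide_upper[of pi "x - Y"] by simp_all
    moreover have "x - Y \<noteq> of_int k * pi" using x(3)[of k] by simp
    ultimately have "Y < x + of_int (- k) * pi" "x + of_int (- k) * pi < Y + pi" by (simp_all add: algebra_simps)
    moreover have "x + of_int (- k) * pi \<notin> S" unfolding S sector_shift by (rule not_in_sector[OF x(1,2)])
    ultimately show ?thesis using that by blast
  qed
  \<comment> \<open>the total height \<open>2 h\<close> must stay below the vertical period\<close>
  define h where "h = pi * Im \<tau> / 3"
  have h: "h > 0" using tau by (simp add: h_def)
  define p where "p = Complex Y (- h)"
  define q where "q = Complex X h"
  let ?C = "rectpath p q"
  have pq: "Re p < Re q" "Im p < Im q" using X h by (simp_all add: p_def q_def)
  have img: "\<bar>Im (?C t)\<bar> \<le> h \<and> Y \<le> Re (?C t) \<and> Re (?C t) \<le> X" if "t \<in> {0..1}" for t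
  proof -
    have "?C t \<in> path_image ?C" using that by (auto simp: path_image_def)
    then show ?thesis using path_image_rectpath[of p q] pq h by (auto simp: p_def q_def)
  qed
  have lt: "h < pi * Im \<tau>" "2 * h < pi * Im \<tau>" using tau by (simp_all add: h_def)
  have C0: "on_C0 \<tau> (?C t) \<longleftrightarrow> Im (?C t) = 0" if "t \<in> {0..1}" for t
    using on_C0_narrow[of "?C t"] img[OF that] lt by linarith
  have ImC: "Im (?C t) = (if t \<le> 1/2 then - h else if t \<le> 3/4 then h * (8 * t - 5) else if t \<le> 7/8 then h else h * (15 - 16 * t))" for t
    unfolding rectpath_formula by (simp add: linepath_def p_def q_def algebra_simps)
  have Im0: "Im (?C t) = 0 \<longleftrightarrow> t = 5/8 \<or> t = 15/16" for t
    unfolding ImC using h by auto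
  have "solid_contour G \<alpha> \<tau> S u0 ?C"
    unfolding solid_contour_def
  proof (intro conjI ballI impI)
    fix s t :: real assume st: "s \<in> {0..<1}" "t \<in> {0..<1}" "torus_eq \<tau> (?C s) (?C t)"
    then have s1: "s \<in> {0..1}" and t1: "t \<in> {0..1}" by auto
    have i: "\<bar>Im (?C s) - Im (?C t)\<bar> < pi * Im \<tau>" using img[OF s1] img[OF t1] lt by linarith
    obtain m :: int where m: "Re (?C s) - Re (?C t) = of_int m * pi" using torus_eq_narrow(2)[OF st(3) i] by blast
    then have "\<bar>of_int m * pi\<bar> < pi" using img[OF s1] img[OF t1] X by linarith
    then have "m = 0" by (rule int_mult_bounded_eq_0)
    then have "?C s = ?C t" using m torus_eq_narrow(1)[OF st(3) i] by (simp add: complex_eq_iff)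
    moreover have "simple_path ?C" using pq by (intro simple_path_rectpath) auto
    ultimately show "s = t" using s1 t1 st(1,2) unfolding simple_path_def loop_free_def by force
  next
    fix z assume "z \<in> inside (path_image ?C)"
    then show "winding_number ?C z = 1" using inside_rectpath_subset[OF pq] winding_number_rectpath by blast
  next
    have Xt: "?C (5/8) = Complex X 0" and Yt: "?C (15/16) = Complex Y 0"
      unfolding rectpath_formula by (simp_all add: linepath_def p_def q_def complex_eq_iff)
    show "\<exists>x1 x2. 0 < x1 \<and> x1 < x2 \<and> x2 < 1 \<and> {x\<in>{0..1}. on_C0 \<tau> (?C x)} = {x1, x2} \<and>
        Im (?C 0) < 0 \<and> Im (?C x1) = 0 \<and> (\<forall>x\<in>{x1<..<x2}. Im (?C x) > 0) \<and> Im (?C x2) = 0 \<and>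
        Re (?C x1) \<notin> S \<and> Re (?C x2) \<in> connected_component_set (- angle_points G \<alpha>) (Re u0)"
    proof (rule exI[of _ "5/8"], rule exI[of _ "15/16"], intro conjI ballI)
      show "{t \<in> {0..1}. on_C0 \<tau> (?C t)} = {5/8, 15/16}" using C0 Im0 by auto
      show "Im (?C 0) < 0" unfolding ImC using h by simp
      show "Im (?C (5/8)) = 0" "Im (?C (15/16)) = 0" unfolding Xt Yt by simp_all
      show "0 < Im (?C t)" if "t \<in> {5/8<..<15/16}" for t unfolding ImC using h that by auto
      show "Re (?C (5/8)) \<notin> S" unfolding Xt using X(3) by simp
      show "Re (?C (15/16)) \<in> connected_component_set (- angle_points G \<alpha>) (Re u0)"
        unfolding Yt using u0 by (simp add: Y_def connected_component_refl_eq)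
    qed simp_all
  qed simp_all
  then show ?thesis by blast
qed

end

section \<open>Integrals over contours that cross the sector\<close>

text \<open>
  The quotient is \<open>cos (b - a) + sin (b - a) cot (u - b)\<close>, and the cotangent exchanges the two
  half-planes.
\<close>

lemma Im_sin_quotient:
  "Im (sin (u - of_real a) / sin (u - of_real b))
   = - sin (b - a) * ((exp (2 * Im u) - exp (- 2 * Im u)) / 4) / (norm (sin (u - of_real b)))\<^sup>2"
proof -
  define v where "v = u - of_real b"
  have "Im (sin (v + of_real (b - a)) * cnj (sin v)) = sin (b - a) * Im (cos v * cnj (sin v))"
  proof -
    have "sin (v + of_real (b - a)) * cnj (sin v) = of_real (cos (b - a)) * (sin v * cnj (sin v)) + of_real (sin (b - a)) * (cos v * cnj (sin v))"
      by (simp add: sin_add sin_of_real cos_of_real algebra_simps del: of_real_diff)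
    moreover have "Im (of_real (cos (b - a)) * (sin v * cnj (sin v))) = 0"
      unfolding complex_mult_cnj by (simp del: of_real_add of_real_power)
    ultimately show ?thesis by simp
  qed
  also have "Im (cos v * cnj (sin v)) = - ((exp (2 * Im u) - exp (- 2 * Im u)) / 4)"
  proof -
    define E where "E = exp (Im v)"
    define F where "F = exp (- Im v)"
    have sq: "E\<^sup>2 = exp (2 * Im u)" "F\<^sup>2 = exp (- 2 * Im u)"
      by (simp_all add: E_def F_def v_def exp_double[symmetric] power2_eq_square exp_add[symmetric])
    define S where "S = sin (Re v)"
    define D where "D = cos (Re v)"
    have SD: "S * S + D * D = 1" using sin_cos_squared_add[of "Re v"] by (simp add: S_def D_def power2_eq_square)
    have "Im (cos v * cnj (sin v)) = - ((S * S + D * D) * ((E\<^sup>2 - F\<^sup>2) / 4))"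
      unfolding E_def F_def S_def D_def by (simp add: Re_sin Im_sin Re_cos Im_cos field_simps power2_eq_square del: sin_cos_squared_add sin_cos_squared_add2 sin_cos_squared_add3)
    also have "\<dots> = - ((E\<^sup>2 - F\<^sup>2) / 4)" unfolding SD by simp
    finally show ?thesis unfolding sq .
  qed
  finally have "Im (sin (v + of_real (b - a)) * cnj (sin v)) = - sin (b - a) * ((exp (2 * Im u) - exp (- 2 * Im u)) / 4)" by simp
  moreover have "sin (u - of_real a) / sin (u - of_real b) = (sin (v + of_real (b - a)) * cnj (sin v)) / of_real ((norm (sin v))\<^sup>2)"
    unfolding complex_norm_square by (simp add: v_def)
  ultimately show ?thesis by (simp add: v_def Im_divide_of_real)
qed

lemma Ln_ii_of_real:
  assumes "r \<noteq> 0"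
  shows "Ln (\<i> * of_real r) = of_real (ln \<bar>r\<bar>) + (if r > 0 then 1 else - 1) * \<i> * of_real pi / 2"
    and "Ln (- \<i> * of_real r) = of_real (ln \<bar>r\<bar>) - (if r > 0 then 1 else - 1) * \<i> * of_real pi / 2"
proof -
  have l: "Ln (of_real s) = of_real (ln s)" if "s > 0" for s using Ln_of_real that by simp
  have p: "Ln (\<i> * of_real s) = of_real (ln s) + \<i> * of_real pi / 2" if "s > 0" for s
    using Ln_times_ii[of "of_real s"] that l[OF that] by simp
  have m: "Ln (- (\<i> * of_real s)) = of_real (ln s) - \<i> * of_real pi / 2" if "s > 0" for s
    using cnj_Ln[of "\<i> * of_real s"] p[OF that] that by (simp add: complex_nonpos_Reals_iff)
  show "Ln (\<i> * of_real r) = of_real (ln \<bar>r\<bar>) + (if r > 0 then 1 else - 1) * \<i> * of_real pi / 2"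
    using p[of r] m[of "- r"] assms by (cases "r > 0") auto
  show "Ln (- \<i> * of_real r) = of_real (ln \<bar>r\<bar>) - (if r > 0 then 1 else - 1) * \<i> * of_real pi / 2"
    using m[of r] p[of "- r"] assms by (cases "r > 0") auto
qed

lemma sin_add_int_pi: "sin (x + of_int k * pi) = (if even k then 1 else - 1) * sin x"
  by (simp add: sin_add sin_int_times_real cos_int_times_real mult.commute)

lemma sin_quotient_pos:
  assumes "a < b" "b < a + pi" "x \<notin> sector a b" shows "sin (x - a) / sin (x - b) > 0"
proof -
  define k where "k = - \<lfloor>(x - b) / pi\<rfloor>"
  define y where "y = x + of_int k * pi"
  have "of_int (- k) * pi \<le> x - b" "x - b < (of_int (- k) + 1) * pi"
    unfolding k_def using floor_divide_lower[of pi "x - b"] floor_divide_upper[of pi "x - b"] by simp_all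
  then have y: "b \<le> y" "y < b + pi" by (simp_all add: y_def algebra_simps)
  have "\<not> (a \<le> y \<and> y \<le> b)" using assms(3) unfolding sector_def y_def by blast
  moreover have "\<not> (a \<le> y - pi \<and> y - pi \<le> b)"
  proof
    assume "a \<le> y - pi \<and> y - pi \<le> b"
    then have "a \<le> x + of_int (k - 1) * pi \<and> x + of_int (k - 1) * pi \<le> b" by (simp add: y_def algebra_simps)
    then show False using assms(3) unfolding sector_def by blast
  qed
  ultimately have "b < y" "y < a + pi" using y assms by auto
  then have "sin (y - a) > 0" "sin (y - b) > 0" using assms by (auto intro!: sin_gt_zero)
  moreover have "y - a = (x - a) + of_int k * pi" "y - b = (x - b) + of_int k * pi" by (simp_all add: y_def)
  ultimately show ?thesis by (auto simp: sin_add_int_pi zero_less_divide_iff split: if_splits)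
qed

lemma sin_quotient_neg:
  assumes "b < a + pi" "a < x + of_int k * pi" "x + of_int k * pi < b" shows "sin (x - a) / sin (x - b) < 0"
proof -
  define y where "y = x + of_int k * pi"
  have "sin (y - a) > 0" "sin (b - y) > 0" using assms by (auto simp: y_def intro!: sin_gt_zero)
  then have "sin (y - a) > 0" "sin (y - b) < 0" using sin_minus[of "y - b"] by simp_all
  moreover have "y - a = (x - a) + of_int k * pi" "y - b = (x - b) + of_int k * pi" by (simp_all add: y_def)
  ultimately show ?thesis by (auto simp: sin_add_int_pi divide_less_0_iff split: if_splits)
qed

lemma complex_sin_eq_0_real:
  fixes u :: complex assumes "Im u \<noteq> 0" shows "sin u \<noteq> 0"
proof
  assume "sin u = 0"
  then obtain n :: int where "u = of_real (of_int n * pi)" using sin_eq_0 by blast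
  then show False using assms by simp
qed

text \<open>
  On a closed half-plane the quotient takes values in the opposite closed half-plane, without \<open>0\<close>.
  Multiplication by \<open>i\<close> or \<open>-i\<close> turns this into the right half-plane, where the principal branch is
  holomorphic also at boundary points.
\<close>

lemma Ln_sin_quotient_deriv:
  assumes ab: "a < b" "b < a + pi" and c: "c = \<i> \<and> Im u \<ge> 0 \<or> c = - \<i> \<and> Im u \<le> 0"
    and nz: "sin (u - of_real a) \<noteq> 0" "sin (u - of_real b) \<noteq> 0"
  shows "((\<lambda>u. Ln (c * (sin (u - of_real a) / sin (u - of_real b)))) has_field_derivative
    cot (u - of_real a) - cot (u - of_real b)) (at u)"
proof -
  let ?f = "\<lambda>u. sin (u - of_real a) / sin (u - complex_of_real b)"
  have "sin (b - a) > 0" using ab by (intro sin_gt_zero) auto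
  have ri: "Re (\<i> * w) = - Im w" "Re (- \<i> * w) = Im w" for w by simp_all
  have n: "c * ?f u \<notin> \<real>\<^sub>\<le>\<^sub>0"
  proof
    assume r: "c * ?f u \<in> \<real>\<^sub>\<le>\<^sub>0"
    have sq: "(norm (sin (u - of_real b)))\<^sup>2 > 0" using nz by simp
    show False
    proof (cases "Im u = 0")
      case True
      then have "u = of_real (Re u)" by (simp add: complex_eq_iff)
      then have "?f u = of_real (sin (Re u - a) / sin (Re u - b))"
        by (metis of_real_diff of_real_divide sin_of_real)
      then have "Re (c * ?f u) = 0" using c by auto
      then have "c * ?f u = 0" using r by (simp add: complex_nonpos_Reals_iff complex_eq_iff)
      then show False using nz c by auto
    next
      case False
      have "Re (c * ?f u) > 0"
      proof (cases "Im u > 0")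
        case True
        then have "Im (?f u) < 0" unfolding Im_sin_quotient using \<open>sin (b - a) > 0\<close> sq
          by (intro divide_neg_pos) (auto simp: mult_less_0_iff)
        moreover have "c = \<i>" using c True by auto
        ultimately show ?thesis unfolding \<open>c = \<i>\<close> ri by linarith
      next
        case False
        with \<open>Im u \<noteq> 0\<close> have "Im u < 0" by simp
        then have "Im (?f u) > 0" unfolding Im_sin_quotient using \<open>sin (b - a) > 0\<close> sq
          by (intro divide_pos_pos) (auto simp: zero_less_mult_iff mult_less_0_iff)
        moreover have "c = - \<i>" using c \<open>Im u < 0\<close> by auto
        ultimately show ?thesis unfolding \<open>c = - \<i>\<close> ri by linarith
      qed
      then show False using r by (simp add: complex_nonpos_Reals_iff)
    qed
  qed
  have "(?f has_field_derivative
      (cos (u - of_real a) * sin (u - of_real b) - sin (u - of_real a) * cos (u - of_real b)) / (sin (u - of_real b) * sin (u - of_real b))) (at u)"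
    using nz by (auto intro!: derivative_eq_intros)
  then have df: "((\<lambda>u. c * ?f u) has_field_derivative
      c * ((cos (u - of_real a) * sin (u - of_real b) - sin (u - of_real a) * cos (u - of_real b)) / (sin (u - of_real b) * sin (u - of_real b)))) (at u)"
    by (rule DERIV_cmult)
  have c0: "c \<noteq> 0" using c by auto
  have "inverse (c * ?f u) * (c * ((cos (u - of_real a) * sin (u - of_real b) - sin (u - of_real a) * cos (u - of_real b)) / (sin (u - of_real b) * sin (u - of_real b))))
     = cot (u - of_real a) - cot (u - of_real b)"
    using nz c0 by (simp add: cot_def field_simps)
  then show ?thesis using DERIV_chain2[OF has_field_derivative_Ln[OF n] df] by simp
qed

context
  fixes \<tau> :: complex
  assumes tau: "Im \<tau> > 0" and re: "Re \<tau> = 0"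
begin

text \<open>
  On the convex strip \<open>|Im z| < \<pi> Im \<tau>\<close> the function \<open>\<theta>/sin\<close> has no zeros and so has a
  logarithm \<open>g\<close> there.
\<close>

lemma theta_regular_log:
  obtains g where "\<And>z. \<bar>Im z\<bar> < pi * Im \<tau> \<Longrightarrow> sin z \<noteq> 0 \<Longrightarrow> theta \<tau> z \<noteq> 0 \<and>
    (g has_field_derivative dlog_theta \<tau> z - cot z) (at z)"
proof -
  let ?S = "{z. \<bar>Im z\<bar> < pi * Im \<tau>}"
  have S: "?S = {z. Im z < pi * Im \<tau>} \<inter> {z. Im z > - (pi * Im \<tau>)}" by auto
  have oS: "open ?S" unfolding S by (intro open_Int open_halfspace_Im_lt open_halfspace_Im_gt)
  have cS: "convex ?S" unfolding S by (intro convex_Int convex_halfspace_Im_lt convex_halfspace_Im_gt)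
  obtain C where C: "C \<noteq> 0" "\<And>z. theta \<tau> z = C * (sin z * theta_regular \<tau> z)" using theta_product[OF tau] by blast
  obtain g where g: "g holomorphic_on ?S" "\<And>z. z \<in> ?S \<Longrightarrow> theta_regular \<tau> z = exp (g z)"
    using contractible_imp_holomorphic_log[OF theta_regular_holomorphic[OF tau] convex_imp_contractible[OF cS]]
      theta_regular_nonzero[OF tau] by auto
  show ?thesis
  proof (rule that[of g])
    fix z assume z: "\<bar>Im z\<bar> < pi * Im \<tau>" "sin z \<noteq> 0"
    have zS: "z \<in> ?S" using z by simp
    have nz: "theta_regular \<tau> z \<noteq> 0" by (rule theta_regular_nonzero[OF tau z(1)])
    have d: "(g has_field_derivative deriv g z) (at z)" by (rule holomorphic_derivI[OF g(1) oS zS])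
    have "(theta_regular \<tau> has_field_derivative exp (g z) * deriv g z) (at z)"
      by (rule has_field_derivative_transform_within_open[OF DERIV_fun_exp[OF d] oS zS]) (simp only: g(2))
    from DERIV_imp_deriv[OF this] have dr: "deriv (theta_regular \<tau>) z = theta_regular \<tau> z * deriv g z"
      using g(2)[OF zS] by simp
    have "((\<lambda>z. C * (sin z * theta_regular \<tau> z)) has_field_derivative
        C * (cos z * theta_regular \<tau> z + sin z * deriv (theta_regular \<tau>) z)) (at z)"
      by (rule derivative_eq_intros theta_regular_deriv[OF tau] refl | simp)+
    then have "deriv (theta \<tau>) z = C * (cos z * theta_regular \<tau> z + sin z * deriv (theta_regular \<tau>) z)"
      unfolding C(2)[symmetric] by (rule DERIV_imp_deriv)
    then have "dlog_theta \<tau> z = cot z + deriv g z"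
      unfolding dlog_theta_def C(2) dr cot_def using C(1) nz z(2) by (simp add: field_simps)
    then show "theta \<tau> z \<noteq> 0 \<and> (g has_field_derivative dlog_theta \<tau> z - cot z) (at z)"
      using d C nz z(2) by simp
  qed
qed

text \<open>
  Since \<open>x1\<close> and \<open>x2\<close> are the only times on \<open>C0\<close>, the intermediate value theorem determines the sign of
  the imaginary part at all other times, and prevents it from reaching \<open>\<pi> Im \<tau>\<close> in absolute value.
\<close>

lemma solid_contour_strip:
  assumes C: "solid_contour G \<alpha> \<tau> S u0 C"
  obtains x1 x2 where "0 < x1" "x1 < x2" "x2 < 1" "Im (C x1) = 0" "Im (C x2) = 0" "Re (C x1) \<notin> S"
    "Re (C x2) \<in> connected_component_set (- angle_points G \<alpha>) (Re u0)"
    "\<And>x. x \<in> {x1<..<x2} \<Longrightarrow> 0 < Im (C x)" "\<And>x. x \<in> {0..<x1} \<union> {x2<..1} \<Longrightarrow> Im (C x) < 0"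
    "\<And>x. x \<in> {0..1} \<Longrightarrow> \<bar>Im (C x)\<bar> < pi * Im \<tau>"
proof -
  let ?h = "pi * Im \<tau>"
  have h: "?h > 0" using tau by simp
  obtain x1 x2 where x: "0 < x1" "x1 < x2" "x2 < 1" "{x\<in>{0..1}. on_C0 \<tau> (C x)} = {x1, x2}"
      "Im (C 0) < 0" "Im (C x1) = 0" "\<And>x. x\<in>{x1<..<x2} \<Longrightarrow> Im (C x) > 0" "Im (C x2) = 0"
      "Re (C x1) \<notin> S" "Re (C x2) \<in> connected_component_set (- angle_points G \<alpha>) (Re u0)"
    and cl: "C 1 = C 0" and vp: "valid_path C"
    using C unfolding solid_contour_def pathstart_def pathfinish_def by blast
  have cont: "continuous_on A (\<lambda>x. Im (C x))" if "A \<subseteq> {0..1}" for A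
    using valid_path_imp_path[OF vp] that unfolding path_def by (intro continuous_intros) (rule continuous_on_subset)
  have only: "x = x1 \<or> x = x2" if "x \<in> {0..1}" "Im (C x) = of_int k * ?h" for x and k :: int
  proof -
    have "on_C0 \<tau> (C x)" unfolding on_C0_def using that(2) by (auto simp: mult.assoc)
    then show ?thesis using x(4) that(1) by blast
  qed
  have no: "\<not> (\<exists>z\<in>{y..w} \<union> {w..y}. Im (C z) = of_int k * ?h)" if "{y..w} \<union> {w..y} \<subseteq> {0..1} - {x1, x2}" for y w and k :: int
    using only that by blast
  have ivt: "\<exists>z\<in>{y..w}. Im (C z) = c" if "y \<le> w" "{y..w} \<subseteq> {0..1}" "Im (C y) \<le> c \<and> c \<le> Im (C w) \<or> Im (C w) \<le> c \<and> c \<le> Im (C y)" for y w c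
  proof -
    have "continuous_on {y..w} (\<lambda>x. Im (C x))" by (rule cont[OF that(2)])
    then show ?thesis using that(1,3) IVT'[of "\<lambda>x. Im (C x)" y c w] IVT2'[of "\<lambda>x. Im (C x)" w c y] by fastforce
  qed
  have neg: "Im (C y) < 0" if y: "y \<in> {0..<x1} \<union> {x2<..1}" for y
  proof (rule ccontr)
    assume n: "\<not> Im (C y) < 0"
    show False
    proof (cases "y < x1")
      case True
      then have "\<exists>z\<in>{0..y}. Im (C z) = 0" using n x y by (intro ivt) auto
      then obtain z where z: "z \<in> {0..y}" "Im (C z) = 0" by blast
      then show False using only[of z 0] True x y by auto
    next
      case False
      then have "y > x2" "y \<le> 1" using y x by auto
      then have "\<exists>z\<in>{y..1}. Im (C z) = 0" using n x cl by (intro ivt) auto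
      then obtain z where z: "z \<in> {y..1}" "Im (C z) = 0" by blast
      then show False using only[of z 0] \<open>y > x2\<close> x by auto
    qed
  qed
  have strip: "\<bar>Im (C y)\<bar> < ?h" if y: "y \<in> {0..1}" for y
  proof (rule ccontr)
    assume n: "\<not> \<bar>Im (C y)\<bar> < ?h"
    have bad: False if "z \<in> {0..1}" "Im (C z) = ?h \<or> Im (C z) = - ?h" for z
    proof -
      have "z = x1 \<or> z = x2" using that only[of z 1] only[of z "- 1"] by auto
      then show False using that(2) x(6,8) h by auto
    qed
    have "\<exists>z\<in>{y..x2} \<union> {x2..y}. Im (C z) = (if Im (C y) \<ge> 0 then ?h else - ?h)"
    proof (cases "y \<le> x2")
      case True
      then show ?thesis using ivt[of y x2 "if Im (C y) \<ge> 0 then ?h else - ?h"] n x y h by (auto split: if_splits)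
    next
      case False
      then show ?thesis using ivt[of x2 y "if Im (C y) \<ge> 0 then ?h else - ?h"] n x y h by (auto split: if_splits)
    qed
    then obtain z where "z \<in> {y..x2} \<union> {x2..y}" "Im (C z) = (if Im (C y) \<ge> 0 then ?h else - ?h)" by blast
    then show False using bad[of z] y x by (auto split: if_splits)
  qed
  show ?thesis by (rule that[OF x(1-3,6,8-10,7) neg strip]) auto
qed

text \<open>
  The integrand has primitives on the part of the contour above the real axis and on the part below
  it, which differ only in the branch of the logarithm of the sine quotient. The integral is thus
  the difference of branches at the second crossing minus that at the first one, and the difference
  of branches is \<open>i \<pi>\<close> times the sign of the quotient. This sign is positive at the first crossing,
  which avoids the sector.
\<close>

lemma solid_contour_integral:
  assumes C: "solid_contour G \<alpha> \<tau> (sector a b) u0 C" and ab: "a < b" "b < a + pi"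
    and ang: "\<And>k::int. a + of_int k * pi \<in> angle_points G \<alpha>" "\<And>k::int. b + of_int k * pi \<in> angle_points G \<alpha>"
  shows "((\<lambda>u. dlog_theta \<tau> (u - of_real a) - dlog_theta \<tau> (u - of_real b)) has_contour_integral
    (if \<exists>k::int. a < Re u0 + of_int k * pi \<and> Re u0 + of_int k * pi < b then - 2 * of_real pi * \<i> else 0)) C"
proof -
  let ?in = "\<exists>k::int. a < Re u0 + of_int k * pi \<and> Re u0 + of_int k * pi < b"
  let ?h = "\<lambda>u. dlog_theta \<tau> (u - of_real a) - dlog_theta \<tau> (u - of_real b)"
  let ?f = "\<lambda>u. sin (u - of_real a) / sin (u - complex_of_real b)"
  obtain x1 x2 where x: "0 < x1" "x1 < x2" "x2 < 1" "Im (C x1) = 0" "Im (C x2) = 0" "Re (C x1) \<notin> sector a b"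
    "Re (C x2) \<in> connected_component_set (- angle_points G \<alpha>) (Re u0)"
    "\<And>x. x \<in> {x1<..<x2} \<Longrightarrow> 0 < Im (C x)" "\<And>x. x \<in> {0..<x1} \<union> {x2<..1} \<Longrightarrow> Im (C x) < 0"
    "\<And>x. x \<in> {0..1} \<Longrightarrow> \<bar>Im (C x)\<bar> < pi * Im \<tau>"
    using solid_contour_strip[OF C] by blast
  have vp: "valid_path C" and cl: "C 1 = C 0" using C unfolding solid_contour_def pathstart_def pathfinish_def by blast+
  define X where "X = Re (C x1)"
  define Y where "Y = Re (C x2)"
  have CX: "C x1 = of_real X" and CY: "C x2 = of_real Y" using x(4,5) by (simp_all add: X_def Y_def complex_eq_iff)
  \<comment> \<open>the second crossing and \<open>u0\<close> are on the same side of all translates of \<open>a\<close> and \<open>b\<close>, which are angle points\<close>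
  have comp: "connected_component (- angle_points G \<alpha>) (Re u0) Y" using x(7) by (simp add: Y_def)
  have between: "z \<notin> angle_points G \<alpha>" if "min (Re u0) Y \<le> z" "z \<le> max (Re u0) Y" for z
  proof -
    obtain T where T: "connected T" "T \<subseteq> - angle_points G \<alpha>" "Re u0 \<in> T" "Y \<in> T"
      using comp unfolding connected_component_def by blast
    have "min (Re u0) Y \<in> T" "max (Re u0) Y \<in> T" using T by (auto simp: min_def max_def)
    then have "z \<in> T" using connected_contains_Icc[OF T(1)] that by (meson atLeastAtMost_iff subsetD)
    then show ?thesis using T(2) by blast
  qed
  have trans: "a < r' + of_int k * pi \<and> r' + of_int k * pi < b"
    if "a < r + of_int k * pi" "r + of_int k * pi < b" "{r, r'} = {Re u0, Y}" for r r' and k :: int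
  proof (rule ccontr)
    assume n: "\<not> ?thesis"
    have mm: "min (Re u0) Y = min r r'" "max (Re u0) Y = max r r'" using that(3) by (auto simp: doubleton_eq_iff)
    have "\<not> (min r r' \<le> a - of_int k * pi \<and> a - of_int k * pi \<le> max r r')"
      using between[of "a - of_int k * pi"] ang(1)[of "- k"] mm by auto
    moreover have "\<not> (min r r' \<le> b - of_int k * pi \<and> b - of_int k * pi \<le> max r r')"
      using between[of "b - of_int k * pi"] ang(2)[of "- k"] mm by auto
    ultimately show False using n that(1,2) by (auto simp: min_def max_def split: if_splits)
  qed
  have inY: "?in \<longleftrightarrow> (\<exists>k::int. a < Y + of_int k * pi \<and> Y + of_int k * pi < b)"
    using trans[of "Re u0" _ Y] trans[of Y _ "Re u0"] by (auto simp: insert_commute)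
  have Ynot: "Y \<noteq> a + of_int k * pi" "Y \<noteq> b + of_int k * pi" for k :: int
    using between[of Y] ang by auto
  have Ysec: "Y \<notin> sector a b" if "\<not> (\<exists>k::int. a < Y + of_int k * pi \<and> Y + of_int k * pi < b)"
  proof
    assume "Y \<in> sector a b"
    then obtain k :: int where k: "a \<le> Y + of_int k * pi" "Y + of_int k * pi \<le> b" by (auto simp: sector_def)
    moreover have "Y + of_int k * pi \<noteq> a" "Y + of_int k * pi \<noteq> b" using Ynot[of "- k"] by auto
    ultimately show False using that by (auto simp: less_le)
  qed
  define fX where "fX = sin (X - a) / sin (X - b)"
  define fY where "fY = sin (Y - a) / sin (Y - b)"
  have f: "?f (C x1) = of_real fX" "?f (C x2) = of_real fY"
    unfolding CX CY fX_def fY_def by (metis of_real_diff of_real_divide sin_of_real)+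
  have fXp: "fX > 0" unfolding fX_def by (rule sin_quotient_pos[OF ab]) (simp add: X_def x(6))
  have fYs: "if ?in then fY < 0 else fY > 0"
    unfolding inY fY_def using sin_quotient_neg[OF ab(2)] sin_quotient_pos[OF ab Ysec] by auto
  have fY0: "fY \<noteq> 0" using fYs by (auto split: if_splits)
  have nz: "sin (C y - of_real a) \<noteq> 0 \<and> sin (C y - of_real b) \<noteq> 0" if y: "y \<in> {0..1}" for y
  proof (cases "y = x1 \<or> y = x2")
    case True
    have "?f (C y) \<noteq> 0" using True f fXp fY0 by auto
    then show ?thesis by auto
  next
    case False
    then have "Im (C y) \<noteq> 0" using x(8)[of y] x(9)[of y] y by (cases "y < x1"; cases "y > x2") auto
    then show ?thesis by (intro conjI complex_sin_eq_0_real) auto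
  qed
  obtain g where g: "\<And>z. \<bar>Im z\<bar> < pi * Im \<tau> \<Longrightarrow> sin z \<noteq> 0 \<Longrightarrow> theta \<tau> z \<noteq> 0 \<and>
    (g has_field_derivative dlog_theta \<tau> z - cot z) (at z)" using theta_regular_log by blast
  define H where "H = (\<lambda>c u. Ln (c * ?f u) + (g (u - of_real a) - g (u - of_real b)))"
  have dH: "(H c has_field_derivative ?h u) (at u within A)"
    if c: "c = \<i> \<and> Im u \<ge> 0 \<or> c = - \<i> \<and> Im u \<le> 0" and u: "u = C y" "y \<in> {0..1}" for c u y A
  proof -
    have s: "sin (u - of_real a) \<noteq> 0" "sin (u - of_real b) \<noteq> 0" "\<bar>Im u\<bar> < pi * Im \<tau>" using nz x(10) u by auto
    have gd: "((\<lambda>u. g (u - of_real r)) has_field_derivative (dlog_theta \<tau> (u - of_real r) - cot (u - of_real r)) * 1) (at u)"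
      if "sin (u - of_real r) \<noteq> 0" for r
      using that s(3) g by (intro DERIV_chain2[of g]) (auto intro!: derivative_eq_intros)
    have "(H c has_field_derivative (cot (u - of_real a) - cot (u - of_real b)) +
       ((dlog_theta \<tau> (u - of_real a) - cot (u - of_real a)) * 1 - (dlog_theta \<tau> (u - of_real b) - cot (u - of_real b)) * 1)) (at u)"
      unfolding H_def by (intro DERIV_add DERIV_diff Ln_sin_quotient_deriv[OF ab c s(1,2)] gd s(1,2))
    then show ?thesis using has_field_derivative_at_within by fastforce
  qed
  have piece: "contour_integral (subpath y w C) ?h = H c (C w) - H c (C y)"
    if c: "c = \<i> \<and> (\<forall>z\<in>{y..w}. Im (C z) \<ge> 0) \<or> c = - \<i> \<and> (\<forall>z\<in>{y..w}. Im (C z) \<le> 0)" and yw: "y \<le> w" "{y..w} \<subseteq> {0..1}" for c y w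
  proof -
    have "(?h has_contour_integral (H c (pathfinish (subpath y w C)) - H c (pathstart (subpath y w C)))) (subpath y w C)"
    proof (rule contour_integral_primitive)
      show "valid_path (subpath y w C)" using vp yw by (intro valid_path_subpath) auto
      show "path_image (subpath y w C) \<subseteq> C ` {y..w}" using yw by (simp add: path_image_subpath)
      fix u assume "u \<in> C ` {y..w}"
      then obtain z where z: "z \<in> {y..w}" "u = C z" by blast
      show "(H c has_field_derivative ?h u) (at u within C ` {y..w})"
        by (rule dH[of c u z]) (use c z yw in auto)
    qed
    then show ?thesis using contour_integral_unique by fastforce
  qed
  have Im1: "Im (C z) \<le> 0" if "z \<in> {0..x1} \<union> {x2..1}" for z
    using x(9)[of z] x(4,5) that x(1-3) by (cases "z = x1 \<or> z = x2") auto
  have Im2: "Im (C z) \<ge> 0" if "z \<in> {x1..x2}" for z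
    using x(8)[of z] x(4,5) that by (cases "z = x1 \<or> z = x2") auto
  have p1: "contour_integral (subpath 0 x1 C) ?h = H (- \<i>) (C x1) - H (- \<i>) (C 0)"
    by (rule piece) (use Im1 x in auto)
  have p2: "contour_integral (subpath x1 x2 C) ?h = H \<i> (C x2) - H \<i> (C x1)"
    by (rule piece) (use Im2 x in auto)
  have p3: "contour_integral (subpath x2 1 C) ?h = H (- \<i>) (C 1) - H (- \<i>) (C x2)"
    by (rule piece) (use Im1 x in auto)
  let ?U = "{u. theta \<tau> (u - of_real a) \<noteq> 0} \<inter> {u. theta \<tau> (u - of_real b) \<noteq> 0}"
  have th: "(\<lambda>u. theta \<tau> (u - r)) holomorphic_on A" for r A
    using holomorphic_on_compose_gen[OF _ theta_holomorphic[OF tau, of UNIV], of "\<lambda>u. u - r" A] by (simp add: o_def holomorphic_intros)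
  have dth: "(\<lambda>u. deriv (theta \<tau>) (u - r)) holomorphic_on A" for r A
    using holomorphic_on_compose_gen[OF _ holomorphic_deriv[OF theta_holomorphic[OF tau, of UNIV]], of "\<lambda>u. u - r" A] by (simp add: o_def holomorphic_intros)
  have "?h contour_integrable_on C"
  proof (rule contour_integrable_holomorphic_simple[where S = ?U])
    have "continuous_on UNIV (\<lambda>u. theta \<tau> (u - r))" for r using th holomorphic_on_imp_continuous_on by blast
    then show "open ?U" by (intro open_Int open_Collect_neq continuous_on_const)
    show "?h holomorphic_on ?U" unfolding dlog_theta_def by (intro holomorphic_intros th dth) auto
    show "path_image C \<subseteq> ?U"
    proof
      fix u assume "u \<in> path_image C"
      then obtain y where y: "y \<in> {0..1}" "u = C y" by (auto simp: path_image_def)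
      then show "u \<in> ?U" using nz[OF y(1)] x(10)[OF y(1)] g[of "u - of_real a"] g[of "u - of_real b"] by auto
    qed
  qed (rule vp)
  then have int: "(?h has_contour_integral contour_integral C ?h) C" by (rule has_contour_integral_integral)
  have "contour_integral (subpath 0 x1 C) ?h + contour_integral (subpath x1 x2 C) ?h = contour_integral (subpath 0 x2 C) ?h"
    by (rule contour_integral_subpath_combine[OF \<open>?h contour_integrable_on C\<close> vp]) (use x in auto)
  moreover have "contour_integral (subpath 0 x2 C) ?h + contour_integral (subpath x2 1 C) ?h = contour_integral (subpath 0 1 C) ?h"
    by (rule contour_integral_subpath_combine[OF \<open>?h contour_integrable_on C\<close> vp]) (use x in auto)
  ultimately have "contour_integral C ?h = (H (- \<i>) (C x1) - H \<i> (C x1)) + (H \<i> (C x2) - H (- \<i>) (C x2))"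
    unfolding p1 p2 p3 by (simp add: cl algebra_simps)
  also have "H (- \<i>) (C x1) - H \<i> (C x1) = - \<i> * of_real pi"
    unfolding H_def f using Ln_ii_of_real[of fX] fXp by simp
  also have "H \<i> (C x2) - H (- \<i>) (C x2) = (if fY > 0 then 1 else - 1) * \<i> * of_real pi"
    unfolding H_def f using Ln_ii_of_real[OF fY0] by simp
  finally have ci: "contour_integral C ?h = - \<i> * of_real pi + (if fY > 0 then 1 else - 1) * \<i> * of_real pi" .
  show ?thesis
  proof (cases "?in")
    case True
    with fYs have "fY < 0" by (simp only: if_True)
    then have "contour_integral C ?h = - 2 * of_real pi * \<i>" unfolding ci by simp
    then show ?thesis using int True by (simp only: if_True)
  next
    case False
    with fYs have "fY > 0" by (simp only: if_False)
    then have "contour_integral C ?h = 0" unfolding ci by simp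
    then show ?thesis using int False by (simp only: if_False)
  qed
qed

end

section \<open>The function g for the two ends of an edge\<close>

lemma ell_K_nonzero:
  assumes tau: "Im \<tau> > 0" and re: "Re \<tau> = 0" shows "ell_K \<tau> \<noteq> 0"
proof -
  define c where "c = (\<lambda>n::nat. exp (- pi * Im \<tau> * (real (Suc n))\<^sup>2))"
  have sm: "summable c"
  proof (rule summable_comparison_test')
    show "summable (\<lambda>n. exp (- pi * Im \<tau>) ^ n)" using tau by (intro summable_geometric) simp
    fix n :: nat
    have "pi * Im \<tau> * real n \<le> pi * Im \<tau> * (real (Suc n))\<^sup>2"
      using tau by (intro mult_left_mono) (auto simp: power2_eq_square algebra_simps)
    then show "norm (c n) \<le> exp (- pi * Im \<tau>) ^ n" by (simp add: c_def exp_of_nat_mult[symmetric] algebra_simps)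
  qed
  have "\<tau> = \<i> * of_real (Im \<tau>)" using re by (simp add: complex_eq_iff)
  then have "\<i> * of_real pi * \<tau> * (of_nat (Suc n))\<^sup>2 = of_real (- pi * Im \<tau> * (real (Suc n))\<^sup>2)" for n
    by (simp add: complex_eq_iff power2_eq_square)
  then have e: "exp (\<i> * of_real pi * \<tau> * (of_nat (Suc n))\<^sup>2) = of_real (c n)" for n
    unfolding c_def exp_of_real[symmetric] by (rule arg_cong)
  have "theta3 \<tau> 0 = 1 + 2 * (\<Sum>n. of_real (c n))" unfolding theta3_def e by simp
  also have "(\<Sum>n. complex_of_real (c n)) = of_real (\<Sum>n. c n)" by (rule suminf_of_real[OF sm, symmetric])
  finally have "theta3 \<tau> 0 = of_real (1 + 2 * (\<Sum>n. c n))" by simp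
  moreover have "0 \<le> (\<Sum>n. c n)" by (rule suminf_nonneg[OF sm]) (simp add: c_def)
  ultimately have "theta3 \<tau> 0 \<noteq> 0" by (simp only: of_real_eq_0_iff)
  then show ?thesis by (simp add: ell_K_def)
qed

lemma is_walk_append: "is_walk G x ds y \<Longrightarrow> is_walk G y ds' z \<Longrightarrow> is_walk G x (ds @ ds') z"
  by (induction ds arbitrary: x) auto

lemma track_of_step:
  assumes "(s, s') \<in> steps G" shows "track_of G s = track_of G s'"
proof -
  let ?R = "steps G \<union> (steps G)\<inverse>"
  have "(s, s') \<in> ?R\<^sup>*" "(s', s) \<in> ?R\<^sup>*" using assms by auto
  then show ?thesis unfolding track_of_def by (auto intro: rtrancl_trans)
qed

lemma g_dart_backward: "g_dart G \<alpha> \<tau> t \<eta> (s, False) u = inverse (g_dart G \<alpha> \<tau> t \<eta> (s, True) u)"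
  by (simp add: g_dart_def Let_def)

lemma g_dart_white:
  "pathstart s \<in> whites G \<Longrightarrow> g_dart G \<alpha> \<tau> t \<eta> (s, True) u
    = theta \<tau> (u - of_real (\<alpha> (track_of G s))) / theta \<tau> (u + t + of_real (\<eta> (pathstart s)))"
  by (simp add: g_dart_def Let_def)

lemma g_dart_black:
  "pathstart s \<notin> whites G \<Longrightarrow> g_dart G \<alpha> \<tau> t \<eta> (s, True) u
    = theta \<tau> (u - t - of_real (\<eta> (pathstart s))) / theta \<tau> (u - of_real (\<alpha> (track_of G s)))"
  by (simp add: g_dart_def Let_def)

text \<open>
  Representatives of all classes at which one of the theta factors of a spoke may vanish.
\<close>

definition spoke_divisor :: "plane_graph \<Rightarrow> (track \<Rightarrow> real) \<Rightarrow> complex \<Rightarrow> (complex \<Rightarrow> real) \<Rightarrow> curve \<Rightarrow> complex set" where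
  "spoke_divisor G \<alpha> t \<eta> s = {of_real (\<alpha> (track_of G s)), - t - of_real (\<eta> (pathstart s)), t + of_real (\<eta> (pathstart s))}"

lemma spoke_divisor_nonzero:
  assumes tau: "Im \<tau> > 0" and u: "\<And>p. p \<in> spoke_divisor G \<alpha> t \<eta> s \<Longrightarrow> \<not> torus_eq \<tau> u p"
  shows "theta \<tau> (u - of_real (\<alpha> (track_of G s))) \<noteq> 0"
    "theta \<tau> (u + t + of_real (\<eta> (pathstart s))) \<noteq> 0"
    "theta \<tau> (u - t - of_real (\<eta> (pathstart s))) \<noteq> 0"
    "g_dart G \<alpha> \<tau> t \<eta> (s, True) u \<noteq> 0"
proof -
  have z: "theta \<tau> (u - p) \<noteq> 0" if "p \<in> spoke_divisor G \<alpha> t \<eta> s" for p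
    using u[OF that] unfolding theta_eq_0_iff[OF tau] torus_eq_def by simp
  show 1: "theta \<tau> (u - of_real (\<alpha> (track_of G s))) \<noteq> 0" by (rule z) (simp add: spoke_divisor_def)
  show 2: "theta \<tau> (u + t + of_real (\<eta> (pathstart s))) \<noteq> 0"
    using z[of "- t - of_real (\<eta> (pathstart s))"] by (simp add: spoke_divisor_def algebra_simps)
  show 3: "theta \<tau> (u - t - of_real (\<eta> (pathstart s))) \<noteq> 0"
    using z[of "t + of_real (\<eta> (pathstart s))"] by (simp add: spoke_divisor_def algebra_simps)
  show "g_dart G \<alpha> \<tau> t \<eta> (s, True) u \<noteq> 0"
    using 1 2 3 by (cases "pathstart s \<in> whites G") (simp_all add: g_dart_white g_dart_black)
qed

context quad_graph begin

lemma quad_tracks: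
  assumes "e \<in> edges G" "quad G e = (s1, s2, s3, s4)"
  shows "track_of G s1 = alpha_track G e" "track_of G s3 = alpha_track G e"
    "track_of G s2 = beta_track G e" "track_of G s4 = beta_track G e"
proof -
  have "(s1, s3) \<in> steps G" "(s2, s4) \<in> steps G"
    using assms by (auto simp: steps_def quad_steps_def intro!: bexI[of _ e])
  then show "track_of G s1 = alpha_track G e" "track_of G s3 = alpha_track G e"
    "track_of G s2 = beta_track G e" "track_of G s4 = beta_track G e"
    using assms(2) by (simp_all add: alpha_track_def beta_track_def track_of_step)
qed

lemma quad_ends:
  assumes "e \<in> edges G" "quad G e = (s1, s2, s3, s4)"
  shows "pathstart s1 = white e" "pathstart s4 = white e" "pathstart s2 = black e" "pathstart s3 = black e"
    "pathfinish s1 = pathfinish s2" "pathfinish s3 = pathfinish s4"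
    "s1 \<in> spokes G" "s2 \<in> spokes G" "s3 \<in> spokes G" "s4 \<in> spokes G"
    "white e \<in> whites G" "black e \<notin> whites G"
proof -
  have "is_quad G e (s1, s2, s3, s4)" using is_quad_quad[OF assms(1)] assms(2) by simp
  then show "pathstart s1 = white e" "pathstart s4 = white e" "pathstart s2 = black e" "pathstart s3 = black e"
    "pathfinish s1 = pathfinish s2" "pathfinish s3 = pathfinish s4"
    "s1 \<in> spokes G" "s2 \<in> spokes G" "s3 \<in> spokes G" "s4 \<in> spokes G"
    by (simp_all add: is_quad_iff quad_set_def)
  show "white e \<in> whites G" using assms(1) by (simp add: whites_def)
  show "black e \<notin> whites G" using white_neq_black assms(1) by (force simp: whites_def)
qed

lemma exp_sum_list_ln:
  assumes "\<And>d. d \<in> set ds \<Longrightarrow> g_dart G \<alpha> \<tau> t \<eta> (fst d, True) u \<noteq> 0"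
  shows "prod_list (map (\<lambda>d. g_dart G \<alpha> \<tau> t \<eta> d u) ds)
    = exp (\<Sum>d\<leftarrow>ds. of_int (dart_sign d) * Ln (g_dart G \<alpha> \<tau> t \<eta> (fst d, True) u))"
  using assms
proof (induction ds)
  case (Cons d ds)
  have "g_dart G \<alpha> \<tau> t \<eta> d u = exp (of_int (dart_sign d) * Ln (g_dart G \<alpha> \<tau> t \<eta> (fst d, True) u))"
    using Cons.prems[of d] by (cases d) (auto simp: dart_sign_def g_dart_backward exp_minus)
  then show ?case using Cons by (simp add: exp_add)
qed simp

lemma exp_sum_list_quads:
  assumes "\<And>e. e \<in> fst ` set l \<Longrightarrow> exp (quad_sum (quad G e) X) = 1"
  shows "exp (\<Sum>(e, m)\<leftarrow>l. of_int m * quad_sum (quad G e) X) = 1"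
  using assms
proof (induction l)
  case (Cons a l)
  obtain e m where a: "a = (e, m)" by (cases a)
  have "exp (of_int m * quad_sum (quad G e) X) = exp (quad_sum (quad G e) X) powi m"
    by (simp add: exp_power_int mult.commute)
  also have "exp (quad_sum (quad G e) X) = 1" using Cons.prems[of e] a by simp
  finally show ?case using Cons a by (simp add: exp_add)
qed simp

text \<open>
  The product of \<open>g\<close> around a quad is \<open>1\<close>: opposite sides are crossed by the same train-track, and
  adjacent sides at \<open>w\<close> or \<open>b\<close> share the other theta factor.
\<close>

lemma exp_quad_sum_g_dart:
  assumes e: "e \<in> edges G" and nz: "\<And>s. s \<in> quad_set (quad G e) \<Longrightarrow> g_dart G \<alpha> \<tau> t \<eta> (s, True) u \<noteq> 0"
  shows "exp (quad_sum (quad G e) (\<lambda>s. Ln (g_dart G \<alpha> \<tau> t \<eta> (s, True) u))) = 1"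
proof -
  obtain s1 s2 s3 s4 where q: "quad G e = (s1, s2, s3, s4)" by (cases "quad G e")
  note E = quad_ends[OF e q] and T = quad_tracks[OF e q]
  let ?c = "\<lambda>s. g_dart G \<alpha> \<tau> t \<eta> (s, True) u"
  have n: "?c s1 \<noteq> 0" "?c s2 \<noteq> 0" "?c s3 \<noteq> 0" "?c s4 \<noteq> 0" using nz by (auto simp: q quad_set_def)
  have "exp (quad_sum (quad G e) (\<lambda>s. Ln (?c s))) = ?c s1 / ?c s2 * ?c s3 / ?c s4"
    using n by (simp add: q quad_sum_def exp_add exp_diff)
  also have "\<dots> = 1"
    using n E T by (simp add: g_dart_white g_dart_black field_simps)
  finally show ?thesis .
qed

text \<open>
  The exceptional set depends on the walk. It has to be finite although the half-angles of all
  train-tracks together may be dense; so it is collected from the finitely many quads needed to fill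
  in the walk.
\<close>

lemma g_closed_walk:
  assumes tau: "Im \<tau> > 0" and w: "is_walk G x ds x" "x \<in> support (spokes G)"
  shows "\<exists>P. finite P \<and> (\<forall>u. (\<forall>p\<in>P. \<not> torus_eq \<tau> u p) \<longrightarrow>
    prod_list (map (\<lambda>d. g_dart G \<alpha> \<tau> t \<eta> d u) ds) = 1)"
proof -
  obtain l where l: "fst ` set l \<subseteq> edges G"
    "\<And>X. (\<Sum>d\<leftarrow>ds. of_int (dart_sign d) * X (fst d)) = (\<Sum>(e, m)\<leftarrow>l. of_int m * quad_sum (quad G e) X)"
    using closed_walk_eq_quad_sum[OF w] by blast
  define A where "A = fst ` set ds \<union> (\<Union>e\<in>fst ` set l. quad_set (quad G e))"
  define P where "P = (\<Union>s\<in>A. spoke_divisor G \<alpha> t \<eta> s)"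
  have "finite P" by (auto simp: P_def A_def spoke_divisor_def)
  moreover have "prod_list (map (\<lambda>d. g_dart G \<alpha> \<tau> t \<eta> d u) ds) = 1" if u: "\<forall>p\<in>P. \<not> torus_eq \<tau> u p" for u
  proof -
    have nz: "g_dart G \<alpha> \<tau> t \<eta> (s, True) u \<noteq> 0" if "s \<in> A" for s
      by (rule spoke_divisor_nonzero(4)[OF tau]) (use u that in \<open>auto simp: P_def\<close>)
    have "prod_list (map (\<lambda>d. g_dart G \<alpha> \<tau> t \<eta> d u) ds)
      = exp (\<Sum>d\<leftarrow>ds. of_int (dart_sign d) * Ln (g_dart G \<alpha> \<tau> t \<eta> (fst d, True) u))"
    proof (rule exp_sum_list_ln)
      fix d assume "d \<in> set ds"
      then have "fst d \<in> A" unfolding A_def by blast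
      then show "g_dart G \<alpha> \<tau> t \<eta> (fst d, True) u \<noteq> 0" by (rule nz)
    qed
    also have "\<dots> = exp (\<Sum>(e, m)\<leftarrow>l. of_int m * quad_sum (quad G e) (\<lambda>s. Ln (g_dart G \<alpha> \<tau> t \<eta> (s, True) u)))"
      unfolding l(2)[of "\<lambda>s. Ln (g_dart G \<alpha> \<tau> t \<eta> (s, True) u)"] ..
    also have "\<dots> = 1"
    proof (rule exp_sum_list_quads)
      fix e assume e: "e \<in> fst ` set l"
      then have "e \<in> edges G" using l(1) by blast
      then show "exp (quad_sum (quad G e) (\<lambda>s. Ln (g_dart G \<alpha> \<tau> t \<eta> (s, True) u))) = 1"
        by (rule exp_quad_sum_g_dart) (rule nz, use e in \<open>unfold A_def, blast\<close>)
    qed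
    finally show ?thesis .
  qed
  ultimately show ?thesis by blast
qed

lemma g_fun_edge:
  assumes tau: "Im \<tau> > 0" and e: "e \<in> edges G"
  shows "\<exists>P. finite P \<and> (\<forall>u. (\<forall>p\<in>P. \<not> torus_eq \<tau> u p) \<longrightarrow>
    g_fun G \<alpha> \<tau> t \<eta> (black e) (white e) u =
      theta \<tau> (u - t - of_real (\<eta> (black e))) * theta \<tau> (u + t + of_real (\<eta> (white e))) /
      (theta \<tau> (u - of_real (\<alpha> (alpha_track G e))) * theta \<tau> (u - of_real (\<alpha> (beta_track G e)))))"
proof -
  obtain s1 s2 s3 s4 where q: "quad G e = (s1, s2, s3, s4)" by (cases "quad G e")
  note E = quad_ends[OF e q] and T = quad_tracks[OF e q]
  define ds where "ds = (SOME ds. is_walk G (black e) ds (white e))"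
  have "is_walk G (black e) [(s3, True), (s4, False)] (white e)"
    using E by (simp add: dart_src_def dart_tgt_def)
  then have ds: "is_walk G (black e) ds (white e)" unfolding ds_def by (rule someI)
  have "is_walk G (white e) [(s4, True), (s3, False)] (black e)"
    using E by (simp add: dart_src_def dart_tgt_def)
  then have w: "is_walk G (black e) (ds @ [(s4, True), (s3, False)]) (black e)" by (rule is_walk_append[OF ds])
  have "black e \<in> path_image s3" using E(4) pathstart_in_path_image by metis
  then have "black e \<in> support (spokes G)" using E(9) by (auto simp: support_def)
  then obtain P where P: "finite P" "\<And>u. \<forall>p\<in>P. \<not> torus_eq \<tau> u p \<Longrightarrow>
      prod_list (map (\<lambda>d. g_dart G \<alpha> \<tau> t \<eta> d u) (ds @ [(s4, True), (s3, False)])) = 1"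
    using g_closed_walk[OF tau w] by blast
  let ?P = "P \<union> spoke_divisor G \<alpha> t \<eta> s3 \<union> spoke_divisor G \<alpha> t \<eta> s4"
  have fin: "finite ?P" using P(1) by (simp add: spoke_divisor_def)
  have main: "g_fun G \<alpha> \<tau> t \<eta> (black e) (white e) u =
      theta \<tau> (u - t - of_real (\<eta> (black e))) * theta \<tau> (u + t + of_real (\<eta> (white e))) /
      (theta \<tau> (u - of_real (\<alpha> (alpha_track G e))) * theta \<tau> (u - of_real (\<alpha> (beta_track G e))))"
    if u: "\<forall>p\<in>?P. \<not> torus_eq \<tau> u p" for u
  proof -
    have n3: "g_dart G \<alpha> \<tau> t \<eta> (s3, True) u \<noteq> 0" and n4: "g_dart G \<alpha> \<tau> t \<eta> (s4, True) u \<noteq> 0"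
      by (rule spoke_divisor_nonzero(4)[OF tau], use u in blast)+
    have "g_fun G \<alpha> \<tau> t \<eta> (black e) (white e) u * (g_dart G \<alpha> \<tau> t \<eta> (s4, True) u * inverse (g_dart G \<alpha> \<tau> t \<eta> (s3, True) u)) = 1"
      using P(2)[of u] u by (simp add: g_fun_def ds_def[symmetric] g_dart_backward)
    then have "g_fun G \<alpha> \<tau> t \<eta> (black e) (white e) u = g_dart G \<alpha> \<tau> t \<eta> (s3, True) u / g_dart G \<alpha> \<tau> t \<eta> (s4, True) u"
      using n3 n4 by (simp add: field_simps)
    also have "g_dart G \<alpha> \<tau> t \<eta> (s3, True) u = theta \<tau> (u - t - of_real (\<eta> (black e))) / theta \<tau> (u - of_real (\<alpha> (alpha_track G e)))"
      using g_dart_black[of s3 G \<alpha> \<tau> t \<eta> u] E(4,12) T(2) by simp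
    also have "g_dart G \<alpha> \<tau> t \<eta> (s4, True) u = theta \<tau> (u - of_real (\<alpha> (beta_track G e))) / theta \<tau> (u + t + of_real (\<eta> (white e)))"
      using g_dart_white[of s4 G \<alpha> \<tau> t \<eta> u] E(2,11) T(4) by simp
    finally show ?thesis by (simp only: divide_divide_eq_left divide_divide_eq_right times_divide_eq_left times_divide_eq_right)
  qed
  show ?thesis
  proof (intro exI[of _ ?P] conjI allI impI)
    show "finite ?P" by (rule fin)
  qed (rule main)
qed

lemma abel_map_edge:
  assumes "abel_map G \<alpha> v0 \<eta>" "e \<in> edges G"
  shows "\<eta> (white e) = \<eta> (black e) - \<alpha> (alpha_track G e) - \<alpha> (beta_track G e)"
proof -
  obtain s1 s2 s3 s4 where q: "quad G e = (s1, s2, s3, s4)" by (cases "quad G e")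
  note E = quad_ends[OF assms(2) q] and T = quad_tracks[OF assms(2) q]
  have "\<eta> (pathfinish s4) = \<eta> (white e) + \<alpha> (beta_track G e)" "\<eta> (pathfinish s3) = \<eta> (black e) - \<alpha> (alpha_track G e)"
  proof -
    have "\<forall>s\<in>spokes G. \<eta> (pathfinish s) =
        (if pathstart s \<in> whites G then \<eta> (pathstart s) + \<alpha> (track_of G s)
         else \<eta> (pathstart s) - \<alpha> (track_of G s))"
      using assms(1) unfolding abel_map_def by blast
    from bspec[OF this E(10)] bspec[OF this E(9)]
    show "\<eta> (pathfinish s4) = \<eta> (white e) + \<alpha> (beta_track G e)" "\<eta> (pathfinish s3) = \<eta> (black e) - \<alpha> (alpha_track G e)"
      using E(2,4,11,12) T(2,4) by simp_all
  qed
  then show ?thesis using E(6) by simp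
qed

lemma alpha_beta_tracks:
  assumes "e \<in> edges G" shows "alpha_track G e \<in> tracks G" "beta_track G e \<in> tracks G"
proof -
  obtain s1 s2 s3 s4 where q: "quad G e = (s1, s2, s3, s4)" by (cases "quad G e")
  show "alpha_track G e \<in> tracks G" "beta_track G e \<in> tracks G"
    using quad_ends[OF assms q] quad_tracks[OF assms q] unfolding tracks_def by (metis imageI)+
qed

end

section \<open>Edge probabilities\<close>

lemma edge_angles_lift:
  assumes "edge_angles G \<alpha> e a b"
  obtains k l :: int where "a = \<alpha> (alpha_track G e) + of_int k * pi" "b = \<alpha> (beta_track G e) + of_int l * pi"
    "a < b" "b < a + pi"
proof -
  have "\<exists>n. \<alpha> (alpha_track G e) = a + of_int n * pi" "\<exists>n. \<alpha> (beta_track G e) = b + of_int n * pi"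
    and ab: "a < b" "b < a + pi"
    using assms unfolding edge_angles_def rcong_altdef by auto
  then obtain m n :: int where "\<alpha> (alpha_track G e) = a + of_int m * pi" "\<alpha> (beta_track G e) = b + of_int n * pi" by blast
  then show ?thesis using that[of "- m" "- n"] ab by simp
qed

text \<open>
  Lifts of the two half-angles with \<open>a < b < a + \<pi>\<close> differ by a common multiple of \<open>\<pi>\<close> only.
\<close>

lemma edge_angles_sector:
  assumes "edge_angles G \<alpha> e a b" "edge_angles G \<alpha> e l r"
  shows "sector l r = sector a b"
proof -
  obtain k j :: int where 1: "a = \<alpha> (alpha_track G e) + of_int k * pi" "b = \<alpha> (beta_track G e) + of_int j * pi"
    "a < b" "b < a + pi" using edge_angles_lift[OF assms(1)] .
  obtain k' j' :: int where 2: "l = \<alpha> (alpha_track G e) + of_int k' * pi" "r = \<alpha> (beta_track G e) + of_int j' * pi"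
    "l < r" "r < l + pi" using edge_angles_lift[OF assms(2)] .
  have "of_int ((j - k) - (j' - k')) * pi = (b - a) - (r - l)" using 1 2 by (simp add: algebra_simps)
  then have "(j - k) - (j' - k') = 0" using 1 2 int_mult_bounded_eq_0[of "(j - k) - (j' - k')" pi] by linarith
  then have j': "real_of_int j' = of_int j + (of_int k' - of_int k)" by linarith
  have lr: "l = a + of_int (k' - k) * pi" "r = b + of_int (k' - k) * pi"
    unfolding 1(1,2) 2(1,2) j' by (simp_all add: algebra_simps)
  have "x \<in> sector l r \<longleftrightarrow> x + of_int (k - k') * pi \<in> sector a b" for x
    unfolding sector_def lr by (simp add: algebra_simps)
  then show ?thesis unfolding sector_shift by blast
qed

lemma det_singleton: "Determinant.det (Matrix.mat (length [e]) (length [e]) f) = f (0, 0)"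
  by (subst det_single) simp_all

locale dimer_setting = quad_graph +
  fixes \<alpha> :: "track \<Rightarrow> real" and \<tau> t v0 u0 :: complex
    and \<eta> :: "complex \<Rightarrow> real" and s :: "complex \<Rightarrow> complex \<Rightarrow> real set" and P :: "curve set measure"
  assumes re: "Re \<tau> = 0" and tau: "Im \<tau> > 0"
    and t: "\<exists>r. t = of_real r + of_real pi / 2 * \<tau>"
    and abel: "abel_map G \<alpha> v0 \<eta>"
    and sect: "sector_system G \<alpha> \<tau> t \<eta> s"
    and isP: "is_P G \<alpha> \<tau> t \<eta> s u0 P"
begin

lemma edge_angles_exist:
  assumes "e \<in> edges G" obtains a b where "edge_angles G \<alpha> e a b"
proof -
  have "is_sector G \<alpha> \<tau> t \<eta> (black e) (white e) (s (black e) (white e))"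
    using sect assms by (auto simp: sector_system_def blacks_def whites_def)
  then show ?thesis using that assms unfolding is_sector_def by blast
qed

lemma sector_edge:
  assumes "e \<in> edges G" "edge_angles G \<alpha> e a b"
  shows "s (black e) (white e) = sector a b"
proof -
  have "is_sector G \<alpha> \<tau> t \<eta> (black e) (white e) (s (black e) (white e))"
    using sect assms by (auto simp: sector_system_def blacks_def whites_def)
  then obtain l r where lr: "s (black e) (white e) = sector l r" "edge_angles G \<alpha> e l r"
    using assms(1) unfolding is_sector_def sector_def by blast
  then show ?thesis using edge_angles_sector[OF assms(2) lr(2)] by simp
qed

definition "contour e = (SOME C. is_contour G \<alpha> \<tau> (s (black e) (white e)) u0 C)"

lemma edge_prob_A:
  assumes "e \<in> edges G"
  shows "complex_of_real (edge_prob P e) = fock_K G \<alpha> \<tau> t \<eta> e * A_coeff G \<alpha> \<tau> t \<eta> s u0 (black e) (white e)"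
proof -
  have "distinct [e] \<and> set [e] \<subseteq> edges G" using assms by simp
  then have "complex_of_real (measure P {\<omega> \<in> space P. set [e] \<subseteq> \<omega>}) =
        prod_list (map (fock_K G \<alpha> \<tau> t \<eta>) [e]) *
        Determinant.det (Matrix.mat (length [e]) (length [e])
          (\<lambda>(i, j). A_coeff G \<alpha> \<tau> t \<eta> s u0 (black ([e] ! i)) (white ([e] ! j))))"
    using isP unfolding is_P_def by blast
  then show ?thesis unfolding det_singleton edge_prob_def by simp
qed

lemma theta_nonzero_Im: "0 < \<bar>Im z\<bar> \<Longrightarrow> \<bar>Im z\<bar> < pi * Im \<tau> \<Longrightarrow> theta \<tau> z \<noteq> 0"
  unfolding theta_eq_0_iff[OF tau] using torus_eq_narrow(1)[OF tau re, of z 0] by auto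

text \<open>
  The constant term in \<open>fay_identity\<close> for \<open>x = t + \<eta>(b)\<close>.
\<close>

definition "edge_const e a b = dlog_theta \<tau> (t + of_real (\<eta> (black e)) - of_real b) - dlog_theta \<tau> (t + of_real (\<eta> (black e)) - of_real a)"

text \<open>
  Up to the factor \<open>kap = \<theta>'(0) K\<close>, the function \<open>g\<close> agrees with the explicit integrand off finitely many
  classes modulo the lattice, and this factor cancels against those in the formula for the
  probability.
\<close>

lemma edge_prob_contour:
  assumes e: "e \<in> edges G" and ab: "edge_angles G \<alpha> e a b"
    and inj: "\<And>x y. x \<in> {0..<1} \<Longrightarrow> y \<in> {0..<1} \<Longrightarrow> torus_eq \<tau> (contour e x) (contour e y) \<Longrightarrow> x = y"
    and I: "((\<lambda>u. dlog_theta \<tau> (u - of_real a) - dlog_theta \<tau> (u - of_real b) + edge_const e a b) has_contour_integral I) (contour e)"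
  shows "complex_of_real (edge_prob P e) = \<i> / (2 * of_real pi) * I"
proof -
  define a0 where "a0 = \<alpha> (alpha_track G e)"
  define b0 where "b0 = \<alpha> (beta_track G e)"
  define x where "x = t + of_real (\<eta> (black e))"
  obtain k l :: int where kl: "a = a0 + of_int k * pi" "b = b0 + of_int l * pi" and lt: "a < b" "b < a + pi"
    using edge_angles_lift[OF ab] unfolding a0_def b0_def .
  define kap where "kap = fock_K G \<alpha> \<tau> t \<eta> e * deriv (theta \<tau>) 0"
  obtain r where r: "t = of_real r + of_real pi / 2 * \<tau>" using t by blast
  have Imx: "Im (x - of_real c) = pi / 2 * Im \<tau>" for c by (simp add: x_def r)
  have nx: "theta \<tau> (x - of_real c) \<noteq> 0" for c
  proof -
    have "pi * Im \<tau> > 0" using tau by simp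
    then show ?thesis using Imx[of c] by (intro theta_nonzero_Im) simp_all
  qed
  have nab: "theta \<tau> (of_real a0 - of_real b0) \<noteq> 0"
  proof
    assume "theta \<tau> (of_real a0 - of_real b0) = 0"
    then have "torus_eq \<tau> (of_real (a0 - b0)) 0" unfolding theta_eq_0_iff[OF tau] by simp
    then obtain m :: int where "a0 - b0 = of_int m * pi"
      using torus_eq_narrow(2)[OF tau re, of "of_real (a0 - b0)" 0] tau by auto
    then have m: "a - b = of_int (m + k - l) * pi" by (simp add: kl algebra_simps)
    then have "m + k - l = 0" using lt int_mult_bounded_eq_0[of "m + k - l" pi] by linarith
    then show False using m lt by simp
  qed
  have K: "fock_K G \<alpha> \<tau> t \<eta> e = theta \<tau> (of_real b0 - of_real a0) / (theta \<tau> (x - of_real b0) * theta \<tau> (x - of_real a0))"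
    by (simp add: fock_K_def Let_def a0_def b0_def x_def)
  have "theta \<tau> (of_real b0 - of_real a0) \<noteq> 0" using nab theta_minus[OF tau, of "of_real a0 - of_real b0"] by simp
  then have kap: "kap \<noteq> 0" unfolding kap_def K using nx deriv_theta_0_nonzero[OF tau] by simp
  let ?g = "g_fun G \<alpha> \<tau> t \<eta> (black e) (white e)"
  let ?h = "\<lambda>u. dlog_theta \<tau> (u - of_real a) - dlog_theta \<tau> (u - of_real b) + edge_const e a b"
  obtain Q where Q: "finite Q" "\<And>u. \<forall>p\<in>Q. \<not> torus_eq \<tau> u p \<Longrightarrow> ?g u =
      theta \<tau> (u - t - of_real (\<eta> (black e))) * theta \<tau> (u + t + of_real (\<eta> (white e))) /
      (theta \<tau> (u - of_real a0) * theta \<tau> (u - of_real b0))"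
    using g_fun_edge[OF tau e] unfolding a0_def b0_def by blast
  have sh: "dlog_theta \<tau> (u - of_real a) = dlog_theta \<tau> (u - of_real a0)" "dlog_theta \<tau> (u - of_real b) = dlog_theta \<tau> (u - of_real b0)" for u
    using dlog_theta_add_int_pi[OF tau, of "u - of_real a0" "- k"] dlog_theta_add_int_pi[OF tau, of "u - of_real b0" "- l"]
    by (simp_all add: kl algebra_simps)
  have eq: "?g u = inverse kap * ?h u" if u: "\<And>p. p \<in> Q \<union> {of_real a0, of_real b0} \<Longrightarrow> \<not> torus_eq \<tau> u p" for u
  proof -
    have n: "theta \<tau> (u - of_real a0) \<noteq> 0" "theta \<tau> (u - of_real b0) \<noteq> 0"
      using u[of "of_real a0"] u[of "of_real b0"] unfolding theta_eq_0_iff[OF tau] by (auto simp: torus_eq_def)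
    have args: "u - t - of_real (\<eta> (black e)) = u - x" "u + t + of_real (\<eta> (white e)) = u + x - of_real a0 - of_real b0"
      unfolding abel_map_edge[OF abel e] by (simp_all add: x_def a0_def b0_def)
    have "?h u = theta \<tau> (of_real b0 - of_real a0) * deriv (theta \<tau>) 0 * theta \<tau> (u - x) * theta \<tau> (u + x - of_real a0 - of_real b0) /
      (theta \<tau> (u - of_real a0) * theta \<tau> (u - of_real b0) * theta \<tau> (x - of_real b0) * theta \<tau> (x - of_real a0))"
      unfolding fay_identity[OF tau nab nx nx n] edge_const_def x_def[symmetric] sh by simp
    also have "\<dots> = kap * ?g u"
    proof -
      have "?g u = theta \<tau> (u - x) * theta \<tau> (u + x - of_real a0 - of_real b0) / (theta \<tau> (u - of_real a0) * theta \<tau> (u - of_real b0))"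
        using Q(2)[of u] u unfolding args by blast
      then show ?thesis unfolding kap_def K by (simp add: mult_ac)
    qed
    finally show ?thesis using kap by (simp add: field_simps)
  qed
  have "(?g has_contour_integral (inverse kap * I)) (contour e)"
    by (rule has_contour_integral_spike_torus[where P = "Q \<union> {of_real a0, of_real b0}" and \<tau> = \<tau>, OF has_contour_integral_lmul[OF I] _ inj eq])
       (use Q(1) in auto)
  then have "contour_integral (contour e) ?g = inverse kap * I" by (rule contour_integral_unique)
  then have "A_coeff G \<alpha> \<tau> t \<eta> s u0 (black e) (white e) = \<i> * deriv (theta \<tau>) 0 / (2 * of_real pi) * (inverse kap * I)"
    unfolding A_coeff_def contour_def by simp
  then show ?thesis unfolding edge_prob_A[OF e] using kap unfolding kap_def by (simp add: field_simps)
qed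

text \<open>
  Here \<open>x = t\<^sub>b + \<pi>\<tau>/2\<close>, and the shift by \<open>\<pi>\<tau>/2\<close> replaces \<open>\<theta>\<close> by \<open>\<theta>\<^sub>4\<close>. The extra terms \<open>-i\<close> of the
  logarithmic derivative cancel in the difference.
\<close>

lemma edge_const_eq:
  defines "tb \<equiv> \<lambda>e. t - of_real pi / 2 * \<tau> + of_real (\<eta> (black e))"
  shows "edge_const e a b = - (2 * ell_K \<tau> / of_real pi) * (Ztilde \<tau> (of_real b - tb e) - Ztilde \<tau> (of_real a - tb e))"
proof -
  obtain r where r: "t = of_real r + of_real pi / 2 * \<tau>" using t by blast
  define y where "y = r + \<eta> (black e)"
  have tb: "tb e = of_real y" by (simp add: tb_def r y_def)
  let ?M = "\<lambda>z. deriv (theta4 \<tau>) z / theta4 \<tau> z"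
  have d: "dlog_theta \<tau> (t + of_real (\<eta> (black e)) - of_real c) = ?M (of_real (y - c)) - \<i>" for c
  proof -
    have arg: "t + of_real (\<eta> (black e)) - of_real c = of_real (y - c) + of_real pi / 2 * \<tau>" by (simp add: r y_def)
    have "theta \<tau> (of_real (y - c) + of_real pi / 2 * \<tau>) \<noteq> 0" using tau by (intro theta_nonzero_Im) auto
    then have "theta4 \<tau> (of_real (y - c)) \<noteq> 0" unfolding theta_add_half_tau[OF tau] by simp
    then show ?thesis unfolding arg by (rule dlog_theta_add_half_tau[OF tau])
  qed
  have odd: "?M (- z) = - ?M z" for z
  proof -
    have "((\<lambda>z. theta4 \<tau> (- z)) has_field_derivative deriv (theta4 \<tau>) (- z) * (- 1)) (at z)"
      by (rule DERIV_chain2[OF theta4_deriv[OF tau]]) (rule derivative_eq_intros refl)+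
    then have "(theta4 \<tau> has_field_derivative deriv (theta4 \<tau>) (- z) * (- 1)) (at z)"
      unfolding theta4_minus[OF tau] .
    then have "deriv (theta4 \<tau>) z = - deriv (theta4 \<tau>) (- z)" by (simp add: DERIV_imp_deriv)
    then show ?thesis by (simp add: theta4_minus[OF tau])
  qed
  have K0: "ell_K \<tau> \<noteq> 0" by (rule ell_K_nonzero[OF tau re])
  have Z: "Ztilde \<tau> (of_real c - tb e) = - (of_real pi / (2 * ell_K \<tau>)) * ?M (of_real (y - c))" for c
    using odd[of "of_real (y - c)"] unfolding Ztilde_def tb by simp
  show ?thesis unfolding edge_const_def d Z using K0 by (simp add: field_simps)
qed

text \<open>
  The contour in the definition of \<open>A\<close> is chosen among the contours of all three phases. The phases
  are disjoint, being distinguished by \<open>Im u0\<close>, and each of them admits a contour; so the chosen one is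
  of the kind that belongs to the phase of \<open>u0\<close>.
\<close>

lemma contour_cases:
  assumes e: "e \<in> edges G" and ab: "edge_angles G \<alpha> e a b" and u0: "u0 \<in> domain_D G \<alpha> \<tau>"
  shows "u0 \<in> gas_points \<tau> \<Longrightarrow> gas_contour \<tau> (sector a b) (contour e)"
    and "u0 \<in> liquid_points G \<alpha> \<tau> \<Longrightarrow> liquid_contour \<tau> (sector a b) u0 (contour e)"
    and "u0 \<in> liquid_points G \<alpha> \<tau> \<Longrightarrow> 0 < Im u0 \<and> Im u0 < pi / 2 * Im \<tau>"
    and "u0 \<in> solid_points G \<alpha> \<Longrightarrow> solid_contour G \<alpha> \<tau> (sector a b) u0 (contour e)"
proof -
  have lt: "a < b" "b < a + pi" using ab by (simp_all add: edge_angles_def)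
  have x: "(a + pi + b) / 2 \<notin> sector a b" by (rule not_in_sector) (use lt in \<open>simp_all add: field_simps\<close>)
  have liq: "0 < Im u0 \<and> Im u0 < pi / 2 * Im \<tau>" if l: "u0 \<in> liquid_points G \<alpha> \<tau>"
  proof -
    obtain d where d: "d > 0" "ball u0 d \<subseteq> domain_D G \<alpha> \<tau>"
      using l unfolding liquid_points_def mem_interior by blast
    have "u0 + \<i> * of_real (d / 2) \<in> ball u0 d" "u0 - \<i> * of_real (d / 2) \<in> ball u0 d"
      using d(1) by (simp_all add: dist_norm norm_mult)
    then have "u0 + \<i> * of_real (d / 2) \<in> domain_D G \<alpha> \<tau>" "u0 - \<i> * of_real (d / 2) \<in> domain_D G \<alpha> \<tau>" using d(2) by blast+
    then show ?thesis using d(1) by (simp add: domain_D_def)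
  qed
  then show "u0 \<in> liquid_points G \<alpha> \<tau> \<Longrightarrow> 0 < Im u0 \<and> Im u0 < pi / 2 * Im \<tau>" .
  have gas: "Im u0 = pi / 2 * Im \<tau>" if "u0 \<in> gas_points \<tau>" using that by (simp add: gas_points_def)
  have sol: "Im u0 = 0 \<and> Re u0 \<notin> angle_points G \<alpha>" if "u0 \<in> solid_points G \<alpha>" using that by (auto simp: solid_points_def)
  have ex: "is_contour G \<alpha> \<tau> (sector a b) u0 (contour e)" if "\<exists>C. is_contour G \<alpha> \<tau> (sector a b) u0 C"
    unfolding contour_def sector_edge[OF e ab] using that by (rule someI_ex)
  show "gas_contour \<tau> (sector a b) (contour e)" if g: "u0 \<in> gas_points \<tau>"
  proof -
    have "\<exists>C. is_contour G \<alpha> \<tau> (sector a b) u0 C"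
      unfolding is_contour_def using g gas_contour_exists[OF tau re x] by blast
    moreover have "u0 \<notin> liquid_points G \<alpha> \<tau>" "u0 \<notin> solid_points G \<alpha>" using gas[OF g] liq sol tau by auto
    ultimately show ?thesis using ex unfolding is_contour_def by blast
  qed
  show "liquid_contour \<tau> (sector a b) u0 (contour e)" if g: "u0 \<in> liquid_points G \<alpha> \<tau>"
  proof -
    have "\<exists>C. is_contour G \<alpha> \<tau> (sector a b) u0 C"
      unfolding is_contour_def using g liquid_contour_exists[OF tau re _ _ x] liq[OF g] by blast
    moreover have "u0 \<notin> gas_points \<tau>" "u0 \<notin> solid_points G \<alpha>" using liq[OF g] gas sol by auto
    ultimately show ?thesis using ex unfolding is_contour_def by blast
  qed
  show "solid_contour G \<alpha> \<tau> (sector a b) u0 (contour e)" if g: "u0 \<in> solid_points G \<alpha>"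
  proof -
    have "\<exists>C. is_contour G \<alpha> \<tau> (sector a b) u0 C"
      unfolding is_contour_def using g solid_contour_exists[OF tau re lt refl] sol[OF g] by blast
    moreover have "u0 \<notin> gas_points \<tau>" "u0 \<notin> liquid_points G \<alpha> \<tau>" using liq gas sol[OF g] tau by auto
    ultimately show ?thesis using ex unfolding is_contour_def by blast
  qed
qed

lemma gas_probability:
  assumes e: "e \<in> edges G" and ab: "edge_angles G \<alpha> e a b" and u0: "u0 \<in> domain_D G \<alpha> \<tau>" "u0 \<in> gas_points \<tau>"
  shows "complex_of_real (edge_prob P e) = of_real (b - a) / of_real pi + \<i> * \<tau> / 2 * edge_const e a b"
proof -
  have C: "gas_contour \<tau> (sector a b) (contour e)" by (rule contour_cases(1)[OF e ab u0])
  have le: "a \<le> b" using ab by (simp add: edge_angles_def)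
  have sub: "path_image (contour e) \<subseteq> slit_domain \<tau> a b"
    by (rule path_image_subset_slit_domain[OF tau re]) (use C in \<open>auto simp: gas_contour_def\<close>)
  have "pathstart (contour e) \<in> slit_domain \<tau> a b" using sub pathstart_in_path_image by blast
  then have L: "dlog_theta_integral \<tau> a b (pathfinish (contour e)) - dlog_theta_integral \<tau> a b (pathstart (contour e)) = - 2 * \<i> * of_real (b - a)"
    and D: "pathfinish (contour e) - pathstart (contour e) = of_real pi * \<tau>"
    using C dlog_theta_integral_add_tau[OF tau _ le] by (simp_all add: gas_contour_def)
  have "complex_of_real (edge_prob P e) = \<i> / (2 * of_real pi) * (- 2 * \<i> * of_real (b - a) + edge_const e a b * (of_real pi * \<tau>))"
  proof (rule edge_prob_contour[OF e ab])
    show "((\<lambda>u. dlog_theta \<tau> (u - of_real a) - dlog_theta \<tau> (u - of_real b) + edge_const e a b) has_contour_integral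
      (- 2 * \<i> * of_real (b - a) + edge_const e a b * (of_real pi * \<tau>))) (contour e)"
      using has_contour_integral_dlog_theta[OF tau _ sub le, of "edge_const e a b"] C unfolding L D by (simp add: gas_contour_def)
  qed (use C in \<open>auto simp: gas_contour_def\<close>)
  then show ?thesis by (simp add: field_simps)
qed

lemma liquid_probability:
  assumes e: "e \<in> edges G" and ab: "edge_angles G \<alpha> e a b" and u0: "u0 \<in> domain_D G \<alpha> \<tau>" "u0 \<in> liquid_points G \<alpha> \<tau>"
  shows "complex_of_real (edge_prob P e) = \<i> / (2 * of_real pi) *
    (dlog_theta_integral \<tau> a b u0 - dlog_theta_integral \<tau> a b (cnj u0) + edge_const e a b * (u0 - cnj u0))"
proof (rule edge_prob_contour[OF e ab])
  have C: "liquid_contour \<tau> (sector a b) u0 (contour e)" by (rule contour_cases(2)[OF e ab u0])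
  have le: "a \<le> b" using ab by (simp add: edge_angles_def)
  have sub: "path_image (contour e) \<subseteq> slit_domain \<tau> a b"
    by (rule path_image_subset_slit_domain[OF tau re]) (use C in \<open>auto simp: liquid_contour_def\<close>)
  show "((\<lambda>u. dlog_theta \<tau> (u - of_real a) - dlog_theta \<tau> (u - of_real b) + edge_const e a b) has_contour_integral
    (dlog_theta_integral \<tau> a b u0 - dlog_theta_integral \<tau> a b (cnj u0) + edge_const e a b * (u0 - cnj u0))) (contour e)"
    using has_contour_integral_dlog_theta[OF tau _ sub le, of "edge_const e a b"] C by (simp add: liquid_contour_def)
  fix x y :: real assume "x \<in> {0..<1}" "y \<in> {0..<1}" "torus_eq \<tau> (contour e x) (contour e y)"
  moreover then have "x \<in> {0..1}" "y \<in> {0..1}" by auto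
  ultimately show "x = y" using C unfolding liquid_contour_def by blast
qed

lemma angle_points_edge:
  assumes e: "e \<in> edges G" and ab: "edge_angles G \<alpha> e a b"
  shows "a + of_int k * pi \<in> angle_points G \<alpha>" "b + of_int k * pi \<in> angle_points G \<alpha>"
proof -
  obtain m n :: int where "a = \<alpha> (alpha_track G e) + of_int m * pi" "b = \<alpha> (beta_track G e) + of_int n * pi"
    using edge_angles_lift[OF ab] .
  then have *: "\<alpha> (alpha_track G e) = a + of_int k * pi + of_int (- m - k) * pi" "\<alpha> (beta_track G e) = b + of_int k * pi + of_int (- n - k) * pi"
    by (simp_all add: algebra_simps)
  have "[a + of_int k * pi = \<alpha> (alpha_track G e)] (rmod pi)" "[b + of_int k * pi = \<alpha> (beta_track G e)] (rmod pi)"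
    unfolding rcong_altdef by (rule exI, rule *(1), rule exI, rule *(2))
  then show "a + of_int k * pi \<in> angle_points G \<alpha>" "b + of_int k * pi \<in> angle_points G \<alpha>"
    unfolding angle_points_def using alpha_beta_tracks[OF e] by blast+
qed

lemma solid_probability:
  assumes e: "e \<in> edges G" and ab: "edge_angles G \<alpha> e a b" and u0: "u0 \<in> domain_D G \<alpha> \<tau>" "u0 \<in> solid_points G \<alpha>"
  shows "edge_prob P e = (if \<exists>k::int. a < Re u0 + of_int k * pi \<and> Re u0 + of_int k * pi < b then 1 else 0)"
proof -
  let ?c = "\<exists>k::int. a < Re u0 + of_int k * pi \<and> Re u0 + of_int k * pi < b"
  have C: "solid_contour G \<alpha> \<tau> (sector a b) u0 (contour e)" by (rule contour_cases(4)[OF e ab u0])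
  have lt: "a < b" "b < a + pi" using ab by (simp_all add: edge_angles_def)
  have vp: "valid_path (contour e)" and cl: "pathfinish (contour e) = pathstart (contour e)"
    using C by (simp_all add: solid_contour_def)
  have "((\<lambda>u. edge_const e a b) has_contour_integral edge_const e a b * pathfinish (contour e) - edge_const e a b * pathstart (contour e)) (contour e)"
    by (rule contour_integral_primitive[where S = UNIV and f = "\<lambda>u. edge_const e a b * u"])
       (auto intro!: derivative_eq_intros vp)
  then have c: "((\<lambda>u. edge_const e a b) has_contour_integral 0) (contour e)" unfolding cl by simp
  have "complex_of_real (edge_prob P e) = \<i> / (2 * of_real pi) * ((if ?c then - 2 * of_real pi * \<i> else 0) + 0)"
    by (rule edge_prob_contour[OF e ab _ has_contour_integral_add[OF solid_contour_integral[OF tau re C lt angle_points_edge[OF e ab]] c]])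
       (use C in \<open>auto simp: solid_contour_def\<close>)
  also have "\<dots> = complex_of_real (if ?c then 1 else 0)" by (cases ?c) simp_all
  finally show ?thesis by (simp only: of_real_eq_iff)
qed

lemma countable_edges: "countable (edges G)"
proof -
  have "edges G = (\<Union>n::nat. {p \<in> edges G. path_image p \<inter> cball 0 (real n) \<noteq> {}})"
  proof
    show "edges G \<subseteq> (\<Union>n::nat. {p \<in> edges G. path_image p \<inter> cball 0 (real n) \<noteq> {}})"
    proof
      fix p assume p: "p \<in> edges G"
      obtain n :: nat where "norm (p 0) \<le> real n" using real_arch_simple by blast
      then have "p 0 \<in> path_image p \<inter> cball 0 (real n)" by (auto simp: path_image_def)
      then show "p \<in> (\<Union>n::nat. {p \<in> edges G. path_image p \<inter> cball 0 (real n) \<noteq> {}})" using p by blast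
    qed
  qed blast
  moreover have "finite {p \<in> edges G. path_image p \<inter> cball 0 (real n) \<noteq> {}}" for n :: nat
    using bip by (simp add: bipartite_plane_graph_def embedded_arcs_def)
  then have "countable (\<Union>n::nat. {p \<in> edges G. path_image p \<inter> cball 0 (real n) \<noteq> {}})"
    by (intro countable_UN countableI_type) (rule countable_finite)
  ultimately show ?thesis by (simp only:)
qed

text \<open>
  Countably many events of probability \<open>0\<close> or \<open>1\<close> hold or fail simultaneously almost surely. The
  common configuration belongs to the probability space because the latter is not a null set.
\<close>

lemma deterministic:
  assumes zo: "\<And>e. e \<in> edges G \<Longrightarrow> edge_prob P e = 0 \<or> edge_prob P e = 1"
  shows "{e \<in> edges G. edge_prob P e = 1} \<in> dimer_configs G"
    and "AE \<omega> in P. \<omega> = {e \<in> edges G. edge_prob P e = 1}"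
proof -
  have gm: "prob_space P" "space P = dimer_configs G"
    "sets P = sigma_sets (dimer_configs G) ((\<lambda>e. {\<omega> \<in> dimer_configs G. e \<in> \<omega>}) ` edges G)"
    using isP unfolding is_P_def gibbs_measure_def by blast+
  interpret prob_space P by (rule gm(1))
  have ev: "{\<omega> \<in> space P. e \<in> \<omega>} \<in> sets P" if "e \<in> edges G" for e
    unfolding gm(2,3) using that by (intro sigma_sets.Basic) auto
  have "AE \<omega> in P. e \<in> \<omega> \<longleftrightarrow> edge_prob P e = 1" if e: "e \<in> edges G" for e
  proof (cases "edge_prob P e = 1")
    case True
    then have "AE \<omega> in P. \<omega> \<in> {\<omega> \<in> space P. e \<in> \<omega>}"
      unfolding edge_prob_def by (rule AE_prob_1)
    then show ?thesis using True by (auto elim: AE_mp)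
  next
    case False
    then have "prob {\<omega> \<in> space P. e \<in> \<omega>} = 0" using zo[OF e] by (simp add: edge_prob_def)
    then have "AE \<omega> in P. \<omega> \<notin> {\<omega> \<in> space P. e \<in> \<omega>}" using prob_eq_0[OF ev[OF e]] by blast
    then have "AE \<omega> in P. e \<notin> \<omega>" using AE_space by eventually_elim simp
    then show ?thesis using False by simp
  qed
  then have "AE \<omega> in P. \<forall>e\<in>edges G. e \<in> \<omega> \<longleftrightarrow> edge_prob P e = 1"
    unfolding AE_ball_countable[OF countable_edges] by blast
  moreover have "AE \<omega> in P. \<omega> \<in> space P" by (rule AE_space)
  ultimately show ae: "AE \<omega> in P. \<omega> = {e \<in> edges G. edge_prob P e = 1}"
  proof eventually_elim
    case (elim \<omega>)
    then have "\<omega> \<subseteq> edges G" unfolding gm(2) dimer_configs_def by blast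
    then show ?case using elim(1) by blast
  qed
  show "{e \<in> edges G. edge_prob P e = 1} \<in> dimer_configs G"
  proof (rule ccontr)
    assume n: "{e \<in> edges G. edge_prob P e = 1} \<notin> dimer_configs G"
    from ae AE_space have "AE \<omega> in P. False"
    proof eventually_elim
      case (elim \<omega>)
      then show ?case using n gm(2) by simp
    qed
    then show False by (simp add: AE_False)
  qed
qed

lemma unique_edge_at_black:
  assumes "\<And>e. e \<in> edges G \<Longrightarrow> edge_prob P e = 0 \<or> edge_prob P e = 1" and v: "v \<in> blacks G"
  shows "\<exists>!e. e \<in> edges G \<and> black e = v \<and> edge_prob P e = 1"
proof -
  have "\<exists>!e. e \<in> {e \<in> edges G. edge_prob P e = 1} \<and> v \<in> {white e, black e}"
    using deterministic(1)[OF assms(1)] v unfolding dimer_configs_def by blast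
  moreover have "v \<noteq> white e" if "e \<in> edges G" for e
    using v white_neq_black[OF that] by (fastforce simp: blacks_def)
  ultimately show ?thesis by (smt (verit) insert_iff mem_Collect_eq singletonD)
qed

end

theorem proposition44:
  fixes G :: plane_graph and \<alpha> :: "track \<Rightarrow> real" and \<tau> t v0 u0 :: complex
    and \<eta> :: "complex \<Rightarrow> real" and s :: "complex \<Rightarrow> complex \<Rightarrow> real set"
    and P :: "curve set measure"
  assumes "minimal_graph G"
    and "\<alpha> \<in> angle_maps G"
    and "Re \<tau> = 0" and "Im \<tau> > 0"
    and "\<exists>r. t = of_real r + of_real pi / 2 * \<tau>"
    and "periodic_extension_property G \<alpha>"
    and "abel_map G \<alpha> v0 \<eta>"
    and "sector_system G \<alpha> \<tau> t \<eta> s"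
    and "u0 \<in> domain_D G \<alpha> \<tau>"
    and "is_P G \<alpha> \<tau> t \<eta> s u0 P"
  shows "(u0 \<in> gas_points \<tau> \<longrightarrow>
       (\<forall>e\<in>edges G. \<forall>a b. edge_angles G \<alpha> e a b \<longrightarrow>
          (let t\<^sub>b = t - of_real pi / 2 * \<tau> + of_real (\<eta> (black e)) in
           of_real (edge_prob P e) =
             (of_real b - of_real a) / of_real pi +
             ell_K' \<tau> / of_real pi * (Ztilde \<tau> (of_real b - t\<^sub>b) - Ztilde \<tau> (of_real a - t\<^sub>b)) \<and>
           of_real (edge_prob P e) = H_fun \<tau> (of_real b - t\<^sub>b) - H_fun \<tau> (of_real a - t\<^sub>b))))
    \<and> (u0 \<in> liquid_points G \<alpha> \<tau> \<longrightarrow>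
       (\<forall>e\<in>edges G. \<forall>a b. edge_angles G \<alpha> e a b \<longrightarrow>
          (let t\<^sub>b = t - of_real pi / 2 * \<tau> + of_real (\<eta> (black e)) in
           \<exists>d. log_variation (\<lambda>u. theta \<tau> (of_real u - u0) / theta \<tau> (of_real u - cnj u0)) a b d \<and>
             of_real (edge_prob P e) =
               1 / (2 * of_real pi * \<i>) * d -
               \<i> * ell_K \<tau> / (of_real pi)\<^sup>2 * (u0 - cnj u0) *
               (Ztilde \<tau> (of_real b - t\<^sub>b) - Ztilde \<tau> (of_real a - t\<^sub>b)))))
    \<and> (u0 \<in> solid_points G \<alpha> \<longrightarrow>
       (\<forall>e\<in>edges G. \<forall>a b. edge_angles G \<alpha> e a b \<longrightarrow>
          edge_prob P e =
            (if \<exists>k::int. a < Re u0 + of_int k * pi \<and> Re u0 + of_int k * pi < b then 1 else 0)) \<and>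
       (\<forall>v\<in>blacks G. \<exists>!e. e \<in> edges G \<and> black e = v \<and> edge_prob P e = 1) \<and>
       (\<exists>\<omega>\<in>dimer_configs G. AE \<omega>' in P. \<omega>' = \<omega>))"
proof -
  interpret dimer_setting G \<alpha> \<tau> t v0 u0 \<eta> s P
    using assms unfolding minimal_graph_def by unfold_locales blast+
  let ?tb = "\<lambda>e. t - of_real pi / 2 * \<tau> + of_real (\<eta> (black e))"
  note u0 = \<open>u0 \<in> domain_D G \<alpha> \<tau>\<close>
  have gas: "of_real (edge_prob P e) = (of_real b - of_real a) / of_real pi +
      ell_K' \<tau> / of_real pi * (Ztilde \<tau> (of_real b - ?tb e) - Ztilde \<tau> (of_real a - ?tb e))"
    if "u0 \<in> gas_points \<tau>" "e \<in> edges G" "edge_angles G \<alpha> e a b" for e a b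
    unfolding gas_probability[OF that(2,3) u0 that(1)] edge_const_eq ell_K'_def
    by (simp add: field_simps)
  have gas': "of_real (edge_prob P e) = H_fun \<tau> (of_real b - ?tb e) - H_fun \<tau> (of_real a - ?tb e)"
    if "u0 \<in> gas_points \<tau>" "e \<in> edges G" "edge_angles G \<alpha> e a b" for e a b
    unfolding gas[OF that] H_fun_def by (simp add: field_simps)
  have liquid: "\<exists>d. log_variation (\<lambda>u. theta \<tau> (of_real u - u0) / theta \<tau> (of_real u - cnj u0)) a b d \<and>
      of_real (edge_prob P e) = 1 / (2 * of_real pi * \<i>) * d - \<i> * ell_K \<tau> / (of_real pi)\<^sup>2 * (u0 - cnj u0) *
        (Ztilde \<tau> (of_real b - ?tb e) - Ztilde \<tau> (of_real a - ?tb e))"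
    if "u0 \<in> liquid_points G \<alpha> \<tau>" "e \<in> edges G" "edge_angles G \<alpha> e a b" for e a b
  proof (intro exI conjI)
    have Im: "0 < Im u0 \<and> Im u0 < pi / 2 * Im \<tau>" by (rule contour_cases(3)[OF that(2,3) u0 that(1)])
    moreover have "0 < pi * Im \<tau>" using tau by simp
    ultimately have "0 < Im u0" "Im u0 < pi * Im \<tau>" by simp_all
    moreover have "a \<le> b" using that(3) by (simp add: edge_angles_def)
    ultimately show "log_variation (\<lambda>u. theta \<tau> (of_real u - u0) / theta \<tau> (of_real u - cnj u0)) a b
       (dlog_theta_integral \<tau> a b (cnj u0) - dlog_theta_integral \<tau> a b u0)"
      using log_variation_theta_quotient[OF tau _ _ re] by blast
    show "of_real (edge_prob P e) = 1 / (2 * of_real pi * \<i>) * (dlog_theta_integral \<tau> a b (cnj u0) - dlog_theta_integral \<tau> a b u0)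
       - \<i> * ell_K \<tau> / (of_real pi)\<^sup>2 * (u0 - cnj u0) *
        (Ztilde \<tau> (of_real b - ?tb e) - Ztilde \<tau> (of_real a - ?tb e))"
      unfolding liquid_probability[OF that(2,3) u0 that(1)] edge_const_eq
      by (simp add: divide_simps power2_eq_square) (simp add: algebra_simps)
  qed
  have solid: "edge_prob P e = (if \<exists>k::int. a < Re u0 + of_int k * pi \<and> Re u0 + of_int k * pi < b then 1 else 0)"
    if "u0 \<in> solid_points G \<alpha>" "e \<in> edges G" "edge_angles G \<alpha> e a b" for e a b
    by (rule solid_probability[OF that(2,3) u0 that(1)])
  have zo: "edge_prob P e = 0 \<or> edge_prob P e = 1" if sol: "u0 \<in> solid_points G \<alpha>" "e \<in> edges G" for e
  proof -
    obtain a b where "edge_angles G \<alpha> e a b" using edge_angles_exist[OF sol(2)] .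
    from solid[OF sol this] show ?thesis by (auto split: if_splits)
  qed
  show ?thesis
    unfolding Let_def
  proof (intro conjI impI ballI allI)
    fix v assume "u0 \<in> solid_points G \<alpha>" "v \<in> blacks G"
    then show "\<exists>!e. e \<in> edges G \<and> black e = v \<and> edge_prob P e = 1" using unique_edge_at_black zo by blast
  next
    assume "u0 \<in> solid_points G \<alpha>"
    then show "\<exists>\<omega>\<in>dimer_configs G. AE \<omega>' in P. \<omega>' = \<omega>" using deterministic zo by blast
  qed (erule (2) gas gas' liquid solid)+
qed

end
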